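(* Let $\mathcal X,\mathcal Y$ be finite sets, let $P_{XY}$ be a probability measure on $\mathcal X\times\mathcal Y$ with marginals $P_X,P_Y$, and consider testing against independence: $$H_0:\ P_{XY}(x,y),\qquad H_1:\ P_{\bar X\bar Y}(x,y)=P_X(x)P_Y(y),\qquad (x,y)\in\mathcal X\times\mathcal Y .$$ Let $R\ge0$ be the available total rate of interaction. Then the optimal error exponent of the Type II error probability with one round of interaction ($K=1$) satisfies $$\lim_{\epsilon\to0}\ \liminf_{n\to\infty}-\frac1n\log\beta_n(R,\epsilon\,|\,K=1)\ =\ E(R),$$ where $$E(R)=\max_{\substack{P_{U|X}:\ \mathcal X\to\mathcal P(\mathcal U),\ \ P_{V|UY}:\ \mathcal U\times\mathcal Y\to\mathcal P(\mathcal V)\\ I(U;X)+I(V;Y|U)\le R}}\big[I(U;Y)+I(V;X|U)\big],$$ the maximum being over all finite sets $\mathcal U,\mathcal V$ and all stochastic kernels $P_{U|X},P_{V|UY}$ satisfying the rate constraint, and the mutual informations being computed under the joint law $P_{XY}(x,y)P_{U|X}(u|x)P_{V|UY}(v|u,y)$.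
   Context: All logarithms and exponentials are in base 2; $I(\cdot;\cdot)$, $I(\cdot;\cdot|\cdot)$ are (conditional) mutual information, and $\mathcal P(\mathcal Z)$ is the set of probability measures on a finite set $\mathcal Z$. Collaborative hypothesis testing. Node $A$ observes $X^n$ and node $B$ observes $Y^n$, where $(X_i,Y_i)_{i=1}^n$ are i.i.d. with law $P_{XY}$ under $H_0$ and $P_{\bar X\bar Y}$ under $H_1$. A one-round ($K=1$) code of blocklength $n$ consists of encoders $$f_{[1]}:\mathcal X^n\to\{1,\dots,|f_{[1]}|\},\qquad g_{[1]}:\mathcal Y^n\times\{1,\dots,|f_{[1]}|\}\to\{1,\dots,|g_{[1]}|\},$$ and a decision map $\phi:\mathcal X^n\times\{1,\dots,|g_{[1]}|\}\to\{0,1\}$, where $|f_{[1]}|,|g_{[1]}|$ denote the sizes of the ranges. With $J=g_{[1]}(Y^n,f_{[1]}(X^n))$, the Type I and Type II error probabilities are $$\alpha_n=\Pr[\phi(X^n,J)=1\mid (X_i,Y_i)\text{ i.i.d. }\sim P_{XY}],\qquad \beta_n=\Pr[\phi(X^n,J)=0\mid (X_i,Y_i)\text{ i.i.d. }\sim P_{\bar X\bar Y}].$$ For $0<\epsilon<1$, a number $E$ is a feasible exponent for $(R,\epsilon)$ if for every $\varepsilon>0$ and all sufficiently large $n$ there is a one-round code of blocklength $n$ with $$-\tfrac1n\log\beta_n\ge E-\varepsilon,\qquad \tfrac1n\log\big(|f_{[1]}||g_{[1]}|\big)\le R+\varepsilon,\qquad \alpha_n\le\epsilon .$$ The expression $\liminf_{n\to\infty}-\frac1n\log\beta_n(R,\epsilon|K=1)$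 denotes the optimal error exponent for $(R,\epsilon)$, i.e. the supremum of all feasible exponents. It is nondecreasing in $\epsilon$; $\lim_{\epsilon\to0}$ means $\epsilon\downarrow0$. *)

theory Defs
  imports "HOL-Probability.Probability"
begin

text \<open>
  Codewords are natural numbers, \<open>F\<close> and \<open>G\<close> are the sizes of the two message sets, and length-\<open>n\<close>
  sequences are lists; nothing is required of the maps outside the stated domains.
\<close>

definition one_round_code ::
  "nat \<Rightarrow> nat \<Rightarrow> nat \<Rightarrow> ('x list \<Rightarrow> nat) \<Rightarrow> ('y list \<times> nat \<Rightarrow> nat) \<Rightarrow> ('x list \<times> nat \<Rightarrow> nat) \<Rightarrow> bool"
  where
  "one_round_code n F G f g \<phi> \<longleftrightarrow>
     f \<in> {xs. length xs = n} \<rightarrow> {1..F} \<and>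
     g \<in> {ys. length ys = n} \<times> {1..F} \<rightarrow> {1..G} \<and>
     \<phi> \<in> {xs. length xs = n} \<times> {1..G} \<rightarrow> {0, 1}"

text \<open>Probability that the decision is \<open>d\<close> when the pairs \<open>(X\<^sub>i, Y\<^sub>i)\<close> are i.i.d. with law \<open>P\<close>.\<close>

definition decision_prob ::
  "nat \<Rightarrow> ('x \<times> 'y) pmf \<Rightarrow> ('x list \<Rightarrow> nat) \<Rightarrow> ('y list \<times> nat \<Rightarrow> nat) \<Rightarrow> ('x list \<times> nat \<Rightarrow> nat)
    \<Rightarrow> nat \<Rightarrow> real"
  where
  "decision_prob n P f g \<phi> d =
     measure_pmf.prob (replicate_pmf n P)
       {zs. let xs = map fst zs; ys = map snd zs; j = g (ys, f xs) in \<phi> (xs, j) = d}"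

text \<open>The case distinction is needed because \<open>log 2 0 = 0\<close>.\<close>

definition error_exponent :: "nat \<Rightarrow> real \<Rightarrow> ereal" where
  "error_exponent n \<beta> = (if \<beta> = 0 then \<infinity> else ereal (- (1 / real n) * log 2 \<beta>))"

definition feasible_exponent ::
  "('x \<times> 'y) pmf \<Rightarrow> ('x \<times> 'y) pmf \<Rightarrow> real \<Rightarrow> real \<Rightarrow> real \<Rightarrow> bool"
  where
  "feasible_exponent P Q R \<epsilon> E \<longleftrightarrow>
     (\<forall>\<delta>>0. \<forall>\<^sub>F n in sequentially. \<exists>F G f g \<phi>.
        one_round_code n F G f g \<phi> \<and>
        error_exponent n (decision_prob n Q f g \<phi> 0) \<ge> ereal (E - \<delta>) \<and>
        (1 / real n) * log 2 (real F * real G) \<le> R + \<delta> \<and>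
        decision_prob n P f g \<phi> 1 \<le> \<epsilon>)"

definition optimal_exponent ::
  "('x \<times> 'y) pmf \<Rightarrow> ('x \<times> 'y) pmf \<Rightarrow> real \<Rightarrow> real \<Rightarrow> ereal"
  where
  "optimal_exponent P Q R \<epsilon> = Sup (ereal ` {E. feasible_exponent P Q R \<epsilon> E})"

definition independent_law :: "('x \<times> 'y) pmf \<Rightarrow> ('x \<times> 'y) pmf" where
  "independent_law P = pair_pmf (map_pmf fst P) (map_pmf snd P)"

definition pmf_MI :: "'a pmf \<Rightarrow> ('a \<Rightarrow> 'b) \<Rightarrow> ('a \<Rightarrow> 'c) \<Rightarrow> real" where
  "pmf_MI W A B =
     prob_space.mutual_information (measure_pmf W) 2 (count_space UNIV) (count_space UNIV) A B"

definition pmf_cond_MI :: "'a pmf \<Rightarrow> ('a \<Rightarrow> 'b) \<Rightarrow> ('a \<Rightarrow> 'c) \<Rightarrow> ('a \<Rightarrow> 'd) \<Rightarrow> real" where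
  "pmf_cond_MI W A B C =
     prob_space.conditional_mutual_information (measure_pmf W) 2
       (count_space UNIV) (count_space UNIV) (count_space UNIV) A B C"

definition joint_law ::
  "('x \<times> 'y) pmf \<Rightarrow> ('x \<Rightarrow> 'u pmf) \<Rightarrow> ('u \<times> 'y \<Rightarrow> 'v pmf) \<Rightarrow> ('x \<times> 'y \<times> 'u \<times> 'v) pmf"
  where
  "joint_law P K L =
     do {(x, y) \<leftarrow> P; u \<leftarrow> K x; v \<leftarrow> L (u, y); return_pmf (x, y, u, v)}"

text \<open>
  The values \<open>I(U;Y) + I(V;X|U)\<close> over which the exponent is maximized. Every finite alphabet is, up
  to relabelling, a finite set of natural numbers, so \<open>\<U>\<close> and \<open>\<V>\<close> range over those.
\<close>

definition exponent_values :: "('x \<times> 'y) pmf \<Rightarrow> real \<Rightarrow> real set" where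
  "exponent_values P R =
     {e. \<exists>(\<U> :: nat set) (\<V> :: nat set) K L W X Y U V.
        finite \<U> \<and> finite \<V> \<and>
        (\<forall>x. set_pmf (K x) \<subseteq> \<U>) \<and>
        (\<forall>u\<in>\<U>. \<forall>y. set_pmf (L (u, y)) \<subseteq> \<V>) \<and>
        W = joint_law P K L \<and>
        X = (\<lambda>(x, y, u, v). x) \<and> Y = (\<lambda>(x, y, u, v). y) \<and>
        U = (\<lambda>(x, y, u, v). u) \<and> V = (\<lambda>(x, y, u, v). v) \<and>
        pmf_MI W U X + pmf_cond_MI W V Y U \<le> R \<and>
        e = pmf_MI W U Y + pmf_cond_MI W V X U}"

definition is_maximum :: "real set \<Rightarrow> real \<Rightarrow> bool" where
  "is_maximum S m \<longleftrightarrow> m \<in> S \<and> (\<forall>s\<in>S. s \<le> m)"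

end

theory Submission
  imports Defs "HOL-Real_Asymp.Real_Asymp"
begin

text \<open>
  Write \<open>r = I(U;X) + I(V;Y|U) = I(UV;XY)\<close> and \<open>e = I(U;Y) + I(V;X|U) = I(X;Y) - I(X;Y|UV)\<close>.

  Attainment. Per value of \<open>(U, V)\<close>, both are positively homogeneous in the kernels, so Caratheodory's theorem
  bounds the alphabets, and a continuous function on a compact set of kernels remains.

  Converse. For a code with messages \<open>M\<^sub>1, M\<^sub>2\<close>, data processing bounds the exponent by \<open>e(M\<^sub>1, M\<^sub>2)\<close>, while
  \<open>r(M\<^sub>1, M\<^sub>2) = H(M\<^sub>1 M\<^sub>2)\<close>. With \<open>U\<^sub>i = (M\<^sub>1, X\<^sub>1..X\<^sub>i\<^sub>-\<^sub>1, Y\<^sub>i\<^sub>+\<^sub>1..Y\<^sub>n)\<close> and \<open>V\<^sub>i = M\<^sub>2\<close> the sums of the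
  single-letter rates and of the exponents exceed \<open>r\<close> and \<open>e\<close> by the same \<open>d \<ge> 0\<close>. As \<open>e \<le> r\<close>, time
  sharing with the trivial scheme removes \<open>d\<close>.

  Achievability. Both encoders choose a codeword of a random codebook with probability proportional to
  its likelihood, and reject when the codebook covers the observed sequence badly. A non-rejected triple
  then has at most its probability under the ideal law in which the codeword is uniform, which bounds the
  type II error for every codebook; soft covering bounds the rejection probability on average.
\<close>

section \<open>Entropy of finitely supported laws\<close>

text \<open>The two summands of the exponent come from two likelihood-ratio tests, one at each node.
  Node B compares y with the codeword u at a threshold near 2^(n I(U;Y)) and announces a failure by
  its rejection message; node A compares x with v, given u, at a threshold near 2^(n I(V;X|U)). Each
  passed test replaces a factor of the independent law by a law conditional on the codewords, at the
  price of one threshold, and the conditional laws have total mass at most 1.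

  Both halves speak about pairs (rate, exponent) instead of the function E(R), whose continuity is
  therefore never an issue: a code may exceed the rate R slightly, and convexity of the set of pairs
  trades this excess for an equal loss of exponent.

  The limit \<epsilon> \<rightarrow> 0 concerns the converse alone. The direct part reaches E(R) for
  each \<epsilon> > 0, whereas data processing only sees the accepted fraction 1 - \<epsilon> of the
  relative entropy and yields E(R) / (1 - \<epsilon>).\<close>

abbreviation expect :: "'w pmf \<Rightarrow> ('w \<Rightarrow> real) \<Rightarrow> real" where
  "expect W \<equiv> measure_pmf.expectation W"

lemma expect_sum:
  assumes "finite (set_pmf W)"
  shows "expect W h = (\<Sum>w\<in>set_pmf W. pmf W w * h w)"
  using integral_measure_pmf_real[OF assms, of W h] by (simp add: mult.commute)

lemma integrable_finite_pmf [simp]: "finite (set_pmf W) \<Longrightarrow> integrable (measure_pmf W) (h :: _ \<Rightarrow> real)"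
  by (rule integrable_measure_pmf_finite)

lemma expect_cong: "(\<And>w. w \<in> set_pmf W \<Longrightarrow> g w = h w) \<Longrightarrow> expect W g = expect W h"
  by (intro integral_cong_AE) (auto simp: AE_measure_pmf_iff)

lemma expect_mono:
  assumes "finite (set_pmf W)" "\<And>w. w \<in> set_pmf W \<Longrightarrow> g w \<le> h w"
  shows "expect W g \<le> expect W h"
  using assms by (intro integral_mono_AE) (auto simp: AE_measure_pmf_iff)

lemma expect_add:
  "finite (set_pmf W) \<Longrightarrow> expect W (\<lambda>w. g w + h w) = expect W g + expect W h"
  by (simp)

lemma expect_bind:
  assumes "finite (set_pmf W)" "\<And>w. w \<in> set_pmf W \<Longrightarrow> finite (set_pmf (K w))"
  shows "expect (bind_pmf W K) h = expect W (\<lambda>w. expect (K w) h)"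
proof -
  have fin: "finite (\<Union>w\<in>set_pmf W. set_pmf (K w))" (is "finite ?S") using assms by auto
  have "expect (bind_pmf W K) h = (\<Sum>z\<in>?S. pmf (bind_pmf W K) z * h z)"
    using fin expect_sum[of "bind_pmf W K" h] by simp
  also have "\<dots> = (\<Sum>z\<in>?S. (\<Sum>w\<in>set_pmf W. pmf W w * pmf (K w) z) * h z)"
    using assms by (simp add: pmf_bind expect_sum)
  also have "\<dots> = (\<Sum>w\<in>set_pmf W. pmf W w * (\<Sum>z\<in>?S. pmf (K w) z * h z))"
    by (simp add: sum_distrib_left sum_distrib_right mult.assoc) (rule sum.swap)
  also have "\<dots> = (\<Sum>w\<in>set_pmf W. pmf W w * expect (K w) h)"
  proof (intro sum.cong refl arg_cong2[where f="(*)"])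
    fix w assume w: "w \<in> set_pmf W"
    have "expect (K w) h = (\<Sum>z\<in>?S. h z * pmf (K w) z)"
      using w fin by (intro integral_measure_pmf_real) auto
    then show "(\<Sum>z\<in>?S. pmf (K w) z * h z) = expect (K w) h" by (simp add: mult.commute)
  qed
  also have "\<dots> = expect W (\<lambda>w. expect (K w) h)" using assms by (simp add: expect_sum)
  finally show ?thesis .
qed

text \<open>First-moment method; it extracts one good codebook from a random one.\<close>

lemma expect_le_obtain:
  assumes "finite (set_pmf W)" "expect W h \<le> c"
  obtains w where "w \<in> set_pmf W" "h w \<le> c"
proof (rule ccontr)
  assume "\<not> thesis"
  with that have gt: "\<And>w. w \<in> set_pmf W \<Longrightarrow> h w > c" by force
  have "c = (\<Sum>w\<in>set_pmf W. pmf W w * c)"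
    using assms(1) by (simp add: sum_pmf_eq_1 flip: sum_distrib_right)
  also have "\<dots> < (\<Sum>w\<in>set_pmf W. pmf W w * h w)"
    using assms(1) gt by (intro sum_strict_mono) (auto simp: set_pmf_not_empty pmf_positive)
  also have "\<dots> = expect W h" by (simp add: expect_sum assms)
  finally show False using assms by simp
qed

lemma pmf_map_sum:
  assumes "finite (set_pmf W)"
  shows "pmf (map_pmf A W) a = (\<Sum>w\<in>set_pmf W. if A w = a then pmf W w else 0)"
proof -
  have "pmf (map_pmf A W) a = measure W (A -` {a})" by (simp add: pmf_map)
  also have "\<dots> = measure W {w\<in>set_pmf W. A w = a}"
    by (intro measure_eq_AE) (auto simp: AE_measure_pmf_iff)
  also have "\<dots> = sum (pmf W) {w\<in>set_pmf W. A w = a}"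
    using assms by (intro measure_measure_pmf_finite) auto
  also have "\<dots> = (\<Sum>w\<in>set_pmf W. if A w = a then pmf W w else 0)"
    using assms by (simp add: sum.If_cases Int_def)
  finally show ?thesis .
qed

lemma pmf_marginal_sum:
  assumes "finite (set_pmf W)" "finite S" "\<And>w. w \<in> set_pmf W \<Longrightarrow> B w \<in> S"
  shows "(\<Sum>b\<in>S. pmf (map_pmf (\<lambda>w. (A w, B w)) W) (a, b)) = pmf (map_pmf A W) a"
proof -
  have "(\<Sum>b\<in>S. pmf (map_pmf (\<lambda>w. (A w, B w)) W) (a, b))
      = (\<Sum>w\<in>set_pmf W. \<Sum>b\<in>S. if A w = a \<and> B w = b then pmf W w else 0)"
    by (simp add: pmf_map_sum assms) (rule sum.swap)
  also have "\<dots> = (\<Sum>w\<in>set_pmf W. if A w = a then pmf W w else 0)"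
  proof (intro sum.cong refl)
    fix w assume w: "w \<in> set_pmf W"
    have "(\<Sum>b\<in>S. if A w = a \<and> B w = b then pmf W w else 0)
        = (\<Sum>b\<in>S. if B w = b then (if A w = a then pmf W w else 0) else 0)"
      by (intro sum.cong) auto
    also have "\<dots> = (if A w = a then pmf W w else 0)" using assms w by simp
    finally show "(\<Sum>b\<in>S. if A w = a \<and> B w = b then pmf W w else 0) = (if A w = a then pmf W w else 0)" .
  qed
  finally show ?thesis by (simp add: pmf_map_sum assms)
qed

text \<open>The marginal law of \<open>A\<close>, read as a random variable on the sample space. It
  depends only on the partition induced by \<open>A\<close>, so densities of tuples can be
  multiplied and compared whatever the types and the order of their components.\<close>

definition pr :: "'w pmf \<Rightarrow> ('w \<Rightarrow> 'a) \<Rightarrow> 'w \<Rightarrow> real" where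
  "pr W A w = measure_pmf.prob W {w'. A w' = A w}"

definition ent :: "'w pmf \<Rightarrow> ('w \<Rightarrow> 'a) \<Rightarrow> real" where
  "ent W A = - expect W (\<lambda>w. log 2 (pr W A w))"

lemma pmf_map_pr: "pmf (map_pmf A W) (A w) = pr W A w"
  by (auto simp: pr_def pmf_map vimage_def intro!: arg_cong[where f="measure W"])

lemma pr_pos: "w \<in> set_pmf W \<Longrightarrow> pr W A w > 0"
  by (auto simp: pmf_positive simp flip: pmf_map_pr)

lemma pr_le_1: "pr W A w \<le> 1" by (simp add: pr_def)

lemma pr_nonneg: "0 \<le> pr W A w" by (simp add: pr_def)

lemma pr_cong:
  assumes "w \<in> set_pmf W" "\<And>w w'. w \<in> set_pmf W \<Longrightarrow> w' \<in> set_pmf W \<Longrightarrow> A w = A w' \<longleftrightarrow> B w = B w'"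
  shows "pr W A w = pr W B w"
  unfolding pr_def using assms by (intro measure_eq_AE) (auto simp: AE_measure_pmf_iff)

text \<open>Entropy depends only on the partition of the support. This reorders tuples and drops
  components that are functions of the others.\<close>

lemma ent_cong:
  assumes "\<And>w w'. w \<in> set_pmf W \<Longrightarrow> w' \<in> set_pmf W \<Longrightarrow> A w = A w' \<longleftrightarrow> B w = B w'"
  shows "ent W A = ent W B"
  unfolding ent_def using pr_cong[OF _ assms, of _ W] by (auto intro!: expect_cong)

lemma pr_map: "pr (map_pmf h W) A (h w) = pr W (\<lambda>w. A (h w)) w"
  by (auto simp: pr_def vimage_def)

lemma ent_map: "ent (map_pmf h W) A = ent W (\<lambda>w. A (h w))"
  by (simp add: ent_def pr_map)

text \<open>The inequality ln t \<le> t - 1. The entropy bound, submodularity and data processing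
  below each reduce to exhibiting a ratio of mean at most 1.\<close>

lemma expect_log_le_0:
  assumes "finite (set_pmf W)" "\<And>w. w \<in> set_pmf W \<Longrightarrow> r w > 0" "expect W r \<le> 1"
  shows "expect W (\<lambda>w. log 2 (r w)) \<le> 0"
proof -
  have "expect W (\<lambda>w. log 2 (r w)) \<le> expect W (\<lambda>w. (r w - 1) / ln 2)"
    using assms by (intro expect_mono) (auto simp: log_def divide_right_mono ln_le_minus_one)
  also have "\<dots> = (expect W r - 1) / ln 2"
    using assms by (simp)
  also have "\<dots> \<le> 0" using assms by (simp add: divide_nonpos_pos)
  finally show ?thesis .
qed

lemma ent_le_log_card:
  assumes fin: "finite (set_pmf W)" and S: "finite S" "\<And>w. w \<in> set_pmf W \<Longrightarrow> A w \<in> S"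
  shows "ent W A \<le> log 2 (card S)"
proof -
  let ?Q = "map_pmf A W"
  have finQ: "finite (set_pmf ?Q)" using fin by simp
  have sub: "set_pmf ?Q \<subseteq> S" using S by auto
  have c: "card S > 0" using S set_pmf_not_empty[of W] by (auto simp: card_gt_0_iff)
  have "expect W (\<lambda>w. 1 / (card S * pr W A w)) = expect ?Q (\<lambda>a. 1 / (card S * pmf ?Q a))"
    by (simp add: pmf_map_pr)
  also have "\<dots> = (\<Sum>a\<in>set_pmf ?Q. 1 / card S)"
    unfolding expect_sum[OF finQ]
  proof (intro sum.cong refl)
    fix a assume "a \<in> set_pmf ?Q"
    then have "pmf ?Q a > 0" by (rule pmf_positive)
    then show "pmf ?Q a * (1 / (card S * pmf ?Q a)) = 1 / card S" by simp
  qed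
  also have "\<dots> \<le> 1" using card_mono[OF S(1) sub] c by (simp add: divide_le_eq)
  finally have le: "expect W (\<lambda>w. 1 / (card S * pr W A w)) \<le> 1" .
  have "0 \<ge> expect W (\<lambda>w. log 2 (1 / (card S * pr W A w)))"
    using c by (intro expect_log_le_0 fin le) (auto simp: pr_pos)
  also have "expect W (\<lambda>w. log 2 (1 / (card S * pr W A w)))
     = expect W (\<lambda>w. - log 2 (card S) - log 2 (pr W A w))"
    using c by (intro expect_cong) (auto simp: log_divide log_mult pr_pos less_imp_neq[THEN not_sym])
  also have "\<dots> = ent W A - log 2 (card S)" using fin by (simp add: ent_def)
  finally show ?thesis by simp
qed

text \<open>This is I(A;B|C) \<ge> 0. The ratio p(a,c) p(b,c) / (p(a,b,c) p(c)) compares the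
  conditionally independent law with the true one and has mean at most 1.\<close>

lemma ent_submodular:
  assumes fin: "finite (set_pmf W)"
  shows "ent W (\<lambda>w. (A w, B w, C w)) + ent W C \<le> ent W (\<lambda>w. (A w, C w)) + ent W (\<lambda>w. (B w, C w))"
proof -
  let ?ABC = "\<lambda>w. (A w, B w, C w)" and ?AC = "\<lambda>w. (A w, C w)" and ?BC = "\<lambda>w. (B w, C w)"
  let ?r = "\<lambda>w. pr W ?AC w * pr W ?BC w / (pr W ?ABC w * pr W C w)"
  let ?S = "set_pmf W"
  let ?h = "\<lambda>(a,b,c). pmf (map_pmf ?AC W) (a,c) * pmf (map_pmf ?BC W) (b,c) / pmf (map_pmf C W) c"
  have swap: "pmf (map_pmf (\<lambda>w. (f w, g w)) W) (a, c) = pmf (map_pmf (\<lambda>w. (g w, f w)) W) (c, a)" 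
    for f :: "'a \<Rightarrow> 'x" and g :: "'a \<Rightarrow> 'y" and a c
    by (simp add: pmf_map_sum fin conj_commute)
  have "expect W ?r = expect (map_pmf ?ABC W) (\<lambda>(a,b,c). ?h (a,b,c) / pmf (map_pmf ?ABC W) (a,b,c))"
    by (simp add: pmf_map_pr pmf_map_pr[of ?AC] pmf_map_pr[of ?BC] pmf_map_pr[of ?ABC] ac_simps)
  also have "\<dots> = (\<Sum>z\<in>?ABC ` ?S. ?h z)"
  proof -
    have "pmf (map_pmf ?ABC W) z \<noteq> 0" if "z \<in> ?ABC ` ?S" for z using that by (simp add: pmf_eq_0_set_pmf)
    then show ?thesis
      by (subst expect_sum) (use fin in \<open>auto intro!: sum.cong simp: split_beta\<close>)
  qed
  \<comment> \<open>The support of the triple need not fill the product of the three ranges, whence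
    an inequality; over the full product the sum factorizes for each c.\<close>
  also have "\<dots> \<le> (\<Sum>z\<in>(A ` ?S) \<times> (B ` ?S) \<times> (C ` ?S). ?h z)"
    using fin by (intro sum_mono2) auto
  also have "\<dots> = (\<Sum>a\<in>A ` ?S. \<Sum>b\<in>B ` ?S. \<Sum>c\<in>C ` ?S. ?h (a, b, c))"
    by (simp add: sum.cartesian_product)
  also have "\<dots> = (\<Sum>c\<in>C ` ?S. (\<Sum>a\<in>A ` ?S. pmf (map_pmf ?AC W) (a,c)) * (\<Sum>b\<in>B ` ?S. pmf (map_pmf ?BC W) (b,c)) / pmf (map_pmf C W) c)"
    unfolding sum_product sum_divide_distrib prod.case
    by (subst sum.swap[of _ "C ` ?S"], subst sum.swap[of _ "C ` ?S"]) (rule refl)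
  also have "\<dots> = (\<Sum>c\<in>C ` ?S. pmf (map_pmf C W) c * pmf (map_pmf C W) c / pmf (map_pmf C W) c)"
    unfolding swap[of A C] swap[of B C] using fin by (subst (1 2) pmf_marginal_sum) auto
  also have "\<dots> = (\<Sum>c\<in>C ` ?S. pmf (map_pmf C W) c)" by (intro sum.cong) auto
  also have "\<dots> = 1" using fin by (intro sum_pmf_eq_1) auto
  finally have "expect W ?r \<le> 1" .
  then have "0 \<ge> expect W (\<lambda>w. log 2 (?r w))"
    using fin by (intro expect_log_le_0) (auto simp: pr_pos)
  also have "expect W (\<lambda>w. log 2 (?r w)) = expect W (\<lambda>w. log 2 (pr W ?AC w) + log 2 (pr W ?BC w) - log 2 (pr W ?ABC w) - log 2 (pr W C w))"
    by (intro expect_cong) (simp add: log_mult log_divide pr_pos less_imp_neq[THEN not_sym])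
  also have "\<dots> = ent W ?ABC + ent W C - ent W ?AC - ent W ?BC"
    using fin by (simp add: ent_def)
  finally show ?thesis by simp
qed

text \<open>Data processing for relative entropy. The ratio \<open>?r\<close> divides the likelihood
  ratio of \<open>T\<close> by that of the outcome, so its mean under \<open>W\<close> is at most
  the mean under \<open>Q\<close> of the likelihood ratio of \<open>T\<close>.\<close>

lemma divergence_map_le:
  assumes fin: "finite (set_pmf W)" and finQ: "finite (set_pmf Q)" and ac: "set_pmf W \<subseteq> set_pmf Q"
  shows "expect W (\<lambda>w. log 2 (pr W T w / pr Q T w)) \<le> expect W (\<lambda>w. log 2 (pmf W w / pmf Q w))"
proof -
  let ?r = "\<lambda>w. pr W T w * pmf Q w / (pr Q T w * pmf W w)"
  let ?h = "\<lambda>w. pr W T w / pr Q T w"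
  have posW: "pmf W w > 0" "pr W T w > 0" "pmf Q w > 0" "pr Q T w > 0" if "w \<in> set_pmf W" for w
    using that ac by (auto simp: pmf_positive pr_pos)
  have "expect W ?r = (\<Sum>w\<in>set_pmf W. ?h w * pmf Q w)"
    unfolding expect_sum[OF fin] using posW by (intro sum.cong) (auto simp: less_imp_neq[THEN not_sym])
  also have "\<dots> \<le> (\<Sum>w\<in>set_pmf Q. ?h w * pmf Q w)"
    using finQ ac by (intro sum_mono2) (auto simp: pr_nonneg)
  also have "\<dots> = expect Q ?h" by (simp add: expect_sum finQ mult.commute)
  also have "\<dots> = expect (map_pmf T Q) (\<lambda>t. pmf (map_pmf T W) t / pmf (map_pmf T Q) t)"
    by (simp add: pmf_map_pr)
  also have "\<dots> = (\<Sum>t\<in>set_pmf (map_pmf T Q). pmf (map_pmf T W) t)"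
  proof -
    have "pmf (map_pmf T Q) t > 0" if "t \<in> set_pmf (map_pmf T Q)" for t using that by (rule pmf_positive)
    then show ?thesis using finQ by (subst expect_sum) (auto intro!: sum.cong simp: less_imp_neq[THEN not_sym])
  qed
  also have "\<dots> \<le> 1" using finQ fin
    by (subst measure_measure_pmf_finite[symmetric]) auto
  finally have "expect W ?r \<le> 1" .
  then have "0 \<ge> expect W (\<lambda>w. log 2 (?r w))"
    using fin posW by (intro expect_log_le_0) (auto)
  also have "expect W (\<lambda>w. log 2 (?r w)) = expect W (\<lambda>w. log 2 (pr W T w / pr Q T w) - log 2 (pmf W w / pmf Q w))"
    using posW by (intro expect_cong) (auto simp: log_mult log_divide less_imp_neq[THEN not_sym])
  finally show ?thesis using fin by (simp)
qed

section \<open>Rate and exponent of auxiliary variables\<close>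

lemma distributed_pmf:
  "distributed (measure_pmf W) (count_space UNIV) A (\<lambda>a. ennreal (pmf (map_pmf A W) a))"
  unfolding distributed_def
  by (auto simp: measure_pmf_eq_density[symmetric] map_pmf_rep_eq[symmetric])

text \<open>Countable types turn a product of counting spaces into a counting space, so the
  densities in the library's formula are mass functions.\<close>

lemma pmf_MI_eq:
  fixes A :: "'w \<Rightarrow> 'b::countable" and B :: "'w \<Rightarrow> 'c::countable"
  assumes fin: "finite (set_pmf W)"
  shows "pmf_MI W A B = ent W A + ent W B - ent W (\<lambda>w. (A w, B w))"
proof -
  interpret information_space "measure_pmf W" 2
    by (simp add: information_space_def information_space_axioms_def measure_pmf.prob_space_axioms)
  let ?AB = "\<lambda>w. (A w, B w)"
  let ?Q = "map_pmf ?AB W"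
  have pair: "count_space (UNIV :: 'b set) \<Otimes>\<^sub>M count_space (UNIV :: 'c set) = count_space UNIV"
    by (simp add: pair_measure_countable)
  have "pmf_MI W A B = (\<integral>z. pmf ?Q z * log 2 (pmf ?Q z / (pmf (map_pmf A W) (fst z) * pmf (map_pmf B W) (snd z)))
     \<partial>(count_space UNIV \<Otimes>\<^sub>M count_space UNIV))"
    unfolding pmf_MI_def
    by (intro mutual_information_distr sigma_finite_measure_count_space)
       (auto simp: pair distributed_pmf)
  also have "\<dots> = (\<integral>z. pmf ?Q z * log 2 (pmf ?Q z / (pmf (map_pmf A W) (fst z) * pmf (map_pmf B W) (snd z))) \<partial>count_space UNIV)"
    by (simp only: pair)
  also have "\<dots> = expect ?Q (\<lambda>z. log 2 (pmf ?Q z / (pmf (map_pmf A W) (fst z) * pmf (map_pmf B W) (snd z))))"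
    by (simp only: measure_pmf_eq_density[of ?Q]) (simp add: integral_density)
  also have "\<dots> = expect W (\<lambda>w. log 2 (pr W ?AB w / (pr W A w * pr W B w)))"
    by (simp add: pmf_map_pr pmf_map_pr[of ?AB])
  also have "\<dots> = expect W (\<lambda>w. log 2 (pr W ?AB w) - log 2 (pr W A w) - log 2 (pr W B w))"
    by (intro expect_cong) (simp add: log_divide log_mult pr_pos less_imp_neq[THEN not_sym])
  also have "\<dots> = ent W A + ent W B - ent W ?AB"
    using fin by (simp add: ent_def)
  finally show ?thesis .
qed

text \<open>By definition in the library, I(A;B|C) is the difference I(A;B C) - I(A;C).\<close>

lemma pmf_cond_MI_eq:
  fixes A :: "'w \<Rightarrow> 'b::countable" and B :: "'w \<Rightarrow> 'c::countable" and C :: "'w \<Rightarrow> 'd::countable"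
  assumes fin: "finite (set_pmf W)"
  shows "pmf_cond_MI W A B C = ent W (\<lambda>w. (A w, C w)) + ent W (\<lambda>w. (B w, C w))
      - ent W (\<lambda>w. (A w, B w, C w)) - ent W C"
proof -
  have pair: "count_space (UNIV :: 'c set) \<Otimes>\<^sub>M count_space (UNIV :: 'd set) = count_space UNIV"
    by (simp add: pair_measure_countable)
  have "pmf_cond_MI W A B C = pmf_MI W A (\<lambda>w. (B w, C w)) - pmf_MI W A C"
    unfolding pmf_cond_MI_def pmf_MI_def prob_space.conditional_mutual_information_def[OF measure_pmf.prob_space_axioms] by (simp add: pair)
  then show ?thesis by (simp add: pmf_MI_eq[OF fin])
qed

text \<open>\<open>rate W\<close> is \<open>I(U;X) + I(V;Y|U)\<close> and \<open>expo W\<close> is \<open>I(U;Y) + I(V;X|U)\<close>.\<close>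

definition rate :: "('x \<times> 'y \<times> 'u \<times> 'v) pmf \<Rightarrow> real" where
  "rate W = ent W (\<lambda>(x,y,u,v). x) - ent W (\<lambda>(x,y,u,v). (u, x))
     + ent W (\<lambda>(x,y,u,v). (v, u)) + ent W (\<lambda>(x,y,u,v). (y, u)) - ent W (\<lambda>(x,y,u,v). (v, y, u))"

definition expo :: "('x \<times> 'y \<times> 'u \<times> 'v) pmf \<Rightarrow> real" where
  "expo W = ent W (\<lambda>(x,y,u,v). y) - ent W (\<lambda>(x,y,u,v). (u, y))
     + ent W (\<lambda>(x,y,u,v). (v, u)) + ent W (\<lambda>(x,y,u,v). (x, u)) - ent W (\<lambda>(x,y,u,v). (v, x, u))"

text \<open>No rate constraint is imposed, so that pairs can be averaged and shifted; and
  \<open>P\<close> may be the law of a pair of whole sequences.\<close>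

definition region :: "('x \<times> 'y) pmf \<Rightarrow> (real \<times> real) set" where
  "region P = {(rate (joint_law P K L), expo (joint_law P K L)) |
     (K :: 'x \<Rightarrow> nat pmf) (L :: nat \<times> 'y \<Rightarrow> nat pmf).
     (\<forall>x. finite (set_pmf (K x))) \<and> (\<forall>z. finite (set_pmf (L z)))}"

lemma finite_set_joint_law:
  assumes "finite (set_pmf P)" "\<And>x. finite (set_pmf (K x))" "\<And>z. finite (set_pmf (L z))"
  shows "finite (set_pmf (joint_law P K L))"
  using assms by (auto simp: joint_law_def)

lemma rate_pmf_MI:
  fixes W :: "('x::countable \<times> 'y::countable \<times> 'u::countable \<times> 'v::countable) pmf"
  assumes "finite (set_pmf W)"
  shows "rate W = pmf_MI W (\<lambda>(x,y,u,v). u) (\<lambda>(x,y,u,v). x)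
      + pmf_cond_MI W (\<lambda>(x,y,u,v). v) (\<lambda>(x,y,u,v). y) (\<lambda>(x,y,u,v). u)"
    and "expo W = pmf_MI W (\<lambda>(x,y,u,v). u) (\<lambda>(x,y,u,v). y)
      + pmf_cond_MI W (\<lambda>(x,y,u,v). v) (\<lambda>(x,y,u,v). x) (\<lambda>(x,y,u,v). u)"
  using assms by (simp_all add: pmf_MI_eq pmf_cond_MI_eq rate_def expo_def case_prod_unfold)

lemma exponent_values_region:
  fixes P :: "('x::finite \<times> 'y::finite) pmf"
  shows "e \<in> exponent_values P R \<longleftrightarrow> (\<exists>r\<le>R. (r, e) \<in> region P)"
proof
  assume "e \<in> exponent_values P R"
  then obtain \<U> \<V> :: "nat set" and K L W where *: "finite \<U>" "finite \<V>" "\<forall>x. set_pmf (K x) \<subseteq> \<U>"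
    "\<forall>u\<in>\<U>. \<forall>y. set_pmf (L (u, y)) \<subseteq> \<V>" "W = joint_law P K L"
    "pmf_MI W (\<lambda>(x,y,u,v). u) (\<lambda>(x,y,u,v). x)
      + pmf_cond_MI W (\<lambda>(x,y,u,v). v) (\<lambda>(x,y,u,v). y) (\<lambda>(x,y,u,v). u) \<le> R"
    "e = pmf_MI W (\<lambda>(x,y,u,v). u) (\<lambda>(x,y,u,v). y)
      + pmf_cond_MI W (\<lambda>(x,y,u,v). v) (\<lambda>(x,y,u,v). x) (\<lambda>(x,y,u,v). u)"
    unfolding exponent_values_def by auto
  \<comment> \<open>\<open>exponent_values\<close> restricts \<open>L\<close> only for first
    arguments in \<open>\<U>\<close>. A point mass elsewhere makes all rows finitely supported and
    leaves the joint law unchanged.\<close>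
  define L' where "L' = (\<lambda>(u,y). if u \<in> \<U> then L (u,y) else return_pmf 0)"
  have W: "W = joint_law P K L'"
    unfolding *(5) joint_law_def L'_def using *(3) by (fastforce intro!: bind_pmf_cong)
  have fK: "finite (set_pmf (K x))" for x using *(1,3) finite_subset by blast
  have fL: "finite (set_pmf (L' z))" for z using *(2,4) by (cases z) (auto simp: L'_def intro: finite_subset[of _ \<V>])
  have fin: "finite (set_pmf W)" unfolding W by (intro finite_set_joint_law fK fL) simp
  have "rate W \<le> R" "e = expo W" using *(6,7) fin by (simp_all add: rate_pmf_MI)
  then show "\<exists>r\<le>R. (r, e) \<in> region P" using fK fL unfolding region_def W by blast
next
  assume "\<exists>r\<le>R. (r, e) \<in> region P"
  then obtain K :: "'x \<Rightarrow> nat pmf" and L :: "nat \<times> 'y \<Rightarrow> nat pmf" where *: "rate (joint_law P K L) \<le> R"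
    "e = expo (joint_law P K L)" "\<And>x. finite (set_pmf (K x))" "\<And>z. finite (set_pmf (L z))"
    unfolding region_def by auto
  have fin: "finite (set_pmf (joint_law P K L))" by (intro finite_set_joint_law *) simp
  let ?U = "\<Union>x. set_pmf (K x)" and ?V = "\<Union>u\<in>(\<Union>x. set_pmf (K x)). \<Union>y. set_pmf (L (u,y))"
  show "e \<in> exponent_values P R"
    unfolding exponent_values_def mem_Collect_eq
    apply (rule exI[of _ ?U], rule exI[of _ ?V], rule exI[of _ K], rule exI[of _ L])
    using * fin by (auto simp flip: rate_pmf_MI)
qed


section \<open>Markov chains in the joint law\<close>

lemma pmf_bind_map_Pair:
  "pmf (bind_pmf A (\<lambda>a. map_pmf (Pair a) (B a))) (a, b) = pmf A a * pmf (B a) b"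
proof -
  have "pmf (map_pmf (Pair a') (B a')) (a, b) = indicator {a} a' * pmf (B a) b" for a'
    by (auto simp: pmf_map vimage_def measure_pmf_single indicator_def)
  then show ?thesis by (simp add: pmf_bind measure_pmf_single)
qed

lemma map_joint_law_XYUV:
  "map_pmf (\<lambda>(x,y,u,v). (((x,y),u),v)) (joint_law P K L)
   = bind_pmf (bind_pmf P (\<lambda>z. map_pmf (Pair z) (K (fst z)))) (\<lambda>w. map_pmf (Pair w) (L (snd w, snd (fst w))))"
  by (simp add: joint_law_def map_pmf_def bind_assoc_pmf bind_return_pmf case_prod_unfold)

lemma map_joint_law_XYU:
  "map_pmf (\<lambda>(x,y,u,v). ((x,y),u)) (joint_law P K L) = bind_pmf P (\<lambda>z. map_pmf (Pair z) (K (fst z)))"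
  by (simp add: joint_law_def map_pmf_def bind_assoc_pmf bind_return_pmf case_prod_unfold)

lemma map_joint_law_XY: "map_pmf (\<lambda>(x,y,u,v). (x,y)) (joint_law P K L) = P"
  by (simp add: joint_law_def map_pmf_def bind_assoc_pmf bind_return_pmf bind_return_pmf' case_prod_unfold)

lemma map_joint_law_XU:
  "map_pmf (\<lambda>(x,y,u,v). (x,u)) (joint_law P K L) = bind_pmf (map_pmf fst P) (\<lambda>x. map_pmf (Pair x) (K x))"
  by (simp add: joint_law_def map_pmf_def bind_assoc_pmf bind_return_pmf case_prod_unfold)

lemma map_joint_law_UYV:
  "map_pmf (\<lambda>(x,y,u,v). ((u,y),v)) (joint_law P K L)
   = bind_pmf (map_pmf (\<lambda>(x,y,u,v). (u,y)) (joint_law P K L)) (\<lambda>z. map_pmf (Pair z) (L z))"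
  by (simp add: joint_law_def map_pmf_def bind_assoc_pmf bind_return_pmf case_prod_unfold)

lemma pmf_joint_law: "pmf (joint_law P K L) (x,y,u,v) = pmf P (x,y) * pmf (K x) u * pmf (L (u,y)) v"
proof -
  have "inj (\<lambda>(x,y,u,v). (((x,y),u),v))" by (auto simp: inj_def)
  then have "pmf (joint_law P K L) (x,y,u,v) = pmf (map_pmf (\<lambda>(x,y,u,v). (((x,y),u),v)) (joint_law P K L)) (((x,y),u),v)"
    by (subst pmf_map_inj'[of _ _ "(x,y,u,v)", symmetric]) auto
  then show ?thesis by (simp add: map_joint_law_XYUV pmf_bind_map_Pair)
qed

text \<open>The chain U - X - Y, multiplied out so that it also holds where conditional laws are
  undefined.\<close>

lemma joint_law_markov_U:
  fixes P K L
  defines "W \<equiv> joint_law P K L"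
  shows "pmf (map_pmf (\<lambda>(x,y,u,v). ((x,y),u)) W) ((x,y),u) * pmf (map_pmf (\<lambda>(x,y,u,v). x) W) x
     = pmf (map_pmf (\<lambda>(x,y,u,v). (x,u)) W) (x,u) * pmf (map_pmf (\<lambda>(x,y,u,v). (x,y)) W) (x,y)"
proof -
  have "map_pmf (\<lambda>(x,y,u,v). x) W = map_pmf fst (map_pmf (\<lambda>(x,y,u,v). (x,y)) W)"
    by (simp add: map_pmf_comp case_prod_unfold)
  then show ?thesis
    by (simp add: W_def map_joint_law_XYU map_joint_law_XY map_joint_law_XU pmf_bind_map_Pair)
qed

text \<open>The chain V - (U, Y) - X: node B sees X only through the first message.\<close>

lemma joint_law_markov_V:
  fixes P K L
  defines "W \<equiv> joint_law P K L"
  shows "pmf (map_pmf (\<lambda>(x,y,u,v). (((x,y),u),v)) W) (((x,y),u),v) * pmf (map_pmf (\<lambda>(x,y,u,v). (u,y)) W) (u,y)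
     = pmf (map_pmf (\<lambda>(x,y,u,v). ((x,y),u)) W) ((x,y),u) * pmf (map_pmf (\<lambda>(x,y,u,v). ((u,y),v)) W) ((u,y),v)"
  unfolding W_def by (simp add: map_joint_law_XYU map_joint_law_XYUV map_joint_law_UYV pmf_bind_map_Pair)

lemma ent_markov:
  assumes fin: "finite (set_pmf W)"
    and eq: "\<And>w. w \<in> set_pmf W \<Longrightarrow> pr W A w * pr W B w = pr W C w * pr W D w"
  shows "ent W A + ent W B = ent W C + ent W D"
proof -
  have "expect W (\<lambda>w. log 2 (pr W A w) + log 2 (pr W B w)) = expect W (\<lambda>w. log 2 (pr W C w) + log 2 (pr W D w))"
  proof (rule expect_cong)
    fix w assume w: "w \<in> set_pmf W"
    have "log 2 (pr W A w * pr W B w) = log 2 (pr W C w * pr W D w)" using eq[OF w] by simp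
    then show "log 2 (pr W A w) + log 2 (pr W B w) = log 2 (pr W C w) + log 2 (pr W D w)"
      using w by (simp add: log_mult pr_pos less_imp_neq[THEN not_sym])
  qed
  then show ?thesis using fin by (simp add: ent_def)
qed

lemma joint_law_ent_U:
  fixes P K L
  defines "W \<equiv> joint_law P K L"
  assumes "finite (set_pmf W)"
  shows "ent W (\<lambda>(x,y,u,v). ((x,y),u)) + ent W (\<lambda>(x,y,u,v). x)
    = ent W (\<lambda>(x,y,u,v). (x,u)) + ent W (\<lambda>(x,y,u,v). (x,y))"
proof (rule ent_markov[OF assms(2)])
  fix w :: "'a \<times> 'b \<times> 'c \<times> 'd"
  obtain x y u v where w: "w = (x,y,u,v)" by (cases w)
  show "pr W (\<lambda>(x,y,u,v). ((x,y),u)) w * pr W (\<lambda>(x,y,u,v). x) w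
      = pr W (\<lambda>(x,y,u,v). (x,u)) w * pr W (\<lambda>(x,y,u,v). (x,y)) w"
    using joint_law_markov_U[of P K L x y u] by (simp add: w flip: W_def pmf_map_pr)
qed

lemma joint_law_ent_V:
  fixes P K L
  defines "W \<equiv> joint_law P K L"
  assumes "finite (set_pmf W)"
  shows "ent W (\<lambda>(x,y,u,v). (((x,y),u),v)) + ent W (\<lambda>(x,y,u,v). (u,y))
    = ent W (\<lambda>(x,y,u,v). ((x,y),u)) + ent W (\<lambda>(x,y,u,v). ((u,y),v))"
proof (rule ent_markov[OF assms(2)])
  fix w :: "'a \<times> 'b \<times> 'c \<times> 'd"
  obtain x y u v where w: "w = (x,y,u,v)" by (cases w)
  show "pr W (\<lambda>(x,y,u,v). (((x,y),u),v)) w * pr W (\<lambda>(x,y,u,v). (u,y)) w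
      = pr W (\<lambda>(x,y,u,v). ((x,y),u)) w * pr W (\<lambda>(x,y,u,v). ((u,y),v)) w"
    using joint_law_markov_V[of P K L x y u v] by (simp add: w flip: W_def pmf_map_pr)
qed

lemma ent_reorder:
  "ent W (\<lambda>(x,y,u,v). (u,x)) = ent W (\<lambda>(x,y,u,v). (x,u))"
  "ent W (\<lambda>(x,y,u,v). (y,u)) = ent W (\<lambda>(x,y,u,v). (u,y))"
  "ent W (\<lambda>(x,y,u,v). (v,u)) = ent W (\<lambda>(x,y,u,v). (u,v))"
  "ent W (\<lambda>(x,y,u,v). (v,y,u)) = ent W (\<lambda>(x,y,u,v). ((u,y),v))"
  "ent W (\<lambda>(x,y,u,v). (v,x,u)) = ent W (\<lambda>(x,y,u,v). ((u,x),v))"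
  "ent W (\<lambda>(x,y,u,v). (((x,y),u),v)) = ent W (\<lambda>w. w)"
  by (auto intro!: ent_cong split: prod.splits)

text \<open>The symmetric forms \<open>I(UV;XY)\<close> and \<open>I(X;Y) - I(X;Y|UV)\<close>.\<close>

lemma rate_joint_law:
  fixes P K L
  defines "W \<equiv> joint_law P K L"
  assumes fin: "finite (set_pmf W)"
  shows "rate W = ent P (\<lambda>z. z) + ent W (\<lambda>(x,y,u,v). (u,v)) - ent W (\<lambda>w. w)"
    and "expo W = ent P fst + ent P snd - ent P (\<lambda>z. z) + ent W (\<lambda>(x,y,u,v). (u,v)) + ent W (\<lambda>w. w)
        - ent W (\<lambda>(x,y,u,v). ((u,x),v)) - ent W (\<lambda>(x,y,u,v). ((u,y),v))"
proof -
  have XY: "map_pmf (\<lambda>(x,y,u,v). (x,y)) W = P" by (simp add: W_def map_joint_law_XY)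
  have P: "ent P f = ent W (\<lambda>w. f (fst w, fst (snd w)))" for f :: "_ \<Rightarrow> 'z"
    unfolding XY[symmetric] by (simp add: ent_map case_prod_unfold)
  note 1 = joint_law_ent_U[of P K L, folded W_def, OF fin] joint_law_ent_V[of P K L, folded W_def, OF fin]
  show "rate W = ent P (\<lambda>z. z) + ent W (\<lambda>(x,y,u,v). (u,v)) - ent W (\<lambda>w. w)"
    using 1 unfolding rate_def ent_reorder P by (simp add: case_prod_unfold)
  show "expo W = ent P fst + ent P snd - ent P (\<lambda>z. z) + ent W (\<lambda>(x,y,u,v). (u,v)) + ent W (\<lambda>w. w)
        - ent W (\<lambda>(x,y,u,v). ((u,x),v)) - ent W (\<lambda>(x,y,u,v). ((u,y),v))"
    using 1 unfolding expo_def ent_reorder P by (simp add: case_prod_unfold)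
qed

text \<open>By the two Markov chains the difference is I(U;X|Y) + I(V;Y|U X), a sum of two
  nonnegative terms; \<open>s1\<close> and \<open>s2\<close> are exactly these.\<close>

lemma expo_le_rate:
  fixes P K L
  defines "W \<equiv> joint_law P K L"
  assumes fin: "finite (set_pmf W)"
  shows "expo W \<le> rate W"
proof -
  note 1 = joint_law_ent_U[of P K L, folded W_def, OF fin] joint_law_ent_V[of P K L, folded W_def, OF fin]
  note s1 = ent_submodular[OF fin, of "\<lambda>(x,y,u,v). x" "\<lambda>(x,y,u,v). u" "\<lambda>(x,y,u,v). y"]
  note s2 = ent_submodular[OF fin, of "\<lambda>(x,y,u,v). y" "\<lambda>(x,y,u,v). v" "\<lambda>(x,y,u,v). (u,x)"]
  have c: "ent W (\<lambda>w. ((\<lambda>(x,y,u,v). x) w, (\<lambda>(x,y,u,v). u) w, (\<lambda>(x,y,u,v). y) w)) = ent W (\<lambda>(x,y,u,v). ((x,y),u))"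
    "ent W (\<lambda>w. ((\<lambda>(x,y,u,v). x) w, (\<lambda>(x,y,u,v). y) w)) = ent W (\<lambda>(x,y,u,v). (x,y))"
    "ent W (\<lambda>w. ((\<lambda>(x,y,u,v). u) w, (\<lambda>(x,y,u,v). y) w)) = ent W (\<lambda>(x,y,u,v). (u,y))"
    "ent W (\<lambda>w. ((\<lambda>(x,y,u,v). y) w, (\<lambda>(x,y,u,v). v) w, (\<lambda>(x,y,u,v). (u,x)) w)) = ent W (\<lambda>w. w)"
    "ent W (\<lambda>w. ((\<lambda>(x,y,u,v). y) w, (\<lambda>(x,y,u,v). (u,x)) w)) = ent W (\<lambda>(x,y,u,v). ((x,y),u))"
    "ent W (\<lambda>w. ((\<lambda>(x,y,u,v). v) w, (\<lambda>(x,y,u,v). (u,x)) w)) = ent W (\<lambda>(x,y,u,v). ((u,x),v))"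
    by (auto intro!: ent_cong split: prod.splits)
  show ?thesis
    using s1 s2 1 unfolding c rate_def expo_def ent_reorder by linarith
qed

section \<open>Bounded alphabets and attainment of the maximum\<close>

definition xlog :: "real \<Rightarrow> real" where "xlog t = t * log 2 t"

lemma xlog_0 [simp]: "xlog 0 = 0" by (simp add: xlog_def)

lemma xlog_scale: "c > 0 \<Longrightarrow> t \<ge> 0 \<Longrightarrow> xlog (c * t) = c * xlog t + xlog c * t"
  by (cases "t = 0") (auto simp: xlog_def log_mult algebra_simps)

lemma continuous_on_xlog: "continuous_on {0..} xlog"
proof -
  have "((\<lambda>t::real. t * log 2 t) \<longlongrightarrow> 0) (at_right 0)"
    unfolding log_def by real_asymp
  then have 0: "(xlog \<longlongrightarrow> xlog 0) (at 0 within {0..})"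
    by (simp add: xlog_def[abs_def] at_within_Ici_at_right)
  have "(xlog \<longlongrightarrow> xlog t) (at t within {0..})" if "t > 0" for t
    unfolding xlog_def using that by (intro tendsto_intros) auto
  with 0 show ?thesis
    unfolding continuous_on_def by (metis atLeast_iff less_eq_real_def)
qed

lemma ent_xlog:
  assumes fin: "finite (set_pmf W)" and S: "finite S" "\<And>w. w \<in> set_pmf W \<Longrightarrow> A w \<in> S"
  shows "ent W A = - (\<Sum>a\<in>S. xlog (pmf (map_pmf A W) a))"
proof -
  have "ent W A = - expect (map_pmf A W) (\<lambda>a. log 2 (pmf (map_pmf A W) a))"
    by (simp add: ent_def pmf_map_pr)
  also have "expect (map_pmf A W) (\<lambda>a. log 2 (pmf (map_pmf A W) a)) = (\<Sum>a\<in>S. log 2 (pmf (map_pmf A W) a) * pmf (map_pmf A W) a)"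
    using S by (intro integral_measure_pmf_real) auto
  finally show ?thesis by (simp add: xlog_def mult.commute)
qed

text \<open>For a nonnegative matrix, the contribution of one pair \<open>(u, v)\<close> to \<open>H(UV) - H(XYUV)\<close>
  and to \<open>H(UV) + H(XYUV) - H(XUV) - H(YUV)\<close>.\<close>

definition rate_block :: "('x::finite \<Rightarrow> 'y::finite \<Rightarrow> real) \<Rightarrow> real" where
  "rate_block m = (\<Sum>x\<in>UNIV. \<Sum>y\<in>UNIV. xlog (m x y)) - xlog (\<Sum>x\<in>UNIV. \<Sum>y\<in>UNIV. m x y)"

definition expo_block :: "('x::finite \<Rightarrow> 'y::finite \<Rightarrow> real) \<Rightarrow> real" where
  "expo_block m = (\<Sum>x\<in>UNIV. xlog (\<Sum>y\<in>UNIV. m x y)) + (\<Sum>y\<in>UNIV. xlog (\<Sum>x\<in>UNIV. m x y))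
     - (\<Sum>x\<in>UNIV. \<Sum>y\<in>UNIV. xlog (m x y)) - xlog (\<Sum>x\<in>UNIV. \<Sum>y\<in>UNIV. m x y)"

text \<open>\<open>xlog\<close> is homogeneous up to the defect \<open>xlog c * t\<close>, which is
  linear in \<open>t\<close>. In a block the positive and the negative terms carry the same total
  mass, so the defects cancel.\<close>

lemma block_scale:
  assumes "c \<ge> 0" "\<And>x y. m x y \<ge> 0"
  shows "rate_block (\<lambda>x y. c * m x y) = c * rate_block m"
    and "expo_block (\<lambda>x y. c * m x y) = c * expo_block m"
proof -
  let ?t = "\<Sum>x\<in>UNIV. \<Sum>y\<in>UNIV. m x y"
  have *: "(\<Sum>x\<in>UNIV. \<Sum>y\<in>UNIV. xlog (c * m x y)) = c * (\<Sum>x\<in>UNIV. \<Sum>y\<in>UNIV. xlog (m x y)) + xlog c * ?t"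
    "xlog (\<Sum>x\<in>UNIV. \<Sum>y\<in>UNIV. c * m x y) = c * xlog ?t + xlog c * ?t"
    "(\<Sum>x\<in>UNIV. xlog (\<Sum>y\<in>UNIV. c * m x y)) = c * (\<Sum>x\<in>UNIV. xlog (\<Sum>y\<in>UNIV. m x y)) + xlog c * ?t"
    "(\<Sum>y\<in>UNIV. xlog (\<Sum>x\<in>UNIV. c * m x y)) = c * (\<Sum>y\<in>UNIV. xlog (\<Sum>x\<in>UNIV. m x y)) + xlog c * ?t"
    if "c > 0"
  proof -
    show "(\<Sum>x\<in>UNIV. \<Sum>y\<in>UNIV. xlog (c * m x y)) = c * (\<Sum>x\<in>UNIV. \<Sum>y\<in>UNIV. xlog (m x y)) + xlog c * ?t"
      using assms that by (simp add: xlog_scale sum.distrib sum_distrib_left)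
    show "xlog (\<Sum>x\<in>UNIV. \<Sum>y\<in>UNIV. c * m x y) = c * xlog ?t + xlog c * ?t"
      using assms that by (simp add: xlog_scale sum_nonneg flip: sum_distrib_left)
    show "(\<Sum>x\<in>UNIV. xlog (\<Sum>y\<in>UNIV. c * m x y)) = c * (\<Sum>x\<in>UNIV. xlog (\<Sum>y\<in>UNIV. m x y)) + xlog c * ?t"
      using assms that by (simp add: xlog_scale sum_nonneg sum.distrib flip: sum_distrib_left)
    have "(\<Sum>y\<in>UNIV. xlog (\<Sum>x\<in>UNIV. c * m x y)) = c * (\<Sum>y\<in>UNIV. xlog (\<Sum>x\<in>UNIV. m x y)) + xlog c * (\<Sum>y\<in>UNIV. \<Sum>x\<in>UNIV. m x y)"
      using assms that by (simp add: xlog_scale sum_nonneg sum.distrib flip: sum_distrib_left)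
    then show "(\<Sum>y\<in>UNIV. xlog (\<Sum>x\<in>UNIV. c * m x y)) = c * (\<Sum>y\<in>UNIV. xlog (\<Sum>x\<in>UNIV. m x y)) + xlog c * ?t"
      by (subst sum.swap)
  qed
  show "rate_block (\<lambda>x y. c * m x y) = c * rate_block m"
    using assms(1) * by (cases "c = 0") (auto simp: rate_block_def algebra_simps)
  show "expo_block (\<lambda>x y. c * m x y) = c * expo_block m"
    using assms(1) * by (cases "c = 0") (auto simp: expo_block_def algebra_simps)
qed

text \<open>The slice of the joint law at one pair (u, v), with \<open>k\<close> the probability of
  u as a function of x and \<open>l\<close> that of v as a function of y. It is linear in each of
  them separately.\<close>

definition block :: "('x \<times> 'y) pmf \<Rightarrow> ('x \<Rightarrow> real) \<Rightarrow> ('y \<Rightarrow> real) \<Rightarrow> 'x \<Rightarrow> 'y \<Rightarrow> real" where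
  "block P k l x y = pmf P (x,y) * k x * l y"

text \<open>Kernels with alphabets \<open>{..<M}\<close> and \<open>{..<N}\<close> as real arrays,
  on which a topology is available. Outside the index range the entries are merely
  nonnegative.\<close>

definition kernel_arrays :: "nat \<Rightarrow> nat \<Rightarrow> (nat \<Rightarrow> 'x \<Rightarrow> real) \<Rightarrow> (nat \<Rightarrow> nat \<Rightarrow> 'y \<Rightarrow> real) \<Rightarrow> bool" where
  "kernel_arrays M N k l \<longleftrightarrow> (\<forall>u x. 0 \<le> k u x) \<and> (\<forall>u v y. 0 \<le> l u v y) \<and>
     (\<forall>x. (\<Sum>u<M. k u x) = 1) \<and> (\<forall>u<M. \<forall>y. (\<Sum>v<N. l u v y) = 1)"

definition array_rate ::
  "('x::finite \<times> 'y::finite) pmf \<Rightarrow> nat \<Rightarrow> nat \<Rightarrow> (nat \<Rightarrow> 'x \<Rightarrow> real) \<Rightarrow> (nat \<Rightarrow> nat \<Rightarrow> 'y \<Rightarrow> real) \<Rightarrow> real" where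
  "array_rate P M N k l = ent P (\<lambda>z. z) + (\<Sum>u<M. \<Sum>v<N. rate_block (block P (k u) (l u v)))"

definition array_expo ::
  "('x::finite \<times> 'y::finite) pmf \<Rightarrow> nat \<Rightarrow> nat \<Rightarrow> (nat \<Rightarrow> 'x \<Rightarrow> real) \<Rightarrow> (nat \<Rightarrow> nat \<Rightarrow> 'y \<Rightarrow> real) \<Rightarrow> real" where
  "array_expo P M N k l = ent P fst + ent P snd - ent P (\<lambda>z. z) + (\<Sum>u<M. \<Sum>v<N. expo_block (block P (k u) (l u v)))"

text \<open>In the symmetric forms every entropy that depends on the kernels contains U and V.
  Summing over (u, v) outermost therefore splits rate and exponent into one contribution per
  block.\<close>

lemma joint_law_arrays:
  fixes P :: "('x::finite \<times> 'y::finite) pmf" and K :: "'x \<Rightarrow> nat pmf" and L :: "nat \<times> 'y \<Rightarrow> nat pmf"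
  assumes K: "\<And>x. set_pmf (K x) \<subseteq> {..<M}" and L: "\<And>u y. u < M \<Longrightarrow> set_pmf (L (u, y)) \<subseteq> {..<N}"
  defines "k \<equiv> \<lambda>u x. pmf (K x) u" and "l \<equiv> \<lambda>u v y. pmf (L (u, y)) v"
  shows "rate (joint_law P K L) = array_rate P M N k l" "expo (joint_law P K L) = array_expo P M N k l"
proof -
  let ?W = "joint_law P K L"
  have supp: "set_pmf ?W \<subseteq> UNIV \<times> UNIV \<times> {..<M} \<times> {..<N}"
    using K L unfolding joint_law_def by (fastforce split: prod.splits)
  then have fin: "finite (set_pmf ?W)" by (rule finite_subset) simp
  have in_supp: "u < M" "v < N" if "(x,y,u,v) \<in> set_pmf ?W" for x y u v using supp that by auto
  let ?m = "\<lambda>u v. block P (k u) (l u v)"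
  have W: "pmf ?W (x,y,u,v) = ?m u v x y" for x y u v
    by (simp add: pmf_joint_law block_def k_def l_def)
  have inj: "pmf (map_pmf f ?W) (f w) = pmf ?W w" if "inj f" for f :: "_ \<Rightarrow> 'z" and w
    using that by (rule pmf_map_inj')
  have UVXY: "pmf (map_pmf (\<lambda>(x,y,u,v). ((u,v),x,y)) ?W) ((u,v),x,y) = ?m u v x y" for u v x y
    using inj[of "\<lambda>(x,y,u,v). ((u,v),x,y)" "(x,y,u,v)"] by (auto simp: W inj_def)
  have UVX_Y: "pmf (map_pmf (\<lambda>(x,y,u,v). (((u,x),v),y)) ?W) (((u,x),v),y) = ?m u v x y" for u v x y
    using inj[of "\<lambda>(x,y,u,v). (((u,x),v),y)" "(x,y,u,v)"] by (auto simp: W inj_def)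
  have UVY_X: "pmf (map_pmf (\<lambda>(x,y,u,v). (((u,y),v),x)) ?W) (((u,y),v),x) = ?m u v x y" for u v x y
    using inj[of "\<lambda>(x,y,u,v). (((u,y),v),x)" "(x,y,u,v)"] by (auto simp: W inj_def)
  have e: "ent ?W (\<lambda>w. w) = - (\<Sum>u<M. \<Sum>v<N. \<Sum>x\<in>UNIV. \<Sum>y\<in>UNIV. xlog (?m u v x y))"
  proof -
    have "ent ?W (\<lambda>w. w) = ent ?W (\<lambda>(x,y,u,v). ((u,v),x,y))" by (intro ent_cong) auto
    also have "\<dots> = - (\<Sum>a\<in>({..<M} \<times> {..<N}) \<times> UNIV \<times> UNIV. xlog (pmf (map_pmf (\<lambda>(x,y,u,v). ((u,v),x,y)) ?W) a))"
      by (intro ent_xlog fin) (auto dest: in_supp)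
    also have "\<dots> = - (\<Sum>u<M. \<Sum>v<N. \<Sum>x\<in>UNIV. \<Sum>y\<in>UNIV. xlog (?m u v x y))"
      by (simp add: sum.cartesian_product' UVXY del: UNIV_Times_UNIV)
    finally show ?thesis .
  qed
  have UV: "pmf (map_pmf (\<lambda>(x,y,u,v). (u,v)) ?W) (u,v) = (\<Sum>x\<in>UNIV. \<Sum>y\<in>UNIV. ?m u v x y)" for u v
    using pmf_marginal_sum[OF fin, of UNIV "\<lambda>(x,y,u,v). (x,y)" "\<lambda>(x,y,u,v). (u,v)" "(u,v)"]
  proof -
    have "(\<lambda>w. ((\<lambda>(x,y,u,v). (u,v)) w, (\<lambda>(x,y,u,v). (x,y)) w)) = (\<lambda>(x,y,u,v). ((u,v),x,y))" by (simp add: fun_eq_iff)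
    note eq = this
    have "(\<Sum>b\<in>UNIV \<times> UNIV. pmf (map_pmf (\<lambda>w. ((\<lambda>(x,y,u,v). (u,v)) w, (\<lambda>(x,y,u,v). (x,y)) w)) ?W) ((u,v),b))
      = pmf (map_pmf (\<lambda>(x,y,u,v). (u,v)) ?W) (u,v)" by (rule pmf_marginal_sum[OF fin]) auto
    then show ?thesis unfolding eq by (simp only: sum.cartesian_product' UVXY)
  qed
  have UVX: "pmf (map_pmf (\<lambda>(x,y,u,v). ((u,x),v)) ?W) ((u,x),v) = (\<Sum>y\<in>UNIV. ?m u v x y)" for u v x
  proof -
    have "(\<lambda>w. ((\<lambda>(x,y,u,v). ((u,x),v)) w, (\<lambda>(x,y,u,v). y) w)) = (\<lambda>(x,y,u,v). (((u,x),v),y))" by (simp add: fun_eq_iff)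
    note eq = this
    have "(\<Sum>b\<in>UNIV. pmf (map_pmf (\<lambda>w. ((\<lambda>(x,y,u,v). ((u,x),v)) w, (\<lambda>(x,y,u,v). y) w)) ?W) (((u,x),v),b))
      = pmf (map_pmf (\<lambda>(x,y,u,v). ((u,x),v)) ?W) ((u,x),v)" by (rule pmf_marginal_sum[OF fin]) auto
    then show ?thesis unfolding eq by (simp only: UVX_Y)
  qed
  have UVY: "pmf (map_pmf (\<lambda>(x,y,u,v). ((u,y),v)) ?W) ((u,y),v) = (\<Sum>x\<in>UNIV. ?m u v x y)" for u v y
  proof -
    have "(\<lambda>w. ((\<lambda>(x,y,u,v). ((u,y),v)) w, (\<lambda>(x,y,u,v). x) w)) = (\<lambda>(x,y,u,v). (((u,y),v),x))" by (simp add: fun_eq_iff)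
    note eq = this
    have "(\<Sum>b\<in>UNIV. pmf (map_pmf (\<lambda>w. ((\<lambda>(x,y,u,v). ((u,y),v)) w, (\<lambda>(x,y,u,v). x) w)) ?W) (((u,y),v),b))
      = pmf (map_pmf (\<lambda>(x,y,u,v). ((u,y),v)) ?W) ((u,y),v)" by (rule pmf_marginal_sum[OF fin]) auto
    then show ?thesis unfolding eq by (simp only: UVY_X)
  qed
  have eUV: "ent ?W (\<lambda>(x,y,u,v). (u,v)) = - (\<Sum>u<M. \<Sum>v<N. xlog (\<Sum>x\<in>UNIV. \<Sum>y\<in>UNIV. ?m u v x y))"
  proof -
    have "ent ?W (\<lambda>(x,y,u,v). (u,v)) = - (\<Sum>a\<in>{..<M} \<times> {..<N}. xlog (pmf (map_pmf (\<lambda>(x,y,u,v). (u,v)) ?W) a))"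
      by (intro ent_xlog fin) (auto dest: in_supp)
    then show ?thesis by (simp only: sum.cartesian_product' UV)
  qed
  have eUVX: "ent ?W (\<lambda>(x,y,u,v). ((u,x),v)) = - (\<Sum>u<M. \<Sum>v<N. \<Sum>x\<in>UNIV. xlog (\<Sum>y\<in>UNIV. ?m u v x y))"
  proof -
    have "ent ?W (\<lambda>(x,y,u,v). ((u,x),v)) = - (\<Sum>a\<in>({..<M} \<times> UNIV) \<times> {..<N}. xlog (pmf (map_pmf (\<lambda>(x,y,u,v). ((u,x),v)) ?W) a))"
      by (intro ent_xlog fin) (auto dest: in_supp)
    also have "\<dots> = - (\<Sum>u<M. \<Sum>x\<in>UNIV. \<Sum>v<N. xlog (\<Sum>y\<in>UNIV. ?m u v x y))"
      by (simp only: sum.cartesian_product' UVX)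
    also have "\<dots> = - (\<Sum>u<M. \<Sum>v<N. \<Sum>x\<in>UNIV. xlog (\<Sum>y\<in>UNIV. ?m u v x y))"
      by (intro arg_cong[where f=uminus] sum.cong refl sum.swap)
    finally show ?thesis .
  qed
  have eUVY: "ent ?W (\<lambda>(x,y,u,v). ((u,y),v)) = - (\<Sum>u<M. \<Sum>v<N. \<Sum>y\<in>UNIV. xlog (\<Sum>x\<in>UNIV. ?m u v x y))"
  proof -
    have "ent ?W (\<lambda>(x,y,u,v). ((u,y),v)) = - (\<Sum>a\<in>({..<M} \<times> UNIV) \<times> {..<N}. xlog (pmf (map_pmf (\<lambda>(x,y,u,v). ((u,y),v)) ?W) a))"
      by (intro ent_xlog fin) (auto dest: in_supp)
    also have "\<dots> = - (\<Sum>u<M. \<Sum>y\<in>UNIV. \<Sum>v<N. xlog (\<Sum>x\<in>UNIV. ?m u v x y))"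
      by (simp only: sum.cartesian_product' UVY)
    also have "\<dots> = - (\<Sum>u<M. \<Sum>v<N. \<Sum>y\<in>UNIV. xlog (\<Sum>x\<in>UNIV. ?m u v x y))"
      by (intro arg_cong[where f=uminus] sum.cong refl sum.swap)
    finally show ?thesis .
  qed
  show "rate ?W = array_rate P M N k l"
    unfolding rate_joint_law(1)[OF fin] array_rate_def e eUV rate_block_def by (simp add: sum_subtractf)
  show "expo ?W = array_expo P M N k l"
    unfolding rate_joint_law(2)[OF fin] array_expo_def e eUV eUVX eUVY expo_block_def
    by (simp add: sum_subtractf sum.distrib)
qed

lemma pmf_of_weights:
  assumes "\<And>u. 0 \<le> (f u :: real)" "(\<Sum>u<M. f u) = 1"
  obtains p :: "nat pmf" where "\<And>u. pmf p u = (if u < M then f u else 0)" "set_pmf p \<subseteq> {..<M}"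
proof
  define g where "g = (\<lambda>u. if u < M then f u else 0)"
  have "(\<integral>\<^sup>+ u. ennreal (g u) \<partial>count_space UNIV) = (\<integral>\<^sup>+ u. ennreal (f u) \<partial>count_space {..<M})"
    by (auto simp: g_def nn_integral_count_space_indicator indicator_def intro!: nn_integral_cong)
  also have "\<dots> = 1"
    using assms by (simp add: nn_integral_count_space_finite sum_ennreal)
  finally have *: "pmf (embed_pmf g) u = g u" for u
    using assms(1) by (intro pmf_embed_pmf) (auto simp: g_def)
  show "pmf (embed_pmf g) u = (if u < M then f u else 0)" for u using *[of u] by (simp add: g_def)
  then show "set_pmf (embed_pmf g) \<subseteq> {..<M}" by (auto simp: set_pmf_iff split: if_splits)
qed

lemma region_arrays:
  fixes P :: "('x::finite \<times> 'y::finite) pmf"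
  shows "z \<in> region P \<longleftrightarrow> (\<exists>M N k l. kernel_arrays M N k l \<and> z = (array_rate P M N k l, array_expo P M N k l))"
proof
  assume "z \<in> region P"
  then obtain K :: "'x \<Rightarrow> nat pmf" and L :: "nat \<times> 'y \<Rightarrow> nat pmf" where
    z: "z = (rate (joint_law P K L), expo (joint_law P K L))"
    and fK: "\<And>x. finite (set_pmf (K x))" and fL: "\<And>z. finite (set_pmf (L z))"
    unfolding region_def by auto
  have "finite (\<Union>x. set_pmf (K x))" using fK by simp
  then obtain M where M: "(\<Union>x. set_pmf (K x)) \<subseteq> {..<M}" by (meson finite_nat_iff_bounded)
  have "finite (\<Union>u<M. \<Union>y. set_pmf (L (u,y)))" using fL by simp
  then obtain N where N: "(\<Union>u<M. \<Union>y. set_pmf (L (u,y))) \<subseteq> {..<N}" by (meson finite_nat_iff_bounded)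
  have K: "set_pmf (K x) \<subseteq> {..<M}" for x using M by auto
  have L: "set_pmf (L (u, y)) \<subseteq> {..<N}" if "u < M" for u y using N that by auto
  have "kernel_arrays M N (\<lambda>u x. pmf (K x) u) (\<lambda>u v y. pmf (L (u, y)) v)"
    using K L by (auto simp: kernel_arrays_def sum_pmf_eq_1)
  then show "\<exists>M N k l. kernel_arrays M N k l \<and> z = (array_rate P M N k l, array_expo P M N k l)"
    using joint_law_arrays[of K M L N P, OF K L] z by blast
next
  assume "\<exists>M N k l. kernel_arrays M N k l \<and> z = (array_rate P M N k l, array_expo P M N k l)"
  then obtain M N k l where a: "kernel_arrays M N k l" and z: "z = (array_rate P M N k l, array_expo P M N k l)" by blast
  have "\<exists>p::nat pmf. (\<forall>u. pmf p u = (if u < M then k u x else 0)) \<and> set_pmf p \<subseteq> {..<M}" for x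
    using pmf_of_weights[of "\<lambda>u. k u x" M] a unfolding kernel_arrays_def by metis
  then obtain K :: "'x \<Rightarrow> nat pmf" where K: "\<And>x u. pmf (K x) u = (if u < M then k u x else 0)" "\<And>x. set_pmf (K x) \<subseteq> {..<M}"
    by metis
  have "\<exists>p::nat pmf. (fst w < M \<longrightarrow> (\<forall>v. pmf p v = (if v < N then l (fst w) v (snd w) else 0)) \<and> set_pmf p \<subseteq> {..<N}) \<and> finite (set_pmf p)" for w
  proof (cases "fst w < M")
    case True
    then show ?thesis using pmf_of_weights[of "\<lambda>v. l (fst w) v (snd w)" N] a
      unfolding kernel_arrays_def by (metis finite_lessThan finite_subset)
  next
    case False
    then show ?thesis by (intro exI[of _ "return_pmf 0"]) simp
  qed
  then obtain L where L: "\<And>u y v. u < M \<Longrightarrow> pmf (L (u,y)) v = (if v < N then l u v y else 0)"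
     "\<And>u y. u < M \<Longrightarrow> set_pmf (L (u,y)) \<subseteq> {..<N}" "\<And>w. finite (set_pmf (L w))"
    by (metis fst_conv snd_conv)
  have "array_rate P M N (\<lambda>u x. pmf (K x) u) (\<lambda>u v y. pmf (L (u, y)) v) = array_rate P M N k l"
    "array_expo P M N (\<lambda>u x. pmf (K x) u) (\<lambda>u v y. pmf (L (u, y)) v) = array_expo P M N k l"
    unfolding array_rate_def array_expo_def using K(1) L(1)
    by (auto intro!: sum.cong arg_cong[where f=rate_block] arg_cong[where f=expo_block] simp: block_def)
  then have "z = (rate (joint_law P K L), expo (joint_law P K L))"
    using joint_law_arrays[of K M L N P, OF K(2) L(2)] z by simp
  then show "z \<in> region P"
    unfolding region_def using K(2) L(3) finite_subset[OF K(2)] by blast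
qed


text \<open>The sum is \<open>card S\<close> times a point of the convex hull, to which
  Caratheodory's theorem applies. Padding with weight 0 makes the number of terms independent of
  \<open>S\<close>, hence the reduced alphabet fixed.\<close>

lemma cone_caratheodory:
  fixes z :: "'i \<Rightarrow> 'v::euclidean_space"
  assumes S: "finite S" "S \<noteq> {}"
  obtains e w where "\<And>j. e j \<in> S" "\<And>j::nat. (0::real) \<le> w j" "(\<Sum>j<DIM('v) + 1. w j *\<^sub>R z (e j)) = (\<Sum>i\<in>S. z i)"
proof -
  let ?n = "real (card S)"
  have n: "?n > 0" using S by (simp add: card_gt_0_iff)
  have "(\<Sum>i\<in>S. (1 / ?n) *\<^sub>R z i) \<in> convex hull (z ` S)"
    using S n by (intro convex_sum) (auto simp: hull_inc)
  then obtain T c where T: "finite T" "T \<subseteq> z ` S" "card T \<le> DIM('v) + 1" "\<And>x. x \<in> T \<Longrightarrow> 0 \<le> (c x :: real)"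
    "(\<Sum>v\<in>T. c v *\<^sub>R v) = (\<Sum>i\<in>S. (1 / ?n) *\<^sub>R z i)"
    unfolding convex_hull_caratheodory by auto
  obtain h where h: "bij_betw h {..<card T} T"
    using T(1) by (metis ex_bij_betw_nat_finite atLeast0LessThan)
  have hT: "h j \<in> T" if "j < card T" for j using h that by (auto simp: bij_betw_def)
  obtain s0 where s0: "s0 \<in> S" using S by auto
  define e where "e j = (if j < card T then inv_into S z (h j) else s0)" for j
  define w where "w j = (if j < card T then ?n * c (h j) else 0)" for j
  show thesis
  proof
    show "e j \<in> S" for j using s0 hT[of j] T(2) by (auto simp: e_def intro!: inv_into_into)
    show "0 \<le> w j" for j using T(4) hT[of j] n by (auto simp: w_def)
    have "(\<Sum>j<DIM('v) + 1. w j *\<^sub>R z (e j)) = (\<Sum>j<card T. w j *\<^sub>R z (e j))"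
      using T(3) by (intro sum.mono_neutral_right) (auto simp: w_def)
    also have "\<dots> = (\<Sum>j<card T. ?n *\<^sub>R (c (h j) *\<^sub>R h j))"
    proof (intro sum.cong refl)
      fix j assume "j \<in> {..<card T}"
      then have "h j \<in> z ` S" "j < card T" using hT T(2) by auto
      then show "w j *\<^sub>R z (e j) = ?n *\<^sub>R (c (h j) *\<^sub>R h j)" by (simp add: e_def w_def f_inv_into_f)
    qed
    also have "\<dots> = ?n *\<^sub>R (\<Sum>v\<in>T. c v *\<^sub>R v)"
      unfolding scaleR_sum_right using sum.reindex_bij_betw[OF h, of "\<lambda>v. ?n *\<^sub>R (c v *\<^sub>R v)"] by simp
    also have "\<dots> = (\<Sum>i\<in>S. z i)" using n by (simp add: T(5) scaleR_sum_right)
    finally show "(\<Sum>j<DIM('v) + 1. w j *\<^sub>R z (e j)) = (\<Sum>i\<in>S. z i)" .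
  qed
qed

text \<open>Origin of \<open>CARD('a) + 3\<close>: one coordinate for each value of
  \<open>a\<close>, two for the functionals \<open>F\<close> and \<open>G\<close>, and one more from
  Caratheodory's theorem.\<close>

lemma reweight_functions:
  fixes f :: "'i \<Rightarrow> 'a::finite \<Rightarrow> real" and F G :: "'i \<Rightarrow> real"
  assumes S: "finite S" "S \<noteq> {}"
  obtains e w where "\<And>j. e j \<in> S" "\<And>j::nat. 0 \<le> (w j :: real)"
    "\<And>a. (\<Sum>j<CARD('a) + 3. w j * f (e j) a) = (\<Sum>i\<in>S. f i a)"
    "(\<Sum>j<CARD('a) + 3. w j * F (e j)) = (\<Sum>i\<in>S. F i)"
    "(\<Sum>j<CARD('a) + 3. w j * G (e j)) = (\<Sum>i\<in>S. G i)"
proof -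
  let ?z = "\<lambda>i. ((\<chi> a. f i a) :: real ^ 'a, F i, G i)"
  have dim: "DIM((real ^ 'a) \<times> real \<times> real) + 1 = CARD('a) + 3" by simp
  obtain e w where ew: "\<And>j. e j \<in> S" "\<And>j::nat. (0::real) \<le> w j" "(\<Sum>j<CARD('a) + 3. w j *\<^sub>R ?z (e j)) = (\<Sum>i\<in>S. ?z i)"
    by (rule cone_caratheodory[OF S, of ?z, unfolded dim]) blast
  have 1: "fst (\<Sum>j<CARD('a) + 3. w j *\<^sub>R ?z (e j)) $ a = fst (\<Sum>i\<in>S. ?z i) $ a" for a by (simp only: ew(3))
  have 2: "snd (\<Sum>j<CARD('a) + 3. w j *\<^sub>R ?z (e j)) = snd (\<Sum>i\<in>S. ?z i)" by (simp only: ew(3))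
  show thesis
  proof (rule that[OF ew(1,2)])
    show "(\<Sum>j<CARD('a) + 3. w j * f (e j) a) = (\<Sum>i\<in>S. f i a)" for a using 1[of a] by (simp add: fst_sum)
    show "(\<Sum>j<CARD('a) + 3. w j * F (e j)) = (\<Sum>i\<in>S. F i)"
      using arg_cong[OF 2, of fst] by (simp add: snd_sum fst_sum)
    show "(\<Sum>j<CARD('a) + 3. w j * G (e j)) = (\<Sum>i\<in>S. G i)"
      using arg_cong[OF 2, of snd] by (simp add: snd_sum)
  qed
qed

lemma block_scale_left: "block P (\<lambda>x. c * k x) l = (\<lambda>x y. c * block P k l x y)"
  and block_scale_right: "block P k (\<lambda>y. c * l y) = (\<lambda>x y. c * block P k l x y)"
  by (auto simp: block_def[abs_def] ac_simps)

lemma block_nonneg: "(\<And>x. 0 \<le> k x) \<Longrightarrow> (\<And>y. 0 \<le> l y) \<Longrightarrow> 0 \<le> block P k l x y"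
  by (simp add: block_def)

text \<open>For each u separately, the columns v are reweighted so that the row sums of
  \<open>l\<close> and both block sums survive; then the u are reweighted so that the sums of
  \<open>k\<close> and both totals survive. Preserved sums keep the arrays stochastic, and
  homogeneity of the blocks lets a weight be absorbed into \<open>l\<close> or
  \<open>k\<close>.\<close>

lemma kernel_arrays_reduce:
  fixes P :: "('x::finite \<times> 'y::finite) pmf"
  assumes a: "kernel_arrays M N k l"
  obtains k' l' where "kernel_arrays (CARD('x) + 3) (CARD('y) + 3) k' l'"
    "array_rate P (CARD('x) + 3) (CARD('y) + 3) k' l' = array_rate P M N k l"
    "array_expo P (CARD('x) + 3) (CARD('y) + 3) k' l' = array_expo P M N k l"
proof -
  let ?M = "CARD('x) + 3" and ?N = "CARD('y) + 3"
  note nn = a[unfolded kernel_arrays_def]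
  have M0: "{..<M} \<noteq> {}" using nn by (metis sum.empty zero_neq_one)
  have N0: "{..<N} \<noteq> {}" using nn M0 by (metis ex_in_conv lessThan_iff sum.empty zero_neq_one)
  define good where "good u e w \<longleftrightarrow> (\<forall>j::nat. 0 \<le> (w j :: real)) \<and> (\<forall>y. (\<Sum>j<?N. w j * l u (e j) y) = (\<Sum>v<N. l u v y)) \<and>
    (\<Sum>j<?N. w j * rate_block (block P (k u) (l u (e j)))) = (\<Sum>v<N. rate_block (block P (k u) (l u v))) \<and>
    (\<Sum>j<?N. w j * expo_block (block P (k u) (l u (e j)))) = (\<Sum>v<N. expo_block (block P (k u) (l u v)))" for u e w
  have "\<exists>e w. good u e w" for u
    unfolding good_def
    by (rule reweight_functions[OF finite_lessThan N0, of "l u" "\<lambda>v. rate_block (block P (k u) (l u v))" "\<lambda>v. expo_block (block P (k u) (l u v))"]) blast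
  then obtain e w where ew: "\<And>u. good u (e u) (w u)" by metis
  have w: "\<And>u j. 0 \<le> w u j" "\<And>u y. (\<Sum>j<?N. w u j * l u (e u j) y) = (\<Sum>v<N. l u v y)"
    "\<And>u. (\<Sum>j<?N. w u j * rate_block (block P (k u) (l u (e u j)))) = (\<Sum>v<N. rate_block (block P (k u) (l u v)))"
    "\<And>u. (\<Sum>j<?N. w u j * expo_block (block P (k u) (l u (e u j)))) = (\<Sum>v<N. expo_block (block P (k u) (l u v)))"
    using ew unfolding good_def by blast+
  define l1 where "l1 u j = (\<lambda>y. w u j * l u (e u j) y)" for u j
  have l1: "rate_block (block P (k u) (l1 u j)) = w u j * rate_block (block P (k u) (l u (e u j)))"
    "expo_block (block P (k u) (l1 u j)) = w u j * expo_block (block P (k u) (l u (e u j)))" for u j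
    unfolding l1_def block_scale_right using w(1) nn by (auto intro!: block_scale block_nonneg)
  obtain d c where c: "\<And>j. d j \<in> {..<M}" "\<And>j::nat. 0 \<le> (c j :: real)" "\<And>x. (\<Sum>j<?M. c j * k (d j) x) = (\<Sum>u<M. k u x)"
    "(\<Sum>j<?M. c j * (\<Sum>v<?N. rate_block (block P (k (d j)) (l1 (d j) v)))) = (\<Sum>u<M. \<Sum>v<?N. rate_block (block P (k u) (l1 u v)))"
    "(\<Sum>j<?M. c j * (\<Sum>v<?N. expo_block (block P (k (d j)) (l1 (d j) v)))) = (\<Sum>u<M. \<Sum>v<?N. expo_block (block P (k u) (l1 u v)))"
    by (rule reweight_functions[OF finite_lessThan M0, of k "\<lambda>u. \<Sum>v<?N. rate_block (block P (k u) (l1 u v))"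
      "\<lambda>u. \<Sum>v<?N. expo_block (block P (k u) (l1 u v))"]) blast
  define k2 where "k2 j = (\<lambda>x. c j * k (d j) x)" for j
  define l2 where "l2 j = l1 (d j)" for j
  have nn1: "0 \<le> l1 u v y" for u v y using nn w(1) by (simp add: l1_def)
  have k2: "rate_block (block P (k2 j) (l2 j v)) = c j * rate_block (block P (k (d j)) (l1 (d j) v))"
    "expo_block (block P (k2 j) (l2 j v)) = c j * expo_block (block P (k (d j)) (l1 (d j) v))" for j v
    unfolding k2_def l2_def block_scale_left using c(2) nn nn1 by (auto intro!: block_scale block_nonneg)
  show thesis
  proof
    show "kernel_arrays ?M ?N k2 l2"
      using nn nn1 c(1,2,3) w(2) by (auto simp: kernel_arrays_def k2_def l2_def l1_def)
    show "array_rate P ?M ?N k2 l2 = array_rate P M N k l"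
      unfolding array_rate_def k2 sum_distrib_left[symmetric] c(4)
      unfolding l1 w(3) ..
    show "array_expo P ?M ?N k2 l2 = array_expo P M N k l"
      unfolding array_expo_def k2 sum_distrib_left[symmetric] c(5)
      unfolding l1 w(4) ..
  qed
qed


section \<open>Compactness of the set of kernels\<close>

lemma compact_function_box:
  fixes S :: "'a \<Rightarrow> 'b::topological_space set"
  assumes "\<And>i. compact (S i)"
  shows "compact (PiE UNIV S)"
proof -
  have "compactin (product_topology (\<lambda>_. euclidean) UNIV) (PiE UNIV S)"
    using assms by (simp add: compactin_PiE)
  then show ?thesis by (simp add: euclidean_product_topology)
qed

lemma continuous_on_block_sums:
  fixes m :: "'a::topological_space \<Rightarrow> 'x::finite \<Rightarrow> 'y::finite \<Rightarrow> real"
  assumes "\<And>x y. continuous_on S (\<lambda>t. m t x y)" "\<And>t x y. t \<in> S \<Longrightarrow> 0 \<le> m t x y"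
  shows "continuous_on S (\<lambda>t. rate_block (m t))" "continuous_on S (\<lambda>t. expo_block (m t))"
  unfolding rate_block_def expo_block_def using assms
  by (auto intro!: continuous_intros continuous_on_compose2[OF continuous_on_xlog] sum_nonneg)

type_synonym ('x, 'y) arrays = "(nat \<Rightarrow> 'x \<Rightarrow> real) \<times> (nat \<Rightarrow> nat \<Rightarrow> 'y \<Rightarrow> real)"

lemma region_attains_max:
  fixes P :: "('x::finite \<times> 'y::finite) pmf"
  assumes ne: "(r0, e0) \<in> region P" "r0 \<le> R"
  shows "\<exists>r e. (r, e) \<in> region P \<and> r \<le> R \<and> (\<forall>r' e'. (r', e') \<in> region P \<longrightarrow> r' \<le> R \<longrightarrow> e' \<le> e)"
proof -
  let ?M = "CARD('x) + 3" and ?N = "CARD('y) + 3"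
  define B :: "('x, 'y) arrays set"
    where "B = (PiE UNIV (\<lambda>u. PiE UNIV (\<lambda>x. {0..1}))) \<times> (PiE UNIV (\<lambda>u. PiE UNIV (\<lambda>v. PiE UNIV (\<lambda>y. {0..1}))))"
  have B: "(k, l) \<in> B \<longleftrightarrow> (\<forall>u x. 0 \<le> k u x \<and> k u x \<le> 1) \<and> (\<forall>u v y. 0 \<le> l u v y \<and> l u v y \<le> 1)" for k l
    unfolding B_def by (auto simp: PiE_iff)
  have cB: "compact B"
    unfolding B_def by (intro compact_Times compact_function_box compact_Icc)
  have ck: "continuous_on S (\<lambda>t. fst t u x)" and cl: "continuous_on S (\<lambda>t. snd t u v y)"
    for S :: "('x, 'y) arrays set" and u v x y
    by (rule continuous_on_product_then_coordinatewise[where f="\<lambda>t. fst t u" and i=x],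
        rule continuous_on_product_then_coordinatewise[where f="\<lambda>t. fst t" and i=u],
        rule continuous_on_fst, rule continuous_on_id)
       (rule continuous_on_product_then_coordinatewise[where f="\<lambda>t. snd t u v" and i=y],
        rule continuous_on_product_then_coordinatewise[where f="\<lambda>t. snd t u" and i=v],
        rule continuous_on_product_then_coordinatewise[where f="\<lambda>t. snd t" and i=u],
        rule continuous_on_snd, rule continuous_on_id)
  have cb: "continuous_on S (\<lambda>t. block P (fst t u) (snd t u v) x y)"
    for S :: "('x, 'y) arrays set" and u v x y
    unfolding block_def by (intro continuous_intros ck cl)
  have nn: "0 \<le> block P (fst t u) (snd t u v) x y" if "t \<in> B" for t u v x y
    using that B[of "fst t" "snd t"] by (intro block_nonneg) auto
  have cr: "continuous_on B (\<lambda>t. array_rate P ?M ?N (fst t) (snd t))"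
    and ce: "continuous_on B (\<lambda>t. array_expo P ?M ?N (fst t) (snd t))"
    unfolding array_rate_def array_expo_def
    by (intro continuous_intros continuous_on_block_sums cb nn; assumption)+
  define C where "C = {t\<in>B. (\<forall>x. (\<Sum>u<?M. fst t u x) = 1) \<and> (\<forall>u<?M. \<forall>y. (\<Sum>v<?N. snd t u v y) = 1) \<and>
      array_rate P ?M ?N (fst t) (snd t) \<le> R}"
  let ?D = "(\<Inter>x. {t :: ('x, 'y) arrays. (\<Sum>u<?M. fst t u x) = 1})
      \<inter> (\<Inter>u\<in>{..<?M}. \<Inter>y. {t. (\<Sum>v<?N. snd t u v y) = 1})"
  have eqC: "C = {t\<in>B. array_rate P ?M ?N (fst t) (snd t) \<le> R} \<inter> ?D"
    unfolding C_def by blast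
  \<comment> \<open>The rate is continuous on \<open>B\<close> only, where the entries are
    nonnegative, so the sublevel set is closed relative to the compact box.\<close>
  have compact_rate: "compact {t\<in>B. array_rate P ?M ?N (fst t) (snd t) \<le> R}"
  proof -
    have eq: "{t\<in>B. array_rate P ?M ?N (fst t) (snd t) \<le> R} = B \<inter> (\<lambda>t. array_rate P ?M ?N (fst t) (snd t)) -` {..R}" by auto
    have "\<exists>T. closed T \<and> T \<inter> B = (\<lambda>t. array_rate P ?M ?N (fst t) (snd t)) -` {..R} \<inter> B"
      using cr[unfolded continuous_on_closed_invariant, rule_format, of "{..R}"] by simp
    then obtain T where T: "closed T" "T \<inter> B = (\<lambda>t. array_rate P ?M ?N (fst t) (snd t)) -` {..R} \<inter> B" by blast
    have "{t\<in>B. array_rate P ?M ?N (fst t) (snd t) \<le> R} = B \<inter> T" unfolding eq using T(2) by blast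
    then show ?thesis using compact_Int_closed[OF cB T(1)] by simp
  qed
  have "closed ?D"
    by (intro closed_Int closed_INT ballI closed_Collect_eq continuous_on_sum continuous_on_const ck cl)
  then have cC: "compact C" unfolding eqC by (rule compact_Int_closed[OF compact_rate])
  have red: "\<exists>t\<in>C. e' = array_expo P ?M ?N (fst t) (snd t)" if re: "(r', e') \<in> region P" "r' \<le> R" for r' e'
  proof -
    obtain M N k l where "kernel_arrays M N k l" and "(r', e') = (array_rate P M N k l, array_expo P M N k l)"
      using re(1) unfolding region_arrays by blast
    then obtain k' l' where kl: "kernel_arrays ?M ?N k' l'"
      "array_rate P ?M ?N k' l' = r'" "array_expo P ?M ?N k' l' = e'"
      using kernel_arrays_reduce[of M N k l P] by auto
    note nn = kl(1)[unfolded kernel_arrays_def]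
    \<comment> \<open>The entries outside the index range are unconstrained and could leave the unit
      box; they are set to 0.\<close>
    define k2 where "k2 u = (if u < ?M then k' u else (\<lambda>_. 0))" for u
    define l2 where "l2 u v = (if u < ?M \<and> v < ?N then l' u v else (\<lambda>_. 0))" for u v
    have "k' u x \<le> 1" if "u < ?M" for u x
      using member_le_sum[of u "{..<?M}" "\<lambda>u. k' u x"] nn that by auto
    moreover have "l' u v y \<le> 1" if "u < ?M" "v < ?N" for u v y
      using member_le_sum[of v "{..<?N}" "\<lambda>v. l' u v y"] nn that by auto
    ultimately have "(k2, l2) \<in> B" using nn by (auto simp: B k2_def l2_def)
    moreover have "array_rate P ?M ?N k2 l2 = r'" "array_expo P ?M ?N k2 l2 = e'"
      unfolding kl(2,3)[symmetric] array_rate_def array_expo_def by (auto simp: k2_def l2_def intro!: sum.cong)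
    moreover have "(\<Sum>u<?M. k2 u x) = 1" for x
      using nn by (subst sum.cong[OF refl, of _ _ "\<lambda>u. k' u x"]) (auto simp: k2_def)
    moreover have "(\<Sum>v<?N. l2 u v y) = 1" if "u < ?M" for u y
      using nn that by (subst sum.cong[OF refl, of _ _ "\<lambda>v. l' u v y"]) (auto simp: l2_def)
    ultimately show ?thesis using re(2) by (intro bexI[of _ "(k2, l2)"]) (auto simp: C_def)
  qed
  from red[OF ne] have "C \<noteq> {}" by blast
  moreover have "continuous_on C (\<lambda>t. array_expo P ?M ?N (fst t) (snd t))"
    using ce by (rule continuous_on_subset) (auto simp: C_def)
  ultimately obtain t where t: "t \<in> C"
    "\<forall>s\<in>C. array_expo P ?M ?N (fst s) (snd s) \<le> array_expo P ?M ?N (fst t) (snd t)"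
    using continuous_attains_sup[OF cC] by blast
  have "(fst t, snd t) \<in> B" using t(1) by (simp add: C_def)
  then have "kernel_arrays ?M ?N (fst t) (snd t)" and r: "array_rate P ?M ?N (fst t) (snd t) \<le> R"
    using t(1) unfolding B by (auto simp: C_def kernel_arrays_def)
  then have "(array_rate P ?M ?N (fst t) (snd t), array_expo P ?M ?N (fst t) (snd t)) \<in> region P"
    unfolding region_arrays by blast
  moreover have "e' \<le> array_expo P ?M ?N (fst t) (snd t)" if "(r', e') \<in> region P" "r' \<le> R" for r' e'
    using red[OF that] t(2) by blast
  ultimately show ?thesis using r by blast
qed

section \<open>Time sharing\<close>

lemma ent_const [simp]: "ent W (\<lambda>_. c) = 0"
  by (simp add: ent_def pr_def)

text \<open>The trivial scheme with constant messages. It satisfies every rate constraint R \<ge> 0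
  and is the partner in time sharing.\<close>

lemma region_zero: "(0, 0) \<in> region P"
proof -
  let ?W = "joint_law P (\<lambda>_. return_pmf (0::nat)) (\<lambda>_. return_pmf (0::nat))"
  have W: "?W = map_pmf (\<lambda>(x,y). (x,y,0,0)) P"
    by (simp add: joint_law_def map_pmf_def bind_return_pmf case_prod_unfold)
  have c: "ent P (\<lambda>z. (c, f z)) = ent P f" "ent P (\<lambda>z. (f z, c)) = ent P f" "ent P (\<lambda>z. (c, f z, c)) = ent P f"
    for f :: "_ \<Rightarrow> 'z" and c :: nat by (auto intro!: ent_cong)
  have "rate ?W = 0" "expo ?W = 0"
    unfolding W rate_def expo_def ent_map by (simp_all add: case_prod_unfold c)
  then show ?thesis unfolding region_def by force
qed

lemma sum_lessThan_add: "(\<Sum>u<a + b. f u) = (\<Sum>u<a. f u) + (\<Sum>u<b. f (a + u))"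
  for f :: "nat \<Rightarrow> 'a::comm_monoid_add"
  by (induction b) (simp_all add: add.assoc)

lemma block_0: "rate_block (\<lambda>x y. 0) = 0" "expo_block (\<lambda>x y. 0) = 0"
  by (simp_all add: rate_block_def expo_block_def)

text \<open>Columns of zeros give zero blocks. Two schemes can thus be brought to a common alphabet
  for V before they are combined.\<close>

lemma kernel_arrays_pad:
  assumes a: "kernel_arrays M N k l" and le: "N \<le> N'"
  obtains l' where "kernel_arrays M N' k l'" "array_rate P M N' k l' = array_rate P M N k l"
    "array_expo P M N' k l' = array_expo P M N k l"
proof
  define l' where "l' = (\<lambda>u v. if v < N then l u v else (\<lambda>_. 0))"
  have 1: "(\<Sum>v<N'. l' u v y) = (\<Sum>v<N. l u v y)" for u y
    using le by (intro sum.mono_neutral_cong_right) (auto simp: l'_def)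
  have z: "block P (k u) (\<lambda>_. 0) = (\<lambda>x y. 0)" for u by (auto simp: block_def fun_eq_iff)
  have 2: "(\<Sum>v<N'. rate_block (block P (k u) (l' u v))) = (\<Sum>v<N. rate_block (block P (k u) (l u v)))"
    "(\<Sum>v<N'. expo_block (block P (k u) (l' u v))) = (\<Sum>v<N. expo_block (block P (k u) (l u v)))" for u
    using le by (intro sum.mono_neutral_cong_right; auto simp: l'_def z block_0)+
  show "kernel_arrays M N' k l'" using a 1 by (auto simp: kernel_arrays_def l'_def)
  show "array_rate P M N' k l' = array_rate P M N k l" "array_expo P M N' k l' = array_expo P M N k l"
    by (simp_all add: array_rate_def array_expo_def 2)
qed

text \<open>Time sharing: the index of the scheme in use becomes part of \<open>U\<close>.\<close>

lemma convex_region: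
  fixes P :: "('x::finite \<times> 'y::finite) pmf"
  shows "convex (region P)"
proof (rule convexI)
  fix z z' :: "real \<times> real" and s t :: real
  assume z: "z \<in> region P" "z' \<in> region P" and st: "0 \<le> s" "0 \<le> t" "s + t = 1"
  obtain M N k l where 1: "kernel_arrays M N k l" "z = (array_rate P M N k l, array_expo P M N k l)"
    using z(1) unfolding region_arrays by blast
  obtain M' N' k' l' where 2: "kernel_arrays M' N' k' l'" "z' = (array_rate P M' N' k' l', array_expo P M' N' k' l')"
    using z(2) unfolding region_arrays by blast
  let ?N = "max N N'"
  obtain l1 where l1: "kernel_arrays M ?N k l1" "z = (array_rate P M ?N k l1, array_expo P M ?N k l1)"
    using kernel_arrays_pad[OF 1(1), of ?N P] 1(2) by (metis max.cobounded1)
  obtain l2 where l2: "kernel_arrays M' ?N k' l2" "z' = (array_rate P M' ?N k' l2, array_expo P M' ?N k' l2)"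
    using kernel_arrays_pad[OF 2(1), of ?N P] 2(2) by (metis max.cobounded2)
  \<comment> \<open>The two alphabets for U are put side by side. Only \<open>k\<close> carries the
    weights \<open>s\<close> and \<open>t\<close>; each conditional kernel \<open>l\<close> is kept
    as it is.\<close>
  define k3 where "k3 = (\<lambda>u x. if u < M then s * k u x else t * k' (u - M) x)"
  define l3 where "l3 = (\<lambda>u. if u < M then l1 u else l2 (u - M))"
  have k3: "k3 u = (\<lambda>x. s * k u x)" "l3 u = l1 u" if "u < M" for u using that by (auto simp: k3_def l3_def)
  have k3': "k3 (M + u) = (\<lambda>x. t * k' u x)" "l3 (M + u) = l2 u" for u by (auto simp: k3_def l3_def)
  note nn = l1(1)[unfolded kernel_arrays_def] l2(1)[unfolded kernel_arrays_def]
  have b: "rate_block (block P (\<lambda>x. s * k u x) (l1 u v)) = s * rate_block (block P (k u) (l1 u v))"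
    "expo_block (block P (\<lambda>x. s * k u x) (l1 u v)) = s * expo_block (block P (k u) (l1 u v))"
    "rate_block (block P (\<lambda>x. t * k' u x) (l2 u v)) = t * rate_block (block P (k' u) (l2 u v))"
    "expo_block (block P (\<lambda>x. t * k' u x) (l2 u v)) = t * expo_block (block P (k' u) (l2 u v))" for u v
    unfolding block_scale_left using nn st by (auto intro!: block_scale block_nonneg)
  have ka: "kernel_arrays (M + M') ?N k3 l3"
    unfolding kernel_arrays_def
  proof (intro conjI allI impI)
    show "0 \<le> k3 u x" "0 \<le> l3 u v y" for u v x y using nn st by (auto simp: k3_def l3_def)
    show "(\<Sum>u<M + M'. k3 u x) = 1" for x
      unfolding sum_lessThan_add k3' using nn st
      by (simp add: k3 cong: sum.cong_simp flip: sum_distrib_left)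
    show "(\<Sum>v<?N. l3 u v y) = 1" if "u < M + M'" for u y
      using nn that by (auto simp: l3_def)
  qed
  \<comment> \<open>The summands that do not depend on the kernels must be split in the proportions
    \<open>s\<close> and \<open>t\<close> as well.\<close>
  have e: "a = s * a + t * a" for a :: real using st(3) by (metis distrib_right mult_1)
  have S: "(\<Sum>u<M + M'. \<Sum>v<?N. rate_block (block P (k3 u) (l3 u v)))
      = s * (\<Sum>u<M. \<Sum>v<?N. rate_block (block P (k u) (l1 u v))) + t * (\<Sum>u<M'. \<Sum>v<?N. rate_block (block P (k' u) (l2 u v)))"
    "(\<Sum>u<M + M'. \<Sum>v<?N. expo_block (block P (k3 u) (l3 u v)))
      = s * (\<Sum>u<M. \<Sum>v<?N. expo_block (block P (k u) (l1 u v))) + t * (\<Sum>u<M'. \<Sum>v<?N. expo_block (block P (k' u) (l2 u v)))"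
    unfolding sum_lessThan_add k3' b sum_distrib_left by (simp_all add: k3 b cong: sum.cong_simp)
  have "array_rate P (M + M') ?N k3 l3 = s * array_rate P M ?N k l1 + t * array_rate P M' ?N k' l2"
    unfolding array_rate_def S by (subst e[of "ent P (\<lambda>z. z)"]) (simp add: algebra_simps)
  moreover have "array_expo P (M + M') ?N k3 l3 = s * array_expo P M ?N k l1 + t * array_expo P M' ?N k' l2"
    unfolding array_expo_def S by (subst e[of "ent P fst + ent P snd - ent P (\<lambda>z. z)"]) (simp add: algebra_simps)
  ultimately show "s *\<^sub>R z + t *\<^sub>R z' \<in> region P"
    unfolding region_arrays using ka l1(2) l2(2)
    by (intro exI[of _ "M + M'"] exI[of _ ?N] exI[of _ k3] exI[of _ l3]) simp
qed

text \<open>Relabelling by \<open>to_nat\<close>. Single-letterization creates auxiliary variables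
  that contain letters and lists.\<close>

lemma region_countable:
  fixes K :: "'x \<Rightarrow> 'u::countable pmf" and L :: "'u \<times> 'y \<Rightarrow> 'v::countable pmf"
  assumes "\<And>x. finite (set_pmf (K x))" "\<And>z. finite (set_pmf (L z))"
  shows "(rate (joint_law P K L), expo (joint_law P K L)) \<in> region P"
proof -
  define K' where "K' x = map_pmf to_nat (K x)" for x
  define L' where "L' z = map_pmf to_nat (L (from_nat (fst z), snd z))" for z
  let ?h = "\<lambda>(x,y,u,v). (x,y,to_nat u,to_nat v)"
  have W: "joint_law P K' L' = map_pmf ?h (joint_law P K L)"
    by (simp add: joint_law_def K'_def L'_def map_pmf_def bind_assoc_pmf bind_return_pmf case_prod_unfold)
  have "rate (joint_law P K' L') = rate (joint_law P K L)" "expo (joint_law P K' L') = expo (joint_law P K L)"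
    unfolding rate_def expo_def W ent_map
    by (auto intro!: arg_cong2[where f="(+)"] arg_cong2[where f="(-)"] ent_cong split: prod.splits)
  moreover have "finite (set_pmf (K' x))" "finite (set_pmf (L' z))" for x z
    using assms by (auto simp: K'_def L'_def)
  ultimately show ?thesis unfolding region_def mem_Collect_eq by (intro exI[of _ K'] exI[of _ L']) simp
qed

text \<open>At points of probability 0 any conditional law will do; a point mass keeps all of them
  finitely supported.\<close>

lemma pmf_disintegrate:
  fixes P :: "('x \<times> 'y) pmf"
  assumes "finite (set_pmf P)"
  obtains C where "P = bind_pmf (map_pmf fst P) (\<lambda>x. map_pmf (Pair x) (C x))" "\<And>x. finite (set_pmf (C x))"
proof
  define C where "C x = (if x \<in> fst ` set_pmf P then map_pmf snd (cond_pmf P {z. fst z = x}) else return_pmf undefined)" for x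
  have ne: "set_pmf P \<inter> {z. fst z = x} \<noteq> {}" if "x \<in> fst ` set_pmf P" for x using that by auto
  show "finite (set_pmf (C x))" for x using assms ne[of x] by (auto simp: C_def set_cond_pmf)
  show "P = bind_pmf (map_pmf fst P) (\<lambda>x. map_pmf (Pair x) (C x))"
  proof (rule pmf_eqI)
    fix z :: "'x \<times> 'y"
    obtain x y where z: "z = (x, y)" by (cases z)
    have "pmf (bind_pmf (map_pmf fst P) (\<lambda>x. map_pmf (Pair x) (C x))) z = pmf (map_pmf fst P) x * pmf (C x) y"
      unfolding z by (rule pmf_bind_map_Pair)
    also have "\<dots> = pmf P z"
    proof (cases "x \<in> fst ` set_pmf P")
      case True
      have fin: "finite (set_pmf (cond_pmf P {z. fst z = x}))" using assms ne[OF True] by (simp add: set_cond_pmf)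
      have m: "pmf (map_pmf fst P) x = measure P {z. fst z = x}" by (simp add: pmf_map vimage_def)
      have pos: "pmf (map_pmf fst P) x > 0" using True by (intro pmf_positive) simp
      have "pmf (C x) y = (\<Sum>w\<in>set_pmf P \<inter> {z. fst z = x}. if snd w = y then pmf P w / measure P {z. fst z = x} else 0)"
        using True ne[OF True] by (simp add: C_def pmf_map_sum[OF fin] set_cond_pmf pmf_cond cong: if_cong sum.cong_simp)
      also have "\<dots> = (\<Sum>w\<in>set_pmf P \<inter> {z. fst z = x}. if w = z then pmf P z / measure P {z. fst z = x} else 0)"
        by (intro sum.cong) (auto simp: z)
      also have "\<dots> = pmf P z / measure P {z. fst z = x}"
        using assms by (auto simp: z set_pmf_iff)
      finally show ?thesis using pos unfolding m by simp
    next
      case False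
      then have "z \<notin> set_pmf P" "pmf (map_pmf fst P) x = 0" by (force simp: z, simp add: pmf_eq_0_set_pmf)
      then show ?thesis by (simp add: set_pmf_iff)
    qed
    finally show "pmf P z = pmf (bind_pmf (map_pmf fst P) (\<lambda>x. map_pmf (Pair x) (C x))) z" ..
  qed
qed

lemma ent_pair_pmf:
  assumes "finite (set_pmf A)" "finite (set_pmf B)"
  shows "ent (pair_pmf A B) (\<lambda>z. z) = ent A (\<lambda>a. a) + ent B (\<lambda>b. b)"
proof -
  have pr: "pr W (\<lambda>z. z) w = pmf W w" for W :: "'z pmf" and w by (simp add: pmf_map_pr[symmetric])
  have "expect (pair_pmf A B) (\<lambda>z. log 2 (pmf (pair_pmf A B) z)) = expect (pair_pmf A B) (\<lambda>z. log 2 (pmf A (fst z)) + log 2 (pmf B (snd z)))"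
    by (intro expect_cong) (auto simp: pmf_pair log_mult pmf_positive set_pmf_iff)
  also have "\<dots> = expect (map_pmf fst (pair_pmf A B)) (\<lambda>z. log 2 (pmf A z)) + expect (map_pmf snd (pair_pmf A B)) (\<lambda>z. log 2 (pmf B z))"
    unfolding integral_map_pmf using assms by (intro expect_add) simp
  also have "\<dots> = expect A (\<lambda>z. log 2 (pmf A z)) + expect B (\<lambda>z. log 2 (pmf B z))"
    by (simp only: map_fst_pair_pmf map_snd_pair_pmf)
  finally show ?thesis by (simp add: ent_def pr)
qed

section \<open>Single-letterization\<close>

text \<open>A pair of lists rather than a list of pairs: node A then observes the first component
  and node B the second, and \<open>region\<close> applies to the block problem as it
  stands.\<close>

definition seq_law :: "nat \<Rightarrow> ('x \<times> 'y) pmf \<Rightarrow> ('x list \<times> 'y list) pmf" where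
  "seq_law n P = map_pmf (\<lambda>zs. (map fst zs, map snd zs)) (replicate_pmf n P)"

lemma finite_set_replicate_pmf: "finite (set_pmf P) \<Longrightarrow> finite (set_pmf (replicate_pmf n P))"
  by (induction n) auto

lemma finite_set_seq_law: "finite (set_pmf P) \<Longrightarrow> finite (set_pmf (seq_law n P))"
  by (simp add: seq_law_def finite_set_replicate_pmf)

lemma seq_law_Suc: "seq_law (Suc n) P =
   bind_pmf P (\<lambda>z. bind_pmf (seq_law n P) (\<lambda>zs. return_pmf (fst z # fst zs, snd z # snd zs)))"
  by (simp add: seq_law_def map_pmf_def bind_assoc_pmf bind_return_pmf)

text \<open>Splitting off the first letter: it is treated with \<open>U\<^sub>1 = (U, Y\<^sup>n\<^sup>-\<^sup>1)\<close>, the remaining letters with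
  \<open>U\<^sub>2 = (U, X\<^sub>1)\<close>, and \<open>V\<close> is kept. Both rate and exponent then grow by the same amount
  \<open>d = I(X\<^sub>1; Y\<^sup>n\<^sup>-\<^sup>1 | U V)\<close>.\<close>

lemma region_split_first:
  fixes P :: "('x::countable \<times> 'y::countable) pmf" and Q :: "('x list \<times> 'y list) pmf"
  assumes finP: "finite (set_pmf P)" and finQ: "finite (set_pmf Q)"
    and re: "(r, e) \<in> region (bind_pmf P (\<lambda>z. bind_pmf Q (\<lambda>zs. return_pmf (fst z # fst zs, snd z # snd zs))))"
  obtains d r1 e1 r2 e2 where "0 \<le> d" "(r1, e1) \<in> region P" "(r2, e2) \<in> region Q"
    "r + d = r1 + r2" "e + d = e1 + e2"
proof -
  let ?PQ = "bind_pmf P (\<lambda>z. bind_pmf Q (\<lambda>zs. return_pmf (fst z # fst zs, snd z # snd zs)))"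
  obtain K :: "'x list \<Rightarrow> nat pmf" and L :: "nat \<times> 'y list \<Rightarrow> nat pmf" where
    re: "r = rate (joint_law ?PQ K L)" "e = expo (joint_law ?PQ K L)"
    and fK: "\<And>x. finite (set_pmf (K x))" and fL: "\<And>z. finite (set_pmf (L z))"
    using re unfolding region_def by auto
  \<comment> \<open>One space carrying the first pair, the remaining pairs and both messages. The
    original law and the two new ones are its images.\<close>
  define \<Omega> where "\<Omega> = bind_pmf P (\<lambda>z. bind_pmf Q (\<lambda>zs. bind_pmf (K (fst z # fst zs)) (\<lambda>u.
     bind_pmf (L (u, snd z # snd zs)) (\<lambda>v. return_pmf (fst z, snd z, fst zs, snd zs, u, v)))))"
  have fin: "finite (set_pmf \<Omega>)" using finP finQ fK fL by (auto simp: \<Omega>_def)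
  have W: "joint_law ?PQ K L = map_pmf (\<lambda>(x,y,xs,ys,u,v). (x # xs, y # ys, u, v)) \<Omega>"
    by (simp add: joint_law_def \<Omega>_def map_pmf_def bind_assoc_pmf bind_return_pmf)
  \<comment> \<open>In the problem for the first letter, node A draws all other pairs itself and
    passes their Y part on inside U.\<close>
  define K1 where "K1 x = bind_pmf Q (\<lambda>zs. bind_pmf (K (x # fst zs)) (\<lambda>u. return_pmf (u, snd zs)))" for x
  define L1 where "L1 w = L (fst (fst w), snd w # snd (fst w))" for w
  have W1: "joint_law P K1 L1 = map_pmf (\<lambda>(x,y,xs,ys,u,v). (x, y, (u, ys), v)) \<Omega>"
    by (simp add: joint_law_def \<Omega>_def map_pmf_def bind_assoc_pmf bind_return_pmf K1_def L1_def case_prod_unfold)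
  obtain C where C: "P = bind_pmf (map_pmf fst P) (\<lambda>x. map_pmf (Pair x) (C x))" "\<And>x. finite (set_pmf (C x))"
    using pmf_disintegrate[OF finP] by blast
  define K2 where "K2 xs = bind_pmf (map_pmf fst P) (\<lambda>x. bind_pmf (K (x # xs)) (\<lambda>u. return_pmf (u, x)))" for xs
  \<comment> \<open>Node B of the remaining problem does not know the first Y letter. It redraws
    this letter given the first X letter, which is part of U; this is legitimate because u depends
    on the first pair only through its X letter.\<close>
  define L2 where "L2 w = bind_pmf (C (snd (fst w))) (\<lambda>y. L (fst (fst w), y # snd w))" for w
  have W2: "joint_law Q K2 L2 = map_pmf (\<lambda>(x,y,xs,ys,u,v). (xs, ys, (u, x), v)) \<Omega>"
  proof -
    have "map_pmf (\<lambda>(x,y,xs,ys,u,v). (xs, ys, (u, x), v)) \<Omega> =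
      bind_pmf P (\<lambda>z. bind_pmf Q (\<lambda>zs. bind_pmf (K (fst z # fst zs)) (\<lambda>u.
        bind_pmf (L (u, snd z # snd zs)) (\<lambda>v. return_pmf (fst zs, snd zs, (u, fst z), v)))))"
      by (simp add: \<Omega>_def map_pmf_def bind_assoc_pmf bind_return_pmf)
    also have "\<dots> = bind_pmf (map_pmf fst P) (\<lambda>x. bind_pmf (C x) (\<lambda>y. bind_pmf Q (\<lambda>zs. bind_pmf (K (x # fst zs)) (\<lambda>u.
        bind_pmf (L (u, y # snd zs)) (\<lambda>v. return_pmf (fst zs, snd zs, (u, x), v))))))"
      by (subst C(1)) (simp add: bind_assoc_pmf bind_map_pmf)
    also have "\<dots> = bind_pmf (map_pmf fst P) (\<lambda>x. bind_pmf Q (\<lambda>zs. bind_pmf (C x) (\<lambda>y. bind_pmf (K (x # fst zs)) (\<lambda>u.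
        bind_pmf (L (u, y # snd zs)) (\<lambda>v. return_pmf (fst zs, snd zs, (u, x), v))))))"
      by (subst bind_commute_pmf[of Q]) (rule refl)
    also have "\<dots> = bind_pmf Q (\<lambda>zs. bind_pmf (map_pmf fst P) (\<lambda>x. bind_pmf (C x) (\<lambda>y. bind_pmf (K (x # fst zs)) (\<lambda>u.
        bind_pmf (L (u, y # snd zs)) (\<lambda>v. return_pmf (fst zs, snd zs, (u, x), v))))))"
      by (rule bind_commute_pmf)
    also have "\<dots> = bind_pmf Q (\<lambda>zs. bind_pmf (map_pmf fst P) (\<lambda>x. bind_pmf (K (x # fst zs)) (\<lambda>u. bind_pmf (C x) (\<lambda>y.
        bind_pmf (L (u, y # snd zs)) (\<lambda>v. return_pmf (fst zs, snd zs, (u, x), v))))))"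
      by (intro bind_pmf_cong refl bind_commute_pmf)
    also have "\<dots> = joint_law Q K2 L2"
      by (simp add: joint_law_def bind_assoc_pmf bind_return_pmf K2_def L2_def case_prod_unfold bind_map_pmf)
    finally show ?thesis ..
  qed
  have reg1: "(rate (joint_law P K1 L1), expo (joint_law P K1 L1)) \<in> region P"
    by (rule region_countable) (use finQ fK fL in \<open>auto simp: K1_def L1_def\<close>)
  have reg2: "(rate (joint_law Q K2 L2), expo (joint_law Q K2 L2)) \<in> region Q"
    by (rule region_countable) (use finP C(2) fK fL in \<open>auto simp: K2_def L2_def\<close>)
  have PQ: "map_pmf (\<lambda>(x,y,xs,ys,u,v). ((x,y),(xs,ys))) \<Omega> = pair_pmf P Q"
    by (simp add: \<Omega>_def map_pmf_def bind_assoc_pmf bind_return_pmf pair_pmf_def)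
  \<comment> \<open>The first pair is independent of the rest, so the entropies of the full X and Y
    sequences split.\<close>
  have indep: "ent \<Omega> (\<lambda>(x,y,xs,ys,u,v). (f (x,y), g (xs,ys))) = ent \<Omega> (\<lambda>(x,y,xs,ys,u,v). f (x,y)) + ent \<Omega> (\<lambda>(x,y,xs,ys,u,v). g (xs,ys))"
    for f :: "_ \<Rightarrow> 'z" and g :: "_ \<Rightarrow> 'z1"
  proof -
    have 1: "ent \<Omega> (\<lambda>(x,y,xs,ys,u,v). h ((x,y),(xs,ys))) = ent (pair_pmf P Q) h" for h :: "_ \<Rightarrow> 'z2"
      unfolding PQ[symmetric] ent_map by (simp add: case_prod_unfold)
    have m: "map_pmf (\<lambda>z. (f (fst z), g (snd z))) (pair_pmf P Q) = pair_pmf (map_pmf f P) (map_pmf g Q)"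
      by (simp add: pair_pmf_def map_pmf_def bind_assoc_pmf bind_return_pmf)
    have "ent \<Omega> (\<lambda>(x,y,xs,ys,u,v). (f (x,y), g (xs,ys))) = ent (pair_pmf P Q) (\<lambda>z. (f (fst z), g (snd z)))"
      using 1[of "\<lambda>z. (f (fst z), g (snd z))"] by simp
    also have "\<dots> = ent (pair_pmf (map_pmf f P) (map_pmf g Q)) (\<lambda>z. z)" by (simp only: m[symmetric] ent_map)
    also have "\<dots> = ent (map_pmf f P) (\<lambda>z. z) + ent (map_pmf g Q) (\<lambda>z. z)"
      using finP finQ by (intro ent_pair_pmf) auto
    also have "ent (map_pmf f P) (\<lambda>z. z) = ent (map_pmf fst (pair_pmf P Q)) f" by (simp only: ent_map map_fst_pair_pmf)
    also have "\<dots> = ent \<Omega> (\<lambda>(x,y,xs,ys,u,v). f (x,y))" using 1[of "\<lambda>z. f (fst z)"] by (simp add: ent_map)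
    also have "ent (map_pmf g Q) (\<lambda>z. z) = ent (map_pmf snd (pair_pmf P Q)) g" by (simp only: ent_map map_snd_pair_pmf)
    also have "\<dots> = ent \<Omega> (\<lambda>(x,y,xs,ys,u,v). g (xs,ys))" using 1[of "\<lambda>z. g (snd z)"] by (simp add: ent_map)
    finally show ?thesis .
  qed
  \<comment> \<open>From here on only linear arithmetic remains. \<open>H6\<close> enters the two
    new problems with opposite signs and disappears from both sums.\<close>
  define H1 where "H1 = ent \<Omega> (\<lambda>(x,y,xs,ys,u,v). (x,xs,u))"
  define H2 where "H2 = ent \<Omega> (\<lambda>(x,y,xs,ys,u,v). (y,ys,u))"
  define H3 where "H3 = ent \<Omega> (\<lambda>(x,y,xs,ys,u,v). (u,v))"
  define H4 where "H4 = ent \<Omega> (\<lambda>(x,y,xs,ys,u,v). (y,ys,u,v))"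
  define H5 where "H5 = ent \<Omega> (\<lambda>(x,y,xs,ys,u,v). (x,xs,u,v))"
  define H6 where "H6 = ent \<Omega> (\<lambda>(x,y,xs,ys,u,v). (x,ys,u))"
  define H7 where "H7 = ent \<Omega> (\<lambda>(x,y,xs,ys,u,v). (x,ys,u,v))"
  define H8 where "H8 = ent \<Omega> (\<lambda>(x,y,xs,ys,u,v). (ys,u,v))"
  define H9 where "H9 = ent \<Omega> (\<lambda>(x,y,xs,ys,u,v). (x,u,v))"
  define X where "X = ent \<Omega> (\<lambda>(x,y,xs,ys,u,v). x)"
  define Y where "Y = ent \<Omega> (\<lambda>(x,y,xs,ys,u,v). y)"
  define Xs where "Xs = ent \<Omega> (\<lambda>(x,y,xs,ys,u,v). xs)"
  define Ys where "Ys = ent \<Omega> (\<lambda>(x,y,xs,ys,u,v). ys)"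
  note H = H1_def H2_def H3_def H4_def H5_def H6_def H7_def H8_def H9_def X_def Y_def Xs_def Ys_def
  note cong = arg_cong2[where f="(+) :: real \<Rightarrow> _"] arg_cong2[where f="(-) :: real \<Rightarrow> _"]
  have XX: "ent \<Omega> (\<lambda>(x,y,xs,ys,u,v). (x,xs)) = X + Xs" using indep[of fst fst] by (simp add: H)
  have YY: "ent \<Omega> (\<lambda>(x,y,xs,ys,u,v). (y,ys)) = Y + Ys" using indep[of snd snd] by (simp add: H)
  have "r = ent \<Omega> (\<lambda>(x,y,xs,ys,u,v). (x,xs)) - H1 + H3 + H2 - H4"
    unfolding re W rate_def ent_map H by (intro cong; intro ent_cong; auto)
  moreover have "e = ent \<Omega> (\<lambda>(x,y,xs,ys,u,v). (y,ys)) - H2 + H3 + H1 - H5"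
    unfolding re W expo_def ent_map H by (intro cong; intro ent_cong; auto)
  moreover have "rate (joint_law P K1 L1) = X - H6 + H8 + H2 - H4"
    unfolding W1 rate_def ent_map H by (intro cong; intro ent_cong; auto)
  moreover have "expo (joint_law P K1 L1) = Y - H2 + H8 + H6 - H7"
    unfolding W1 expo_def ent_map H by (intro cong; intro ent_cong; auto)
  moreover have "rate (joint_law Q K2 L2) = Xs - H1 + H9 + H6 - H7"
    unfolding W2 rate_def ent_map H by (intro cong; intro ent_cong; auto)
  moreover have "expo (joint_law Q K2 L2) = Ys - H6 + H9 + H1 - H5"
    unfolding W2 expo_def ent_map H by (intro cong; intro ent_cong; auto)
  moreover have "H7 + H3 \<le> H9 + H8"
  proof -
    have "ent \<Omega> (\<lambda>w. ((\<lambda>(x,y,xs,ys,u,v). x) w, (\<lambda>(x,y,xs,ys,u,v). ys) w, (\<lambda>(x,y,xs,ys,u,v). (u,v)) w)) = H7"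
      "ent \<Omega> (\<lambda>w. ((\<lambda>(x,y,xs,ys,u,v). x) w, (\<lambda>(x,y,xs,ys,u,v). (u,v)) w)) = H9"
      "ent \<Omega> (\<lambda>w. ((\<lambda>(x,y,xs,ys,u,v). ys) w, (\<lambda>(x,y,xs,ys,u,v). (u,v)) w)) = H8"
      unfolding H by (intro ent_cong; auto)+
    then show ?thesis
      using ent_submodular[OF fin, of "\<lambda>(x,y,xs,ys,u,v). x" "\<lambda>(x,y,xs,ys,u,v). ys" "\<lambda>(x,y,xs,ys,u,v). (u,v)"]
      by (simp add: H3_def)
  qed
  ultimately show thesis
    using XX YY by (intro that[OF _ reg1 reg2, of "H9 + H8 - H7 - H3"]) simp_all
qed

text \<open>Each split contributes its own shift and the shifts add up. The letters need not receive
  the same pair; averaging them is left to convexity.\<close>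

lemma region_seq_law:
  fixes P :: "('x::countable \<times> 'y::countable) pmf"
  assumes fin: "finite (set_pmf P)" and re: "(r, e) \<in> region (seq_law n P)"
  shows "\<exists>d\<ge>0. \<exists>f. (\<forall>i<n. f i \<in> region P) \<and> (r + d, e + d) = (\<Sum>i<n. f i)"
  using re
proof (induction n arbitrary: r e)
  case 0
  obtain K :: "'x list \<Rightarrow> nat pmf" and L :: "nat \<times> 'y list \<Rightarrow> nat pmf" where
    re: "r = rate (joint_law (seq_law 0 P) K L)" "e = expo (joint_law (seq_law 0 P) K L)"
    and fK: "\<And>x. finite (set_pmf (K x))" and fL: "\<And>z. finite (set_pmf (L z))"
    using 0 unfolding region_def by auto
  have s0: "seq_law 0 P = return_pmf ([], [])" by (simp add: seq_law_def)
  have "finite (set_pmf (joint_law (seq_law 0 P) K L))"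
    by (intro finite_set_joint_law fK fL) (simp add: s0)
  note rj = rate_joint_law[OF this]
  have nil: "fst w = [] \<and> fst (snd w) = []" if "w \<in> set_pmf (joint_law (seq_law 0 P) K L)" for w
    using that by (auto simp: joint_law_def s0)
  have e0: "ent (seq_law 0 P) f = 0" for f :: "_ \<Rightarrow> 'z" by (simp add: s0 ent_def pr_def)
  have "ent (joint_law (seq_law 0 P) K L) (\<lambda>w. w) = ent (joint_law (seq_law 0 P) K L) (\<lambda>(x,y,u,v). (u,v))"
    "ent (joint_law (seq_law 0 P) K L) (\<lambda>(x,y,u,v). ((u,x),v)) = ent (joint_law (seq_law 0 P) K L) (\<lambda>(x,y,u,v). (u,v))"
    "ent (joint_law (seq_law 0 P) K L) (\<lambda>(x,y,u,v). ((u,y),v)) = ent (joint_law (seq_law 0 P) K L) (\<lambda>(x,y,u,v). (u,v))"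
    by (intro ent_cong; auto dest!: nil)+
  then have "r = 0" "e = 0" unfolding re rj e0 by simp_all
  then show ?case by (intro exI[of _ 0]) (simp add: zero_prod_def)
next
  case (Suc n)
  obtain d r1 e1 r2 e2 where 1: "0 \<le> d" "(r1, e1) \<in> region P" "(r2, e2) \<in> region (seq_law n P)"
    "r + d = r1 + r2" "e + d = e1 + e2"
    by (rule region_split_first[OF fin finite_set_seq_law[OF fin] Suc.prems[unfolded seq_law_Suc]])
  from Suc.IH[OF 1(3)] obtain d' f where 2: "0 \<le> d'" "\<forall>i<n. f i \<in> region P" "(r2 + d', e2 + d') = (\<Sum>i<n. f i)" by blast
  show ?case
  proof (intro exI conjI)
    show "0 \<le> d + d'" using 1 2 by simp
    show "\<forall>i<Suc n. (f(n := (r1, e1))) i \<in> region P" using 1 2 by (simp add: less_Suc_eq)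
    have "(\<Sum>i<Suc n. (f(n := (r1, e1))) i) = (\<Sum>i<n. f i) + (r1, e1)" by simp
    also have "\<dots> = (r + (d + d'), e + (d + d'))" using 1(4,5) by (simp add: 2(3)[symmetric])
    finally show "(r + (d + d'), e + (d + d')) = (\<Sum>i<Suc n. (f(n := (r1, e1))) i)" ..
  qed
qed

lemma region_le: "(r, e) \<in> region P \<Longrightarrow> finite (set_pmf P) \<Longrightarrow> e \<le> r"
  unfolding region_def by (auto intro!: expo_le_rate finite_set_joint_law)

text \<open>Time sharing with \<open>(0, 0)\<close> undoes a common shift of rate and exponent, since the exponent
  never exceeds the rate.\<close>

lemma region_shift:
  fixes P :: "('x::finite \<times> 'y::finite) pmf"
  assumes z: "(r + d, e + d) \<in> region P" and d: "0 \<le> d" "0 \<le> r"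
  obtains e' where "(r, e') \<in> region P" "e \<le> e'"
proof (cases "r + d = 0")
  case True
  then have "d = 0" using d by auto
  then show thesis using that[of e] z by simp
next
  case False
  then have pos: "r + d > 0" using d by auto
  \<comment> \<open>The weight that brings the rate down to exactly \<open>r\<close>.\<close>
  define s where "s = r / (r + d)"
  have s: "0 \<le> s" "s \<le> 1" "s * (r + d) = r" using pos d by (auto simp: s_def)
  have "s *\<^sub>R (r + d, e + d) + (1 - s) *\<^sub>R (0, 0) \<in> region P"
    using s by (intro convexD[OF convex_region] z region_zero) auto
  then have "(r, s * (e + d)) \<in> region P" by (simp add: s(3))
  moreover have "e \<le> s * (e + d)"
  proof -
    have "e \<le> r" using region_le[OF z] by simp
    then have "e * (r + d) \<le> r * (e + d)" using d by (simp add: algebra_simps mult_left_mono)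
    then show ?thesis using pos by (simp add: s_def pos_le_divide_eq)
  qed
  ultimately show thesis using that by blast
qed

text \<open>In the symmetric form this is I(UV;XY) \<ge> 0, that is, submodularity with a trivial
  conditioning variable.\<close>

lemma rate_nonneg: "(r, e) \<in> region P \<Longrightarrow> finite (set_pmf P) \<Longrightarrow> 0 \<le> r"
proof -
  assume "(r, e) \<in> region P" and finP: "finite (set_pmf P)"
  then obtain K :: "'a \<Rightarrow> nat pmf" and L :: "nat \<times> 'b \<Rightarrow> nat pmf" where
    re: "r = rate (joint_law P K L)" and fK: "\<And>x. finite (set_pmf (K x))" "\<And>z. finite (set_pmf (L z))"
    unfolding region_def by auto
  let ?W = "joint_law P K L"
  have fin: "finite (set_pmf ?W)" by (intro finite_set_joint_law fK finP)
  have "ent P (\<lambda>z. z) = ent ?W (\<lambda>(x,y,u,v). (x,y))"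
    by (subst map_joint_law_XY[of P K L, symmetric], subst ent_map) (simp add: case_prod_unfold)
  moreover have "ent ?W (\<lambda>w. ((\<lambda>(x,y,u,v). (x,y)) w, (\<lambda>(x,y,u,v). (u,v)) w, (\<lambda>_. ()) w)) = ent ?W (\<lambda>w. w)"
    "ent ?W (\<lambda>w. ((\<lambda>(x,y,u,v). (x,y)) w, (\<lambda>_. ()) w)) = ent ?W (\<lambda>(x,y,u,v). (x,y))"
    "ent ?W (\<lambda>w. ((\<lambda>(x,y,u,v). (u,v)) w, (\<lambda>_. ()) w)) = ent ?W (\<lambda>(x,y,u,v). (u,v))"
    by (intro ent_cong; auto)+
  ultimately show ?thesis
    using ent_submodular[OF fin, of "\<lambda>(x,y,u,v). (x,y)" "\<lambda>(x,y,u,v). (u,v)" "\<lambda>_. ()"]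
    unfolding re rate_joint_law(1)[OF fin] by simp
qed

text \<open>Uniform time sharing over the letters gives the average pair, which exceeds (r / n, e /
  n) by d / n in both coordinates; \<open>region_shift\<close> removes this surplus.\<close>

lemma region_single_letter:
  fixes P :: "('x::finite \<times> 'y::finite) pmf"
  assumes re: "(r, e) \<in> region (seq_law n P)" and n: "n > 0"
  obtains e' where "(r / n, e') \<in> region P" "e / n \<le> e'"
proof -
  obtain d f where d: "0 \<le> d" "\<forall>i<n. f i \<in> region P" "(r + d, e + d) = (\<Sum>i<n. f i)"
    using region_seq_law[OF _ re] by auto
  have "(\<Sum>i<n. (1 / real n) *\<^sub>R f i) \<in> region P"
    using n d(2) by (intro convex_sum convex_region) auto
  then have "((r + d) / n, (e + d) / n) \<in> region P"
    by (simp flip: scaleR_sum_right d(3))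
  then have "(r / n + d / n, e / n + d / n) \<in> region P" by (simp add: add_divide_distrib)
  moreover have "0 \<le> r" using rate_nonneg[OF re] by (simp add: finite_set_seq_law)
  ultimately show thesis using region_shift[of "r / n" "d / n" "e / n" P] d(1) that by auto
qed

section \<open>Converse\<close>

lemma measure_pair_pmf_Times: "measure (pair_pmf A B) (S \<times> T) = measure A S * measure B T"
proof -
  have "measure (pair_pmf A B) (S \<times> T) = measure (pair_pmf A B) ((S \<inter> set_pmf A) \<times> (T \<inter> set_pmf B))"
    by (intro measure_eq_AE) (auto simp: AE_measure_pmf_iff)
  also have "\<dots> = measure A (S \<inter> set_pmf A) * measure B (T \<inter> set_pmf B)"
    by (intro measure_pmf_prob_product) auto
  finally show ?thesis by (simp add: measure_Int_set_pmf)
qed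

text \<open>The second component looks at \<open>a\<close> only through \<open>f a\<close>, so the
  event is a product set.\<close>

lemma pr_pair_pmf:
  "pr (pair_pmf A B) (\<lambda>z. (f (fst z), g (f (fst z)) (snd z))) (a, b)
   = pr A f a * measure B {b'. g (f a) b' = g (f a) b}"
proof -
  have "pr (pair_pmf A B) (\<lambda>z. (f (fst z), g (f (fst z)) (snd z))) (a, b)
     = measure (pair_pmf A B) ({a'. f a' = f a} \<times> {b'. g (f a) b' = g (f a) b})"
    unfolding pr_def by (intro arg_cong[where f="measure _"]) auto
  also have "\<dots> = pr A f a * measure B {b'. g (f a) b' = g (f a) b}"
    by (simp add: measure_pair_pmf_Times pr_def)
  finally show ?thesis .
qed

text \<open>With deterministic encoders H(U,X) = H(X) and H(V,Y,U) = H(Y,U), and the rate collapses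
  to H(U,V).\<close>

lemma rate_deterministic:
  assumes fin: "finite (set_pmf P)" and S: "finite S" "\<And>x y. (x, y) \<in> set_pmf P \<Longrightarrow> (f x, g (y, f x)) \<in> S"
  shows "rate (joint_law P (\<lambda>x. return_pmf (f x)) (\<lambda>(u,y). return_pmf (g (y,u)))) \<le> log 2 (card S)"
proof -
  have W: "joint_law P (\<lambda>x. return_pmf (f x)) (\<lambda>(u,y). return_pmf (g (y,u))) = map_pmf (\<lambda>(x,y). (x,y,f x,g (y,f x))) P"
    by (simp add: joint_law_def map_pmf_def bind_return_pmf case_prod_unfold)
  have 1: "ent P (\<lambda>z. (f (fst z), fst z)) = ent P fst"
    "ent P (\<lambda>z. (g (snd z, f (fst z)), snd z, f (fst z))) = ent P (\<lambda>z. (snd z, f (fst z)))"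
    by (intro ent_cong; auto)+
  have "rate (joint_law P (\<lambda>x. return_pmf (f x)) (\<lambda>(u,y). return_pmf (g (y,u)))) = ent P (\<lambda>z. (g (snd z, f (fst z)), f (fst z)))"
    unfolding W rate_def ent_map by (simp add: case_prod_unfold 1)
  also have "\<dots> = ent P (\<lambda>z. (f (fst z), g (snd z, f (fst z))))" by (intro ent_cong) auto
  also have "\<dots> \<le> log 2 (card S)" using S by (intro ent_le_log_card fin) auto
  finally show ?thesis .
qed

text \<open>Write D(T) for the relative entropy of the laws of T under \<open>P\<close> and
  \<open>Q\<close>. Then D(decision) \<le> D(X,V) = D(U,V) + I(X;V|U) and D(U,V) \<le> D(U,Y) =
  I(U;Y). The equality holds because under \<open>Q\<close> the law of v given x depends on x only
  through u. The summand 1 pays for the entropy of the binary decision, and positivity of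
  \<open>b\<close> for absolute continuity of \<open>P\<close> with respect to
  \<open>Q\<close>.\<close>

lemma test_converse:
  fixes P :: "('x \<times> 'y) pmf" and f :: "'x \<Rightarrow> 'u" and g :: "'y \<times> 'u \<Rightarrow> 'v" and acc :: "'x \<times> 'v \<Rightarrow> bool"
  assumes fin: "finite (set_pmf P)"
  defines "Q \<equiv> pair_pmf (map_pmf fst P) (map_pmf snd P)"
  defines "p \<equiv> measure P {(x,y). acc (x, g (y, f x))}" and "b \<equiv> measure Q {(x,y). acc (x, g (y, f x))}"
  assumes p: "p > 0"
  shows "b > 0" and "p * (- log 2 b) \<le> expo (joint_law P (\<lambda>x. return_pmf (f x)) (\<lambda>(u,y). return_pmf (g (y,u)))) + 1"
proof -
  have finQ: "finite (set_pmf Q)" using fin by (simp add: Q_def)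
  have ac: "set_pmf P \<subseteq> set_pmf Q" by (force simp: Q_def)
  let ?U = "\<lambda>z::'x \<times> 'y. f (fst z)" and ?V = "\<lambda>z::'x \<times> 'y. g (snd z, f (fst z))"
  let ?A = "\<lambda>z::'x \<times> 'y. acc (fst z, g (snd z, f (fst z)))"
  let ?UY = "\<lambda>z::'x \<times> 'y. (f (fst z), snd z)" and ?UV = "\<lambda>z::'x \<times> 'y. (f (fst z), g (snd z, f (fst z)))"
    and ?XV = "\<lambda>z::'x \<times> 'y. (fst z, g (snd z, f (fst z)))"
  have pos: "pr P T z > 0" "pr Q T z > 0" if "z \<in> set_pmf P" for T :: "_ \<Rightarrow> 'z" and z
    using that ac by (auto intro: pr_pos)
  have div_log: "expect P (\<lambda>z. log 2 (pr P T z / pr Q T z)) = - ent P T - expect P (\<lambda>z. log 2 (pr Q T z))"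
    for T :: "_ \<Rightarrow> 'z"
  proof -
    have "expect P (\<lambda>z. log 2 (pr P T z / pr Q T z)) = expect P (\<lambda>z. log 2 (pr P T z) - log 2 (pr Q T z))"
      using pos[of _ T] by (intro expect_cong) (simp add: log_divide less_imp_neq[THEN not_sym])
    then show ?thesis using fin by (simp add: ent_def)
  qed
  have dpi: "expect P (\<lambda>z. log 2 (pr P (\<lambda>z. T (S z)) z / pr Q (\<lambda>z. T (S z)) z)) \<le> expect P (\<lambda>z. log 2 (pr P S z / pr Q S z))"
    for T :: "'s \<Rightarrow> 't" and S :: "_ \<Rightarrow> 's"
  proof -
    have "set_pmf (map_pmf S P) \<subseteq> set_pmf (map_pmf S Q)" using ac by auto
    from divergence_map_le[OF _ _ this, of T] fin finQ show ?thesis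
      by (simp add: pr_map pmf_map_pr)
  qed
  have fst_pr: "pr P (\<lambda>z. h (fst z)) z = pr (map_pmf fst P) h (fst z)" for h :: "'x \<Rightarrow> 'z" and z by (simp add: pr_map)
  have QUY: "pr Q ?UY z = pr P ?U z * pr P snd z" for z
    using pr_pair_pmf[of "map_pmf fst P" "map_pmf snd P" f "\<lambda>u y. y" "fst z" "snd z"]
    by (simp add: Q_def fst_pr) (simp add: pr_def vimage_def)
  have QUV: "pr Q ?UV z = pr P ?U z * measure (map_pmf snd P) {y'. g (y', f (fst z)) = ?V z}" for z
    using pr_pair_pmf[of "map_pmf fst P" "map_pmf snd P" f "\<lambda>u y. g (y, u)" "fst z" "snd z"]
    by (simp add: Q_def fst_pr)
  have QXV: "pr Q ?XV z = pr P fst z * measure (map_pmf snd P) {y'. g (y', f (fst z)) = ?V z}" for z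
    using pr_pair_pmf[of "map_pmf fst P" "map_pmf snd P" "\<lambda>x. x" "\<lambda>x y. g (y, f x)" "fst z" "snd z"]
    by (simp add: Q_def fst_pr[of "\<lambda>x. x", simplified])
  have 1: "expect P (\<lambda>z. log 2 (pr Q ?UY z)) = - ent P ?U - ent P snd"
  proof -
    have "expect P (\<lambda>z. log 2 (pr Q ?UY z)) = expect P (\<lambda>z. log 2 (pr P ?U z) + log 2 (pr P snd z))"
      unfolding QUY by (intro expect_cong) (simp add: log_mult pr_pos less_imp_neq[THEN not_sym])
    then show ?thesis using fin by (simp add: ent_def)
  qed
  have 2: "expect P (\<lambda>z. log 2 (pr Q ?XV z)) = - ent P fst + ent P ?U + expect P (\<lambda>z. log 2 (pr Q ?UV z))"
  proof -
    have "expect P (\<lambda>z. log 2 (pr Q ?XV z)) = expect P (\<lambda>z. log 2 (pr P fst z) - log 2 (pr P ?U z) + log 2 (pr Q ?UV z))"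
    proof (rule expect_cong)
      fix z assume z: "z \<in> set_pmf P"
      let ?m = "measure (map_pmf snd P) {y'. g (y', f (fst z)) = ?V z}"
      have "?m > 0" using pos(2)[OF z, of ?XV] pos(1)[OF z, of fst] unfolding QXV by (simp add: zero_less_mult_iff)
      then show "log 2 (pr Q ?XV z) = log 2 (pr P fst z) - log 2 (pr P ?U z) + log 2 (pr Q ?UV z)"
        using z unfolding QXV QUV by (simp add: log_mult pr_pos less_imp_neq[THEN not_sym])
    qed
    then show ?thesis using fin by (simp add: ent_def)
  qed
  have W: "joint_law P (\<lambda>x. return_pmf (f x)) (\<lambda>(u,y). return_pmf (g (y,u))) = map_pmf (\<lambda>(x,y). (x,y,f x,g (y,f x))) P"
    by (simp add: joint_law_def map_pmf_def bind_return_pmf case_prod_unfold)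
  have "ent P (\<lambda>z. (?V z, ?U z)) = ent P ?UV" "ent P (\<lambda>z. (fst z, ?U z)) = ent P fst"
    "ent P (\<lambda>z. (?V z, fst z, ?U z)) = ent P ?XV"
    by (intro ent_cong; auto)+
  then have e: "expo (joint_law P (\<lambda>x. return_pmf (f x)) (\<lambda>(u,y). return_pmf (g (y,u))))
      = ent P snd - ent P ?UY + ent P ?UV + ent P fst - ent P ?XV"
    unfolding W expo_def ent_map by (simp add: case_prod_unfold)
  have "- ent P ?A - expect P (\<lambda>z. log 2 (pr Q ?A z)) \<le> - ent P ?XV - expect P (\<lambda>z. log 2 (pr Q ?XV z))"
    using dpi[of acc ?XV] unfolding div_log .
  moreover have "- ent P ?UV - expect P (\<lambda>z. log 2 (pr Q ?UV z)) \<le> - ent P ?UY - expect P (\<lambda>z. log 2 (pr Q ?UY z))"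
    using dpi[of "\<lambda>(u,y). (u, g (y,u))" ?UY] unfolding div_log by simp
  moreover have "ent P ?A \<le> 1"
    using ent_le_log_card[OF fin, of "UNIV :: bool set" ?A] by simp
  ultimately have main: "- expect P (\<lambda>z. log 2 (pr Q ?A z)) \<le> ent P snd - ent P ?UY + ent P ?UV + ent P fst - ent P ?XV + 1"
    unfolding 1 2 by linarith
  have p': "p = measure P {z. ?A z}" unfolding p_def by (intro arg_cong[where f="measure _"]) auto
  have b': "b = measure Q {z. ?A z}" unfolding b_def by (intro arg_cong[where f="measure _"]) auto
  have "\<exists>z\<in>set_pmf P. ?A z"
  proof (rule ccontr)
    assume "\<not> ?thesis"
    then have "p = 0" unfolding p' by (subst measure_pmf_zero_iff) auto
    then show False using p by simp
  qed
  then obtain z0 where z0: "z0 \<in> set_pmf P" "?A z0" by blast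
  have bA: "pr Q ?A z = b" if "?A z" for z using that by (simp add: pr_def b')
  show bpos: "b > 0" using pos(2)[OF z0(1), of ?A] bA[OF z0(2)] by simp
  have "p * (- log 2 b) = expect P (\<lambda>z. indicator {z. ?A z} z * (- log 2 b))"
    using fin by (simp add: p')
  \<comment> \<open>Where the test rejects, the integrand is only known to be nonnegative; this
    leaves the factor \<open>p\<close>.\<close>
  also have "\<dots> \<le> expect P (\<lambda>z. - log 2 (pr Q ?A z))"
    using fin pos(2)[of _ ?A] by (intro expect_mono) (auto simp: indicator_def bA pr_le_1)
  finally show "p * (- log 2 b) \<le> expo (joint_law P (\<lambda>x. return_pmf (f x)) (\<lambda>(u,y). return_pmf (g (y,u)))) + 1"
    using main e fin by simp
qed

section \<open>From a single test to codes of blocklength n\<close>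

lemma map_replicate_pmf: "map_pmf (map f) (replicate_pmf n P) = replicate_pmf n (map_pmf f P)"
proof (induction n)
  case (Suc n)
  then show ?case
    by (simp add: map_bind_pmf bind_map_pmf bind_return_pmf flip: Suc.IH)
qed simp

lemma fst_seq_law: "map_pmf fst (seq_law n P) = replicate_pmf n (map_pmf fst P)"
  and snd_seq_law: "map_pmf snd (seq_law n P) = replicate_pmf n (map_pmf snd P)"
  by (simp_all add: seq_law_def map_pmf_comp flip: map_replicate_pmf)

lemma seq_law_pair_pmf: "seq_law n (pair_pmf A B) = pair_pmf (replicate_pmf n A) (replicate_pmf n B)"
proof (induction n)
  case 0
  then show ?case by (simp add: seq_law_def pair_pmf_def bind_return_pmf)
next
  case (Suc n)
  have "seq_law (Suc n) (pair_pmf A B) = bind_pmf A (\<lambda>a. bind_pmf B (\<lambda>b. bind_pmf (replicate_pmf n A) (\<lambda>as.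
     bind_pmf (replicate_pmf n B) (\<lambda>bs. return_pmf (a # as, b # bs)))))"
    unfolding seq_law_Suc Suc by (simp add: pair_pmf_def bind_assoc_pmf bind_return_pmf)
  also have "\<dots> = bind_pmf A (\<lambda>a. bind_pmf (replicate_pmf n A) (\<lambda>as. bind_pmf B (\<lambda>b.
     bind_pmf (replicate_pmf n B) (\<lambda>bs. return_pmf (a # as, b # bs)))))"
    by (intro bind_pmf_cong refl bind_commute_pmf)
  also have "\<dots> = pair_pmf (replicate_pmf (Suc n) A) (replicate_pmf (Suc n) B)"
    by (simp add: pair_pmf_def bind_assoc_pmf bind_return_pmf)
  finally show ?case .
qed

lemma seq_law_independent:
  "seq_law n (independent_law P) = pair_pmf (map_pmf fst (seq_law n P)) (map_pmf snd (seq_law n P))"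
  by (simp add: independent_law_def seq_law_pair_pmf fst_seq_law snd_seq_law)

lemma decision_prob_seq_law:
  "decision_prob n P f g \<phi> d = measure (seq_law n P) {(x,y). \<phi> (x, g (y, f x)) = d}"
  by (simp add: decision_prob_def seq_law_def vimage_def Let_def)

lemma length_seq_law: "(xs, ys) \<in> set_pmf (seq_law n P) \<Longrightarrow> length xs = n \<and> length ys = n"
  by (auto simp: seq_law_def set_replicate_pmf)

text \<open>A code is a single test for \<open>seq_law n P\<close>, whose messages serve as U and V;
  the resulting pair is then single-letterized.\<close>

lemma code_converse:
  fixes P :: "('x::finite \<times> 'y::finite) pmf"
  assumes code: "one_round_code n F G f g \<phi>" and n: "n > 0"
    and alpha: "decision_prob n P f g \<phi> 1 \<le> \<epsilon>" "\<epsilon> < 1"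
  obtains r e where "(r, e) \<in> region P" "r \<le> (1 / real n) * log 2 (real F * real G)"
    "error_exponent n (decision_prob n (independent_law P) f g \<phi> 0) \<le> ereal ((e + 1 / n) / (1 - \<epsilon>))"
proof -
  let ?P = "seq_law n P"
  let ?W = "joint_law ?P (\<lambda>x. return_pmf (f x)) (\<lambda>(u,y). return_pmf (g (y,u)))"
  have fin: "finite (set_pmf ?P)" by (simp add: finite_set_seq_law)
  have fr: "f xs \<in> {1..F}" "g (ys, f xs) \<in> {1..G}" "\<phi> (xs, g (ys, f xs)) \<in> {0, 1}"
    if "(xs, ys) \<in> set_pmf ?P" for xs ys
    using length_seq_law[OF that] code unfolding one_round_code_def by (force simp: Pi_iff)+
  have "rate ?W \<le> log 2 (card ({1..F} \<times> {1..G}))"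
    using fr by (intro rate_deterministic fin) auto
  then have rate: "rate ?W \<le> log 2 (real F * real G)" by (simp add: card_cartesian_product)
  let ?p = "measure ?P {(x,y). \<phi> (x, g (y, f x)) = 0}"
  let ?b = "decision_prob n (independent_law P) f g \<phi> 0"
  have "?p = 1 - decision_prob n P f g \<phi> 1"
  proof -
    \<comment> \<open>\<open>\<phi>\<close> has values in {0, 1} on the support only, where the
      sequences have length \<open>n\<close>.\<close>
    have "measure ?P {(x,y). \<phi> (x, g (y, f x)) = 0} = measure ?P (UNIV - {(x,y). \<phi> (x, g (y, f x)) = 1})"
      using fr(3) by (intro measure_eq_AE) (auto simp: AE_measure_pmf_iff)
    also have "\<dots> = 1 - measure ?P {(x,y). \<phi> (x, g (y, f x)) = 1}"
      using measure_pmf.prob_compl[of "{(x,y). \<phi> (x, g (y, f x)) = 1}" ?P] by simp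
    finally show ?thesis by (simp add: decision_prob_seq_law)
  qed
  then have p: "?p \<ge> 1 - \<epsilon>" "?p > 0" using alpha by auto
  have b_eq: "?b = measure (pair_pmf (map_pmf fst ?P) (map_pmf snd ?P)) {(x,y). \<phi> (x, g (y, f x)) = 0}"
    by (simp add: decision_prob_seq_law seq_law_independent)
  have b: "?b > 0" "?p * (- log 2 ?b) \<le> expo ?W + 1"
    unfolding b_eq using test_converse[where f=f and g=g and acc="\<lambda>z. \<phi> z = 0", OF fin p(2)] by auto
  have "?b \<le> 1" by (simp add: decision_prob_def)
  then have "- log 2 ?b \<ge> 0" using b(1) by simp
  then have "(1 - \<epsilon>) * (- log 2 ?b) \<le> ?p * (- log 2 ?b)" using p(1) by (intro mult_right_mono)
  with b(2) have le: "(1 - \<epsilon>) * (- log 2 ?b) \<le> expo ?W + 1" by linarith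
  have "(rate ?W, expo ?W) \<in> region ?P"
    unfolding region_def mem_Collect_eq
    by (intro exI[of _ "\<lambda>x. return_pmf (f x)"] exI[of _ "\<lambda>(u,y). return_pmf (g (y,u))"]) auto
  then obtain e where e: "(rate ?W / n, e) \<in> region P" "expo ?W / n \<le> e"
    using region_single_letter[OF _ n] by blast
  show thesis
  proof (rule that[OF e(1)])
    show "rate ?W / real n \<le> 1 / real n * log 2 (real F * real G)"
      using rate n by (simp add: divide_right_mono)
    have "(1 - \<epsilon>) * (- (1 / n) * log 2 ?b) = ((1 - \<epsilon>) * (- log 2 ?b)) / n" by simp
    also have "\<dots> \<le> (expo ?W + 1) / n" using le n by (intro divide_right_mono) auto
    also have "\<dots> \<le> e + 1 / n" using e(2) by (simp add: add_divide_distrib)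
    finally have "- (1 / n) * log 2 ?b \<le> (e + 1 / n) / (1 - \<epsilon>)"
      using alpha(2) by (simp add: pos_le_divide_eq mult.commute)
    then show "error_exponent n ?b \<le> ereal ((e + 1 / n) / (1 - \<epsilon>))"
      using b(1) by (simp add: error_exponent_def)
  qed
qed

text \<open>The rate of a code may exceed \<open>R\<close> by \<delta>, while \<open>mx\<close>
  speaks about rates up to \<open>R\<close>. The excess is shifted away at an equal cost in
  exponent, so no continuity in \<open>R\<close> is involved.\<close>

lemma feasible_exponent_le:
  fixes P :: "('x::finite \<times> 'y::finite) pmf"
  assumes feas: "feasible_exponent P (independent_law P) R \<epsilon> E" and eps: "\<epsilon> < 1" and R: "0 \<le> R"
    and mx: "\<And>r e. (r, e) \<in> region P \<Longrightarrow> r \<le> R \<Longrightarrow> e \<le> Emax"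
  shows "(1 - \<epsilon>) * E \<le> Emax"
proof (rule field_le_epsilon)
  fix t :: real assume t: "t > 0"
  \<comment> \<open>The losses are \<delta> (1 - \<epsilon>) from the exponent, \<delta> from the
    rate excess and \<delta> from 1 / n; they add up to \<open>t\<close>.\<close>
  define \<delta> where "\<delta> = t / (2 + (1 - \<epsilon>))"
  have d: "\<delta> > 0" "\<delta> * (2 + (1 - \<epsilon>)) = t" using t eps by (auto simp: \<delta>_def)
  have ev: "\<forall>\<^sub>F n in sequentially. 1 / real n < \<delta> \<and> n > 0"
    using d(1) by (intro eventually_conj order_tendstoD(2)[OF lim_1_over_n] eventually_gt_at_top) auto
  obtain n F G f g \<phi> where c: "one_round_code n F G f g \<phi>"
      "error_exponent n (decision_prob n (independent_law P) f g \<phi> 0) \<ge> ereal (E - \<delta>)"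
      "(1 / real n) * log 2 (real F * real G) \<le> R + \<delta>" "decision_prob n P f g \<phi> 1 \<le> \<epsilon>"
      "1 / real n < \<delta>" "n > 0"
    using eventually_happens'[OF sequentially_bot eventually_conj[OF feas[unfolded feasible_exponent_def, rule_format, OF d(1)] ev]] by blast
  obtain r e where re: "(r, e) \<in> region P" "r \<le> (1 / real n) * log 2 (real F * real G)"
    "error_exponent n (decision_prob n (independent_law P) f g \<phi> 0) \<le> ereal ((e + 1 / n) / (1 - \<epsilon>))"
    by (rule code_converse[OF c(1) c(6) c(4) eps])
  have "ereal (E - \<delta>) \<le> ereal ((e + 1 / n) / (1 - \<epsilon>))" using c(2) re(3) by (rule order_trans)
  then have 1: "(E - \<delta>) * (1 - \<epsilon>) \<le> e + 1 / n" using eps by (simp add: pos_le_divide_eq)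
  have "e \<le> Emax + \<delta>"
  proof (cases "r \<le> R")
    case True
    then show ?thesis using mx[OF re(1)] d by simp
  next
    case False
    \<comment> \<open>The pair (r, e) is read as a shift by r - R of a pair with rate
      \<open>R\<close>.\<close>
    then obtain e' where "(R, e') \<in> region P" "e - (r - R) \<le> e'"
      using region_shift[of R "r - R" "e - (r - R)" P] re(1) R by auto
    then show ?thesis using mx[of R e'] re(2) c(3) by auto
  qed
  with 1 c(5) have "(E - \<delta>) * (1 - \<epsilon>) \<le> Emax + \<delta> + \<delta>" by linarith
  then show "(1 - \<epsilon>) * E \<le> Emax + t" unfolding d(2)[symmetric] by (simp add: algebra_simps)
qed

section \<open>Soft covering and one-shot codes\<close>

lemma expect_replicate_sum:
  assumes fin: "finite (set_pmf p)"
  shows "expect (replicate_pmf n p) (\<lambda>ws. sum_list (map h ws)) = n * expect p h"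
proof (induction n)
  case (Suc n)
  have "expect (replicate_pmf (Suc n) p) (\<lambda>ws. sum_list (map h ws))
      = expect p (\<lambda>x. expect (replicate_pmf n p) (\<lambda>ws. h x + sum_list (map h ws)))"
    using fin by (simp add: expect_bind finite_set_replicate_pmf)
  also have "\<dots> = real (Suc n) * expect p h"
    using fin by (simp add: finite_set_replicate_pmf Suc algebra_simps)
  finally show ?case .
qed simp

text \<open>The cross terms vanish since the entries are independent and centred.\<close>

lemma expect_replicate_variance:
  fixes h :: "'a \<Rightarrow> real"
  assumes fin: "finite (set_pmf p)"
  defines "\<mu> \<equiv> expect p h"
  shows "expect (replicate_pmf n p) (\<lambda>ws. (sum_list (map h ws) - n * \<mu>)\<^sup>2) = n * expect p (\<lambda>w. (h w - \<mu>)\<^sup>2)"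
proof (induction n)
  case (Suc n)
  let ?S = "\<lambda>ws. sum_list (map h ws) - n * \<mu>"
  note frep = finite_set_replicate_pmf[OF fin, of n]
  have 0: "expect (replicate_pmf n p) ?S = 0"
    using frep expect_replicate_sum[OF fin, of n h] by (simp add: \<mu>_def)
  have 1: "expect p (\<lambda>x. h x - \<mu>) = 0" using fin by (simp add: \<mu>_def)
  have "expect (replicate_pmf (Suc n) p) (\<lambda>ws. (sum_list (map h ws) - real (Suc n) * \<mu>)\<^sup>2)
      = expect p (\<lambda>x. expect (replicate_pmf n p) (\<lambda>ws. (h x + sum_list (map h ws) - real (Suc n) * \<mu>)\<^sup>2))"
    using fin frep by (simp add: expect_bind)
  also have "\<dots> = expect p (\<lambda>x. expect (replicate_pmf n p) (\<lambda>ws. (h x - \<mu>)\<^sup>2 + 2 * (h x - \<mu>) * ?S ws + (?S ws)\<^sup>2))"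
    by (simp add: power2_eq_square algebra_simps)
  also have "\<dots> = expect p (\<lambda>x. (h x - \<mu>)\<^sup>2 + 2 * (h x - \<mu>) * expect (replicate_pmf n p) ?S + expect (replicate_pmf n p) (\<lambda>ws. (?S ws)\<^sup>2))"
    using frep by (subst expect_add, simp, subst expect_add, simp) simp
  also have "\<dots> = expect p (\<lambda>x. (h x - \<mu>)\<^sup>2) + n * expect p (\<lambda>w. (h w - \<mu>)\<^sup>2)"
    unfolding 0 Suc using fin by simp
  finally show ?case by (simp add: algebra_simps)
qed simp

lemma expect_abs_le_sqrt:
  assumes fin: "finite (set_pmf W)"
  shows "expect W (\<lambda>w. \<bar>Z w\<bar>) \<le> sqrt (expect W (\<lambda>w. (Z w)\<^sup>2))"
proof (rule real_le_rsqrt)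
  let ?m = "expect W (\<lambda>w. \<bar>Z w\<bar>)"
  have "0 \<le> expect W (\<lambda>w. (\<bar>Z w\<bar> - ?m)\<^sup>2)" by (intro integral_nonneg_AE) simp
  also have "\<dots> = expect W (\<lambda>w. (Z w)\<^sup>2 - 2 * ?m * \<bar>Z w\<bar> + ?m\<^sup>2)"
    by (intro expect_cong) (simp add: power2_eq_square algebra_simps)
  also have "\<dots> = expect W (\<lambda>w. (Z w)\<^sup>2) - 2 * ?m * ?m + ?m\<^sup>2" using fin by simp
  finally show "?m\<^sup>2 \<le> expect W (\<lambda>w. (Z w)\<^sup>2)" by (simp add: power2_eq_square)
qed

text \<open>The terms with \<open>a u x > \<tau> q x\<close> are discarded; the second moment of the
  others is at most \<open>\<tau> q(x)\<^sup>2\<close>.\<close>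

lemma soft_covering:
  fixes a :: "'u \<Rightarrow> 'x \<Rightarrow> real"
  assumes fin: "finite (set_pmf p)" "finite S" and a: "\<And>u x. 0 \<le> a u x" and M: "M > 0" and tau: "0 \<le> \<tau>"
    and q: "\<And>x. x \<in> S \<Longrightarrow> expect p (\<lambda>u. a u x) = q x" and q1: "(\<Sum>x\<in>S. q x) \<le> 1"
  shows "expect (replicate_pmf M p) (\<lambda>us. \<Sum>x\<in>S. max 0 (q x - (\<Sum>u\<leftarrow>us. a u x) / M))
     \<le> expect p (\<lambda>u. \<Sum>x\<in>S. if a u x > \<tau> * q x then a u x else 0) + sqrt (\<tau> / M)"
proof -
  note frep = finite_set_replicate_pmf[OF fin(1), of M]
  let ?R = "replicate_pmf M p"
  define b where "b u x = (if a u x > \<tau> * q x then 0 else a u x)" for u x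
  define d where "d x = expect p (\<lambda>u. if a u x > \<tau> * q x then a u x else 0)" for x
  define q' where "q' x = expect p (\<lambda>u. b u x)" for x
  have q0: "0 \<le> q x" if "x \<in> S" for x
    using a by (simp add: q[OF that, symmetric] integral_nonneg_AE)
  have split: "q x = d x + q' x" if "x \<in> S" for x
    unfolding q[OF that, symmetric] d_def q'_def b_def
    by (subst expect_add[symmetric, OF fin(1)]) (intro expect_cong, simp)
  \<comment> \<open>Independence of the codewords makes the variance grow only linearly in
    \<open>M\<close>, so the deviation relative to \<open>M\<close> is of order sqrt(\<tau> /
    M).\<close>
  have dev: "expect ?R (\<lambda>us. \<bar>(\<Sum>u\<leftarrow>us. b u x) - M * q' x\<bar>) \<le> M * (q x * sqrt (\<tau> / M))" if x: "x \<in> S" for x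
  proof -
    have "expect ?R (\<lambda>us. \<bar>(\<Sum>u\<leftarrow>us. b u x) - M * q' x\<bar>) \<le> sqrt (expect ?R (\<lambda>us. ((\<Sum>u\<leftarrow>us. b u x) - M * q' x)\<^sup>2))"
      by (rule expect_abs_le_sqrt[OF frep])
    also have "expect ?R (\<lambda>us. ((\<Sum>u\<leftarrow>us. b u x) - M * q' x)\<^sup>2) = M * expect p (\<lambda>u. (b u x - q' x)\<^sup>2)"
      unfolding q'_def by (rule expect_replicate_variance[OF fin(1)])
    also have "expect p (\<lambda>u. (b u x - q' x)\<^sup>2) = expect p (\<lambda>u. (b u x)\<^sup>2) - (q' x)\<^sup>2"
    proof -
      have "expect p (\<lambda>u. (b u x - q' x)\<^sup>2) = expect p (\<lambda>u. (b u x)\<^sup>2 - 2 * q' x * b u x + (q' x)\<^sup>2)"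
        by (intro expect_cong) (simp add: power2_eq_square algebra_simps)
      also have "\<dots> = expect p (\<lambda>u. (b u x)\<^sup>2) - 2 * q' x * q' x + (q' x)\<^sup>2" using fin(1) by (simp add: q'_def)
      finally show ?thesis by (simp add: power2_eq_square)
    qed
    also have "expect p (\<lambda>u. (b u x)\<^sup>2) \<le> expect p (\<lambda>u. \<tau> * q x * a u x)"
      using a q0[OF x] tau by (intro expect_mono[OF fin(1)]) (auto simp: b_def power2_eq_square intro: mult_right_mono)
    also have "\<dots> = \<tau> * (q x)\<^sup>2" using q[OF x] by (simp add: power2_eq_square)
    finally have "expect ?R (\<lambda>us. \<bar>(\<Sum>u\<leftarrow>us. b u x) - M * q' x\<bar>) \<le> sqrt (M * (\<tau> * (q x)\<^sup>2 - (q' x)\<^sup>2))"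
      by (simp add: mult_left_mono)
    also have "\<dots> \<le> sqrt (M * (\<tau> * (q x)\<^sup>2))" by (simp add: mult_left_mono)
    also have "\<dots> = sqrt ((M * q x)\<^sup>2 * (\<tau> / M))"
      using M by (simp add: power2_eq_square field_simps)
    also have "\<dots> = M * (q x * sqrt (\<tau> / M))"
      using q0[OF x] by (simp only: real_sqrt_mult real_sqrt_abs abs_mult)
    finally show ?thesis .
  qed
  \<comment> \<open>Only a deficit counts. Restoring the discarded terms can only reduce it, so they
    cost no more than their mean \<open>d x\<close>.\<close>
  have pt: "max 0 (q x - (\<Sum>u\<leftarrow>us. a u x) / M) \<le> d x + \<bar>(\<Sum>u\<leftarrow>us. b u x) - M * q' x\<bar> / M" if x: "x \<in> S" for x us
  proof -
    have "(\<Sum>u\<leftarrow>us. b u x) \<le> (\<Sum>u\<leftarrow>us. a u x)" using a by (intro sum_list_mono) (simp add: b_def)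
    then have "q' x - (\<Sum>u\<leftarrow>us. a u x) / M \<le> - ((\<Sum>u\<leftarrow>us. b u x) - M * q' x) / M"
      using M by (simp add: field_simps)
    also have "\<dots> \<le> \<bar>(\<Sum>u\<leftarrow>us. b u x) - M * q' x\<bar> / M" using M by (intro divide_right_mono) auto
    finally have 1: "q' x - (\<Sum>u\<leftarrow>us. a u x) / M \<le> \<bar>(\<Sum>u\<leftarrow>us. b u x) - M * q' x\<bar> / M" .
    have "0 \<le> d x" using a by (auto simp: d_def intro!: integral_nonneg_AE)
    moreover have "0 \<le> \<bar>(\<Sum>u\<leftarrow>us. b u x) - M * q' x\<bar> / M" by simp
    ultimately show ?thesis using 1 unfolding split[OF x] by linarith
  qed
  have "expect ?R (\<lambda>us. \<Sum>x\<in>S. max 0 (q x - (\<Sum>u\<leftarrow>us. a u x) / M))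
      \<le> expect ?R (\<lambda>us. \<Sum>x\<in>S. d x + \<bar>(\<Sum>u\<leftarrow>us. b u x) - M * q' x\<bar> / M)"
    by (intro expect_mono frep sum_mono pt)
  also have "\<dots> = (\<Sum>x\<in>S. d x + expect ?R (\<lambda>us. \<bar>(\<Sum>u\<leftarrow>us. b u x) - M * q' x\<bar>) / M)"
    using frep by (simp add: sum.distrib)
  also have "\<dots> \<le> (\<Sum>x\<in>S. d x + q x * sqrt (\<tau> / M))"
    using dev M by (intro sum_mono add_left_mono) (simp add: pos_divide_le_eq mult.commute)
  also have "\<dots> = (\<Sum>x\<in>S. d x) + (\<Sum>x\<in>S. q x) * sqrt (\<tau> / M)" by (simp add: sum.distrib sum_distrib_right)
  also have "(\<Sum>x\<in>S. d x) = expect p (\<lambda>u. \<Sum>x\<in>S. if a u x > \<tau> * q x then a u x else 0)"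
    using fin(1) by (simp add: d_def)
  also have "(\<Sum>x\<in>S. q x) * sqrt (\<tau> / M) \<le> sqrt (\<tau> / M)"
    using q1 tau by (intro mult_left_le_one_le) (auto intro: sum_nonneg q0)
  finally show ?thesis by simp
qed

text \<open>The likelihood encoder for the output law \<open>q\<close>, made substochastic by the maximum in the denominator.\<close>

definition likelihood :: "nat \<Rightarrow> (nat \<Rightarrow> real) \<Rightarrow> real \<Rightarrow> nat \<Rightarrow> real" where
  "likelihood M a q m = a m / (M * max ((\<Sum>i<M. a i) / M) q)"

text \<open>The third claim is the change of measure: with \<open>q\<close> the law of the encoder's
  input, \<open>b\<close> a joint law of this input and a further variable, and \<open>c\<close> the
  same joint law given codeword \<open>m\<close>, choosing \<open>m\<close> costs at most a uniform
  choice. The fourth says that the missing mass is paid for by the uncovered part of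
  \<open>q\<close>.\<close>

lemma likelihood:
  assumes a: "\<And>m. 0 \<le> a m" and q: "0 \<le> q" and M: "M > 0"
  shows "0 \<le> likelihood M a q m" "(\<Sum>m<M. likelihood M a q m) \<le> 1"
    and "b \<ge> 0 \<Longrightarrow> c * q = a m * b \<Longrightarrow> 0 \<le> c \<Longrightarrow> (q = 0 \<Longrightarrow> b = 0) \<Longrightarrow> b * likelihood M a q m \<le> c / M"
    and "q * (1 - (\<Sum>m<M. likelihood M a q m)) \<le> max 0 (q - (\<Sum>i<M. a i) / M)"
proof -
  let ?h = "(\<Sum>i<M. a i) / M"
  have h: "0 \<le> ?h" using a by (simp add: sum_nonneg)
  have mx: "0 \<le> max ?h q" using q by simp
  show "0 \<le> likelihood M a q m" using a mx by (simp add: likelihood_def)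
  have sum: "(\<Sum>m<M. likelihood M a q m) = ?h / max ?h q"
    by (simp add: likelihood_def flip: sum_divide_distrib)
  show "(\<Sum>m<M. likelihood M a q m) \<le> 1"
  proof -
    have "t / max t q \<le> 1" if "0 \<le> t" for t using that q by (auto simp: divide_le_eq_1)
    then show ?thesis unfolding sum using h by blast
  qed
  show "q * (1 - (\<Sum>m<M. likelihood M a q m)) \<le> max 0 (q - ?h)"
  proof (cases "q = 0")
    case False
    then have "q > 0" using q by simp
    then have "q * (1 - t / max t q) \<le> max 0 (q - t)" if "0 \<le> t" for t
      using that by (cases "t \<le> q") (auto simp: max_def field_simps)
    then show ?thesis unfolding sum using h by blast
  qed simp
  show "b * likelihood M a q m \<le> c / M" if "b \<ge> 0" "c * q = a m * b" "0 \<le> c" "q = 0 \<Longrightarrow> b = 0"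
  proof (cases "q = 0")
    case False
    then have "q > 0" using q by simp
    then have pos: "max ?h q > 0" by simp
    have "b * likelihood M a q m = c * q / (M * max ?h q)" using that(2) by (simp add: likelihood_def mult.commute)
    also have "\<dots> = c / M * (q / max ?h q)" by simp
    also have "\<dots> \<le> c / M * 1" using pos that(3) by (intro mult_left_mono) (auto simp: divide_le_eq_1)
    finally show ?thesis by simp
  qed (use that in simp)
qed

lemma exists_le_average:
  fixes \<kappa> c :: "nat \<Rightarrow> real"
  assumes "\<And>m. m \<le> M \<Longrightarrow> 0 \<le> \<kappa> m" "(\<Sum>m\<le>M. \<kappa> m) = 1"
  shows "\<exists>m\<le>M. c m \<le> (\<Sum>m\<le>M. \<kappa> m * c m)"
proof (rule ccontr)
  assume "\<not> ?thesis"
  then have gt: "\<And>m. m \<le> M \<Longrightarrow> c m > (\<Sum>m\<le>M. \<kappa> m * c m)" by force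
  let ?A = "\<Sum>m\<le>M. \<kappa> m * c m"
  have "\<exists>m\<le>M. \<kappa> m > 0"
  proof (rule ccontr)
    assume "\<not> ?thesis"
    then have "(\<Sum>m\<le>M. \<kappa> m) \<le> 0" by (intro sum_nonpos) (auto simp: not_less)
    then show False using assms(2) by simp
  qed
  then obtain m where m: "m \<le> M" "\<kappa> m > 0" by blast
  have "?A = (\<Sum>m\<le>M. \<kappa> m * ?A)" using assms(2) by (simp flip: sum_distrib_right)
  also have "\<dots> < ?A"
  proof (rule sum_strict_mono_ex1)
    show "\<forall>i\<in>{..M}. \<kappa> i * ?A \<le> \<kappa> i * c i"
      using assms(1) less_imp_le[OF gt] by (auto intro!: mult_left_mono)
    show "\<exists>i\<in>{..M}. \<kappa> i * ?A < \<kappa> i * c i"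
      using m gt by (intro bexI[of _ m] mult_strict_left_mono) auto
  qed simp
  finally show False by simp
qed

text \<open>The average is affine in each row of each kernel, so the rows can be made deterministic one after the other.\<close>

lemma derandomize:
  fixes \<kappa> :: "nat \<Rightarrow> 'x \<Rightarrow> real" and \<kappa>' :: "nat \<Rightarrow> 'y \<Rightarrow> nat \<Rightarrow> real" and w :: "'x \<Rightarrow> 'y \<Rightarrow> nat \<Rightarrow> nat \<Rightarrow> real"
  assumes k: "\<And>m x. m \<le> M \<Longrightarrow> 0 \<le> \<kappa> m x" "\<And>x. (\<Sum>m\<le>M. \<kappa> m x) = 1"
    and k': "\<And>m y l. m \<le> M \<Longrightarrow> l \<le> L \<Longrightarrow> 0 \<le> \<kappa>' m y l" "\<And>m y. m \<le> M \<Longrightarrow> (\<Sum>l\<le>L. \<kappa>' m y l) = 1"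
    and le: "(\<Sum>x\<in>S. \<Sum>y\<in>T. \<Sum>m\<le>M. \<kappa> m x * (\<Sum>l\<le>L. \<kappa>' m y l * w x y m l)) \<le> C"
  obtains f g where "\<And>x. f x \<le> M" "\<And>y m. m \<le> M \<Longrightarrow> g y m \<le> L"
    "(\<Sum>x\<in>S. \<Sum>y\<in>T. w x y (f x) (g y (f x))) \<le> C"
proof -
  define c where "c x m = (\<Sum>y\<in>T. \<Sum>l\<le>L. \<kappa>' m y l * w x y m l)" for x m
  have "\<exists>m\<le>M. c x m \<le> (\<Sum>m\<le>M. \<kappa> m x * c x m)" for x
    using k by (intro exists_le_average) auto
  then obtain f where f: "\<And>x. f x \<le> M" "\<And>x. c x (f x) \<le> (\<Sum>m\<le>M. \<kappa> m x * c x m)" by metis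
  \<comment> \<open>Once \<open>f\<close> is fixed, the total cost separates over the rows (y, m) of
    the second kernel.\<close>
  define b where "b y m l = (\<Sum>x\<in>S. if f x = m then w x y m l else 0)" for y m l
  define good where "good y m l \<longleftrightarrow> l \<le> L \<and> (m \<le> M \<longrightarrow> b y m l \<le> (\<Sum>l\<le>L. \<kappa>' m y l * b y m l))" for y m l
  have "\<exists>l. good y m l" for y m
    unfolding good_def using exists_le_average[of L "\<kappa>' m y" "b y m"] k' by (cases "m \<le> M") auto
  then obtain g where "\<And>y m. good y m (g y m)" by metis
  then have g: "\<And>y m. g y m \<le> L" "\<And>y m. m \<le> M \<Longrightarrow> b y m (g y m) \<le> (\<Sum>l\<le>L. \<kappa>' m y l * b y m l)"
    unfolding good_def by blast+
  have pick: "(\<Sum>m\<le>M. if f x = m then h m else 0) = h (f x)" for x and h :: "nat \<Rightarrow> real" using f(1)[of x] by simp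
  have "(\<Sum>x\<in>S. \<Sum>y\<in>T. w x y (f x) (g y (f x))) = (\<Sum>y\<in>T. \<Sum>x\<in>S. \<Sum>m\<le>M. if f x = m then w x y m (g y m) else 0)"
    unfolding pick by (rule sum.swap)
  also have "\<dots> = (\<Sum>y\<in>T. \<Sum>m\<le>M. b y m (g y m))"
    unfolding b_def by (intro sum.cong refl sum.swap)
  also have "\<dots> \<le> (\<Sum>y\<in>T. \<Sum>m\<le>M. \<Sum>l\<le>L. \<kappa>' m y l * b y m l)"
    using g(2) by (intro sum_mono) auto
  also have "\<dots> = (\<Sum>y\<in>T. \<Sum>m\<le>M. \<Sum>x\<in>S. \<Sum>l\<le>L. if f x = m then \<kappa>' m y l * w x y m l else 0)"
    unfolding b_def sum_distrib_left by (subst sum.swap[of _ S]) (auto intro!: sum.cong)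
  also have "\<dots> = (\<Sum>y\<in>T. \<Sum>x\<in>S. \<Sum>m\<le>M. if f x = m then (\<Sum>l\<le>L. \<kappa>' m y l * w x y m l) else 0)"
    by (intro sum.cong refl, rule trans[OF sum.swap], intro sum.cong refl) simp
  also have "\<dots> = (\<Sum>x\<in>S. c x (f x))"
    unfolding pick c_def by (rule sum.swap)
  also have "\<dots> \<le> (\<Sum>x\<in>S. \<Sum>m\<le>M. \<kappa> m x * c x m)" using f(2) by (intro sum_mono) auto
  also have "\<dots> = (\<Sum>x\<in>S. \<Sum>y\<in>T. \<Sum>m\<le>M. \<kappa> m x * (\<Sum>l\<le>L. \<kappa>' m y l * w x y m l))"
    unfolding c_def sum_distrib_left by (subst sum.swap[of _ T]) (rule refl)
  also note le
  finally show thesis using that f(1) g(1) by blast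
qed

lemma sum_atMost_split: "(\<Sum>m\<le>M. f m) = (\<Sum>m<M. f m) + f M" for f :: "nat \<Rightarrow> real"
  by (simp flip: lessThan_Suc_atMost)

text \<open>In the application \<open>a\<close>, \<open>D\<close>, \<open>J\<close> are the laws of \<open>X\<close>, \<open>Y\<close>, \<open>(X, Y)\<close> given the codeword \<open>u\<^sub>m\<close>, and
  \<open>B\<close>, \<open>C\<close>, \<open>Jv\<close> those given \<open>(u\<^sub>m, v\<^sub>m\<^sub>l)\<close>. Messages \<open>M\<close> and \<open>L\<close> mean rejection.\<close>

lemma codebook_code:
  fixes pX :: "'x \<Rightarrow> real" and pY :: "'y \<Rightarrow> real" and pXY :: "'x \<Rightarrow> 'y \<Rightarrow> real"
    and a :: "nat \<Rightarrow> 'x \<Rightarrow> real" and D :: "nat \<Rightarrow> 'y \<Rightarrow> real" and J :: "nat \<Rightarrow> 'x \<Rightarrow> 'y \<Rightarrow> real"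
    and B :: "nat \<Rightarrow> nat \<Rightarrow> 'x \<Rightarrow> real" and C :: "nat \<Rightarrow> nat \<Rightarrow> 'y \<Rightarrow> real" and Jv :: "nat \<Rightarrow> nat \<Rightarrow> 'x \<Rightarrow> 'y \<Rightarrow> real"
    and M L :: nat and T1 T2 \<eta> :: real
  assumes pos: "M > 0" "L > 0" and T: "T1 > 0" "T2 > 0" and eta: "\<eta> > 0" and fin: "finite S" "finite T"
    and nn: "\<And>x. 0 \<le> pX x" "\<And>y. 0 \<le> pY y" "\<And>x y. 0 \<le> pXY x y" "\<And>m x. 0 \<le> a m x" "\<And>m y. 0 \<le> D m y"
      "\<And>m x y. 0 \<le> J m x y" "\<And>m l x. 0 \<le> B m l x" "\<And>m l y. 0 \<le> C m l y" "\<And>m l x y. 0 \<le> Jv m l x y"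
    and pXY: "\<And>x. x \<in> S \<Longrightarrow> (\<Sum>y\<in>T. pXY x y) = pX x"
    and J: "\<And>m y. m < M \<Longrightarrow> y \<in> T \<Longrightarrow> (\<Sum>x\<in>S. J m x y) = D m y"
    and D: "\<And>m. m < M \<Longrightarrow> (\<Sum>y\<in>T. D m y) \<le> 1"
    and Jv: "\<And>m l x. m < M \<Longrightarrow> l < L \<Longrightarrow> x \<in> S \<Longrightarrow> (\<Sum>y\<in>T. Jv m l x y) = B m l x"
    and B: "\<And>m l. m < M \<Longrightarrow> l < L \<Longrightarrow> (\<Sum>x\<in>S. B m l x) \<le> 1"
    and markov1: "\<And>m x y. m < M \<Longrightarrow> J m x y * pX x = a m x * pXY x y"
    and markov2: "\<And>m l x y. m < M \<Longrightarrow> l < L \<Longrightarrow> Jv m l x y * D m y = C m l y * J m x y"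
  defines "good1 \<equiv> \<lambda>m y. T1 * pY y \<le> D m y" and "good2 \<equiv> \<lambda>m l x. T2 * a m x \<le> B m l x"
  defines "acc \<equiv> \<lambda>x m l. m < M \<and> l < L \<and> T2 * a m x \<le> B m l x"
  assumes err: "(\<Sum>x\<in>S. max 0 (pX x - (\<Sum>m<M. a m x) / M))
      + (\<Sum>m<M. (\<Sum>y\<in>T. max 0 (D m y - (\<Sum>l<L. C m l y) / L))
           + (\<Sum>y\<in>T. if T1 * pY y \<le> D m y then 0 else D m y)
           + (\<Sum>l<L. \<Sum>x\<in>S. if T2 * a m x \<le> B m l x then 0 else B m l x) / L) / M \<le> \<eta>"
  obtains f g where "\<And>x. f x \<le> M" "\<And>y m. m \<le> M \<Longrightarrow> g y m \<le> L"
    "(\<Sum>x\<in>S. \<Sum>y\<in>T. if acc x (f x) (g y (f x)) then 0 else pXY x y) \<le> 2 * \<eta>"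
    "(\<Sum>x\<in>S. \<Sum>y\<in>T. if acc x (f x) (g y (f x)) then pX x * pY y else 0) \<le> 2 / (T1 * T2)"
proof -
  \<comment> \<open>The mass missing from the likelihood encoder goes to the rejection message
    \<open>M\<close>.\<close>
  define k where "k m x = (if m < M then likelihood M (\<lambda>m. a m x) (pX x) m
      else 1 - (\<Sum>m<M. likelihood M (\<lambda>m. a m x) (pX x) m))" for m x
  \<comment> \<open>Node B performs the test \<open>good1\<close> itself: if it fails, all mass goes
    to \<open>L\<close>. This is why \<open>acc\<close> contains only the test of node A.\<close>
  define h where "h m y l = (if good1 m y then likelihood L (\<lambda>l. C m l y) (D m y) l else 0)" for m y l
  define k' where "k' m y l = (if m < M then (if l < L then h m y l else 1 - (\<Sum>l<L. h m y l)) else if l = L then 1 else 0)" for m y l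
  note lk = likelihood[of "\<lambda>m. a m x" "pX x" M for x, OF nn(4) nn(1) pos(1)]
  note lh = likelihood[of "\<lambda>l. C m l y" "D m y" L for m y, OF nn(8) nn(5) pos(2)]
  have h0: "0 \<le> h m y l" for m y l using lh(1) by (simp add: h_def)
  have h1: "(\<Sum>l<L. h m y l) \<le> (if good1 m y then 1 else 0)" for m y using lh(2) by (simp add: h_def)
  have k0: "0 \<le> k m x" for m x using lk(1,2) by (simp add: k_def)
  have k1: "(\<Sum>m\<le>M. k m x) = 1" for x unfolding sum_atMost_split by (simp add: k_def)
  have k'0: "0 \<le> k' m y l" for m y l using h0 order_trans[OF h1[of m y], of 1] by (simp add: k'_def)
  have k'1: "(\<Sum>l\<le>L. k' m y l) = 1" for m y unfolding sum_atMost_split by (simp add: k'_def)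
  have pXY0: "pXY x y = 0" if "pX x = 0" "x \<in> S" "y \<in> T" for x y
    using pXY[OF that(2)] that fin(2) nn(3) by (simp add: sum_nonneg_eq_0_iff)
  have J0: "J m x y = 0" if "D m y = 0" "m < M" "x \<in> S" "y \<in> T" for m x y
    using J[of m y] that fin(1) nn(6) by (simp add: sum_nonneg_eq_0_iff)
  \<comment> \<open>The change of measure for the triple (x, y, m). As message \<open>m\<close> is
    chosen from x alone, the Markov chain U - X - Y carries it from x to the pair.\<close>
  have kXY: "pXY x y * k m x \<le> J m x y / M" if "m < M" "x \<in> S" "y \<in> T" for m x y
    using lk(3)[of "pXY x y" "J m x y" x m] markov1[of m x y] pXY0[of x y] that nn by (simp add: k_def)
  have kX: "pX x * k m x \<le> a m x / M" if "m < M" for m x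
    using lk(3)[of "pX x" "a m x" x m] nn that by (simp add: k_def)
  have hJ: "J m x y * h m y l \<le> Jv m l x y / L" if "m < M" "l < L" "x \<in> S" "y \<in> T" for m l x y
    using lh(3)[of "J m x y" "Jv m l x y" m y l] markov2[of m l x y] J0[of m y x] that nn by (simp add: h_def)
  have rejA: "pX x * k M x \<le> max 0 (pX x - (\<Sum>m<M. a m x) / M)" for x
    using lk(4)[of x] by (simp add: k_def)
  have rejB: "D m y * k' m y L \<le> max 0 (D m y - (\<Sum>l<L. C m l y) / L) + (if good1 m y then 0 else D m y)" if "m < M" for m y
    using lh(4)[of m y] that by (simp add: k'_def h_def)
  \<comment> \<open>Both errors are scaled to mean at most 1, so that one deterministic pair of maps
    bounds their sum by 2. Hence the factor 2 in both conclusions.\<close>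
  define w1 where "w1 x y m l = (if acc x m l then 0 else pXY x y / \<eta>)" for x y m l
  define w2 where "w2 x y m l = (if acc x m l then pX x * pY y * (T1 * T2) else 0)" for x y m l
  have "(\<Sum>x\<in>S. \<Sum>y\<in>T. \<Sum>m\<le>M. k m x * (\<Sum>l\<le>L. k' m y l * w1 x y m l)) \<le> 1"
  proof -
    let ?r = "\<lambda>m l x y. if good2 m l x then 0 else Jv m l x y"
    \<comment> \<open>Per pair (x, y): rejection by A, then for each message rejection by B, and
      finally failure of A's test, measured by the ideal law \<open>Jv\<close>.\<close>
    let ?E = "\<lambda>x y. pXY x y * k M x + (\<Sum>m<M. (J m x y * k' m y L + (\<Sum>l<L. ?r m l x y) / L) / M)"
    have pt: "(\<Sum>m\<le>M. k m x * (\<Sum>l\<le>L. k' m y l * w1 x y m l)) \<le> ?E x y / \<eta>" if xy: "x \<in> S" "y \<in> T" for x y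
    proof -
      have M: "(\<Sum>l\<le>L. k' M y l * w1 x y M l) = pXY x y / \<eta>"
      proof -
        have "(\<Sum>l\<le>L. k' M y l * w1 x y M l) = (\<Sum>l\<le>L. k' M y l) * (pXY x y / \<eta>)"
          unfolding sum_distrib_right by (intro sum.cong) (auto simp: w1_def acc_def)
        then show ?thesis by (simp add: k'1)
      qed
      have m: "k m x * (\<Sum>l\<le>L. k' m y l * w1 x y m l) \<le> (J m x y * k' m y L + (\<Sum>l<L. ?r m l x y) / L) / M / \<eta>"
        if m: "m < M" for m
      proof -
        have "k m x * (\<Sum>l\<le>L. k' m y l * w1 x y m l)
           = (pXY x y * k m x) * (k' m y L + (\<Sum>l<L. if good2 m l x then 0 else h m y l)) / \<eta>"
          unfolding sum_atMost_split using m
          by (simp add: w1_def acc_def good2_def k'_def algebra_simps sum_distrib_left sum_distrib_right sum_divide_distrib add_divide_distrib diff_divide_distrib if_distrib if_distribR cong: if_cong)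
        also have "\<dots> \<le> (J m x y / M) * (k' m y L + (\<Sum>l<L. if good2 m l x then 0 else h m y l)) / \<eta>"
          using eta kXY[OF m xy] h0 k'0 by (intro divide_right_mono mult_right_mono add_nonneg_nonneg sum_nonneg) auto
        also have "\<dots> = (J m x y * k' m y L + (\<Sum>l<L. if good2 m l x then 0 else J m x y * h m y l)) / M / \<eta>"
        proof -
          have "(\<Sum>l<L. if good2 m l x then 0 else J m x y * h m y l) = J m x y * (\<Sum>l<L. if good2 m l x then 0 else h m y l)"
            unfolding sum_distrib_left by (intro sum.cong) auto
          then show ?thesis by (simp add: distrib_left add_divide_distrib)
        qed
        also have "\<dots> \<le> (J m x y * k' m y L + (\<Sum>l<L. ?r m l x y / L)) / M / \<eta>"
          using eta hJ[OF m _ xy] by (intro divide_right_mono add_left_mono sum_mono) auto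
        finally show ?thesis by (simp add: sum_divide_distrib)
      qed
      have "(\<Sum>m\<le>M. k m x * (\<Sum>l\<le>L. k' m y l * w1 x y m l))
         \<le> (\<Sum>m<M. (J m x y * k' m y L + (\<Sum>l<L. ?r m l x y) / L) / M / \<eta>) + k M x * (pXY x y / \<eta>)"
        unfolding sum_atMost_split[of "\<lambda>m. k m x * (\<Sum>l\<le>L. k' m y l * w1 x y m l)"] M
        using m by (intro add_right_mono sum_mono) auto
      then show ?thesis by (simp add: add_divide_distrib sum_divide_distrib mult.commute)
    qed
    have "(\<Sum>x\<in>S. \<Sum>y\<in>T. ?E x y) = (\<Sum>x\<in>S. pX x * k M x)
      + (\<Sum>m<M. ((\<Sum>y\<in>T. D m y * k' m y L) + (\<Sum>l<L. \<Sum>x\<in>S. if good2 m l x then 0 else B m l x) / L) / M)"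
    proof -
      have 1: "(\<Sum>x\<in>S. \<Sum>y\<in>T. pXY x y * k M x) = (\<Sum>x\<in>S. pX x * k M x)"
        by (intro sum.cong refl) (simp add: pXY flip: sum_distrib_right)
      have 2: "(\<Sum>x\<in>S. \<Sum>y\<in>T. J m x y * k' m y L) = (\<Sum>y\<in>T. D m y * k' m y L)" if "m < M" for m
        using that by (subst sum.swap) (intro sum.cong refl, simp add: J flip: sum_distrib_right)
      have 3: "(\<Sum>x\<in>S. \<Sum>y\<in>T. \<Sum>l<L. ?r m l x y) = (\<Sum>l<L. \<Sum>x\<in>S. if good2 m l x then 0 else B m l x)" if m: "m < M" for m
      proof -
        have "(\<Sum>x\<in>S. \<Sum>y\<in>T. \<Sum>l<L. ?r m l x y) = (\<Sum>x\<in>S. \<Sum>l<L. \<Sum>y\<in>T. ?r m l x y)"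
          by (intro sum.cong refl sum.swap)
        also have "\<dots> = (\<Sum>l<L. \<Sum>x\<in>S. \<Sum>y\<in>T. ?r m l x y)" by (rule sum.swap)
        also have "\<dots> = (\<Sum>l<L. \<Sum>x\<in>S. if good2 m l x then 0 else B m l x)"
          by (intro sum.cong refl) (auto simp: Jv[OF m])
        finally show ?thesis .
      qed
      have "(\<Sum>x\<in>S. \<Sum>y\<in>T. \<Sum>m<M. (J m x y * k' m y L + (\<Sum>l<L. ?r m l x y) / L) / M)
         = (\<Sum>x\<in>S. \<Sum>m<M. \<Sum>y\<in>T. (J m x y * k' m y L + (\<Sum>l<L. ?r m l x y) / L) / M)"
        by (intro sum.cong refl sum.swap)
      also have "\<dots> = (\<Sum>m<M. \<Sum>x\<in>S. \<Sum>y\<in>T. (J m x y * k' m y L + (\<Sum>l<L. ?r m l x y) / L) / M)"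
        by (rule sum.swap)
      also have "\<dots> = (\<Sum>m<M. ((\<Sum>x\<in>S. \<Sum>y\<in>T. J m x y * k' m y L) + (\<Sum>x\<in>S. \<Sum>y\<in>T. \<Sum>l<L. ?r m l x y) / L) / M)"
        by (simp only: sum_divide_distrib[symmetric] sum.distrib)
      also have "\<dots> = (\<Sum>m<M. ((\<Sum>y\<in>T. D m y * k' m y L) + (\<Sum>l<L. \<Sum>x\<in>S. if good2 m l x then 0 else B m l x) / L) / M)"
        by (intro sum.cong refl) (simp add: 2 3)
      finally show ?thesis using 1 by (simp only: sum.distrib)
    qed
    also have "\<dots> \<le> (\<Sum>x\<in>S. max 0 (pX x - (\<Sum>m<M. a m x) / M))
      + (\<Sum>m<M. ((\<Sum>y\<in>T. max 0 (D m y - (\<Sum>l<L. C m l y) / L) + (if good1 m y then 0 else D m y))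
          + (\<Sum>l<L. \<Sum>x\<in>S. if good2 m l x then 0 else B m l x) / L) / M)"
      using rejA rejB by (intro add_mono sum_mono divide_right_mono order_refl) auto
    also have "\<dots> \<le> \<eta>"
      using err unfolding good1_def good2_def by (simp only: sum.distrib sum_divide_distrib[symmetric])
    finally have E: "(\<Sum>x\<in>S. \<Sum>y\<in>T. ?E x y) \<le> \<eta>" .
    have "(\<Sum>x\<in>S. \<Sum>y\<in>T. \<Sum>m\<le>M. k m x * (\<Sum>l\<le>L. k' m y l * w1 x y m l)) \<le> (\<Sum>x\<in>S. \<Sum>y\<in>T. ?E x y / \<eta>)"
      by (intro sum_mono pt)
    also have "\<dots> = (\<Sum>x\<in>S. \<Sum>y\<in>T. ?E x y) / \<eta>" by (simp only: sum_divide_distrib)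
    also have "\<dots> \<le> 1" using E eta by (simp add: divide_le_eq_1)
    finally show ?thesis .
  qed
  moreover have "(\<Sum>x\<in>S. \<Sum>y\<in>T. \<Sum>m\<le>M. k m x * (\<Sum>l\<le>L. k' m y l * w2 x y m l)) \<le> 1"
  proof -
    \<comment> \<open>Under independence, \<open>pX x * k m x\<close> is at most
      \<open>a m x / M\<close>. The test \<open>good2\<close> replaces \<open>T2 * a\<close> by
      \<open>B\<close>, of mass at most 1 in x; \<open>good1\<close> replaces \<open>T1 * pY\<close>
      by \<open>D\<close>, of mass at most 1 in y. The average over \<open>m\<close> is then at most
      1.\<close>
    let ?r = "\<lambda>m l x. if good2 m l x then T2 * a m x else 0"
    have pt: "(\<Sum>m\<le>M. k m x * (\<Sum>l\<le>L. k' m y l * w2 x y m l)) \<le> (\<Sum>m<M. \<Sum>l<L. ?r m l x * h m y l * (T1 * pY y) / M)"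
      if xy: "x \<in> S" "y \<in> T" for x y
    proof -
      have M: "(\<Sum>l\<le>L. k' M y l * w2 x y M l) = 0"
        by (intro sum.neutral) (auto simp: w2_def acc_def)
      have m: "k m x * (\<Sum>l\<le>L. k' m y l * w2 x y m l) \<le> (\<Sum>l<L. ?r m l x * h m y l * (T1 * pY y) / M)" if m: "m < M" for m
      proof -
        have "k m x * (\<Sum>l\<le>L. k' m y l * w2 x y m l) = (\<Sum>l<L. k m x * (h m y l * w2 x y m l))"
          unfolding sum_atMost_split using m by (simp add: w2_def acc_def k'_def sum_distrib_left)
        also have "\<dots> \<le> (\<Sum>l<L. ?r m l x * h m y l * (T1 * pY y) / M)"
        proof (rule sum_mono)
          fix l assume l: "l \<in> {..<L}"
          show "k m x * (h m y l * w2 x y m l) \<le> ?r m l x * h m y l * (T1 * pY y) / M"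
          proof (cases "good2 m l x")
            case True
            then have "k m x * (h m y l * w2 x y m l) = (pX x * k m x) * (T2 * h m y l * (T1 * pY y))"
              using m l by (simp add: w2_def acc_def good2_def)
            also have "\<dots> \<le> (a m x / M) * (T2 * h m y l * (T1 * pY y))"
              using T nn h0 kX[OF m] by (intro mult_right_mono) auto
            finally show ?thesis using True by (simp add: ac_simps)
          qed (use m l in \<open>simp add: w2_def acc_def good2_def\<close>)
        qed
        finally show ?thesis .
      qed
      show ?thesis
        unfolding sum_atMost_split[of "\<lambda>m. k m x * (\<Sum>l\<le>L. k' m y l * w2 x y m l)"] M
        unfolding mult_zero_right add_0_right using m by (intro sum_mono) auto
    qed
    have "(\<Sum>x\<in>S. \<Sum>y\<in>T. \<Sum>m\<le>M. k m x * (\<Sum>l\<le>L. k' m y l * w2 x y m l))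
       \<le> (\<Sum>x\<in>S. \<Sum>y\<in>T. \<Sum>m<M. \<Sum>l<L. ?r m l x * h m y l * (T1 * pY y) / M)"
      by (intro sum_mono pt)
    also have "\<dots> = (\<Sum>y\<in>T. \<Sum>m<M. \<Sum>l<L. (\<Sum>x\<in>S. ?r m l x) * h m y l * (T1 * pY y) / M)"
    proof -
      have "(\<Sum>x\<in>S. \<Sum>y\<in>T. \<Sum>m<M. \<Sum>l<L. ?r m l x * h m y l * (T1 * pY y) / M)
         = (\<Sum>y\<in>T. \<Sum>x\<in>S. \<Sum>m<M. \<Sum>l<L. ?r m l x * h m y l * (T1 * pY y) / M)" by (rule sum.swap)
      also have "\<dots> = (\<Sum>y\<in>T. \<Sum>m<M. \<Sum>x\<in>S. \<Sum>l<L. ?r m l x * h m y l * (T1 * pY y) / M)"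
        by (intro sum.cong refl sum.swap)
      also have "\<dots> = (\<Sum>y\<in>T. \<Sum>m<M. \<Sum>l<L. \<Sum>x\<in>S. ?r m l x * h m y l * (T1 * pY y) / M)"
        by (intro sum.cong refl sum.swap)
      finally show ?thesis by (simp only: sum_divide_distrib[symmetric] sum_distrib_right[symmetric])
    qed
    also have "\<dots> \<le> (\<Sum>y\<in>T. \<Sum>m<M. \<Sum>l<L. 1 * h m y l * (T1 * pY y) / M)"
    proof (intro sum_mono divide_right_mono mult_right_mono)
      fix m l assume m: "m \<in> {..<M}" "l \<in> {..<L}"
      have "(\<Sum>x\<in>S. ?r m l x) \<le> (\<Sum>x\<in>S. B m l x)" using nn by (intro sum_mono) (auto simp: good2_def)
      then show "(\<Sum>x\<in>S. ?r m l x) \<le> 1" using B[of m l] m by simp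
    qed (use h0 nn T in auto)
    also have "\<dots> = (\<Sum>y\<in>T. \<Sum>m<M. (\<Sum>l<L. h m y l) * (T1 * pY y) / M)"
      by (simp only: mult_1 sum_divide_distrib[symmetric] sum_distrib_right[symmetric])
    also have "\<dots> \<le> (\<Sum>y\<in>T. \<Sum>m<M. D m y / M)"
    proof (intro sum_mono divide_right_mono)
      fix y m
      have "(\<Sum>l<L. h m y l) * (T1 * pY y) \<le> (if good1 m y then 1 else 0) * (T1 * pY y)"
        using h1[of m y] T nn by (intro mult_right_mono) auto
      also have "\<dots> \<le> D m y" using nn by (auto simp: good1_def)
      finally show "(\<Sum>l<L. h m y l) * (T1 * pY y) \<le> D m y" .
    qed simp
    also have "\<dots> = (\<Sum>m<M. (\<Sum>y\<in>T. D m y) / M)" by (subst sum.swap) (simp add: sum_divide_distrib)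
    also have "\<dots> \<le> (\<Sum>m<M. 1 / M)" using D by (intro sum_mono divide_right_mono) auto
    also have "\<dots> = 1" using pos by simp
    finally show ?thesis .
  qed
  ultimately have "(\<Sum>x\<in>S. \<Sum>y\<in>T. \<Sum>m\<le>M. k m x * (\<Sum>l\<le>L. k' m y l * (w1 x y m l + w2 x y m l))) \<le> 2"
    by (simp add: distrib_left sum.distrib)
  note le2 = this
  obtain f g where fg: "\<And>x. f x \<le> M" "\<And>y m. m \<le> M \<Longrightarrow> g y m \<le> L"
    "(\<Sum>x\<in>S. \<Sum>y\<in>T. w1 x y (f x) (g y (f x)) + w2 x y (f x) (g y (f x))) \<le> 2"
    by (rule derandomize[where M=M and L=L and \<kappa>=k and \<kappa>'=k' and S=S and T=T and w="\<lambda>x y m l. w1 x y m l + w2 x y m l" and C=2,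
      OF k0 k1 k'0 k'1 le2]) blast
  have w0: "0 \<le> (\<Sum>x\<in>S. \<Sum>y\<in>T. w1 x y (f x) (g y (f x)))" "0 \<le> (\<Sum>x\<in>S. \<Sum>y\<in>T. w2 x y (f x) (g y (f x)))"
    using nn T eta by (auto simp: w1_def w2_def intro!: sum_nonneg)
  have "(\<Sum>x\<in>S. \<Sum>y\<in>T. w1 x y (f x) (g y (f x))) = (\<Sum>x\<in>S. \<Sum>y\<in>T. if acc x (f x) (g y (f x)) then 0 else pXY x y) / \<eta>"
    unfolding sum_divide_distrib by (intro sum.cong) (auto simp: w1_def)
  moreover have "(\<Sum>x\<in>S. \<Sum>y\<in>T. w2 x y (f x) (g y (f x))) = (\<Sum>x\<in>S. \<Sum>y\<in>T. if acc x (f x) (g y (f x)) then pX x * pY y else 0) * (T1 * T2)"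
    unfolding sum_distrib_right by (intro sum.cong) (auto simp: w2_def)
  ultimately have "(\<Sum>x\<in>S. \<Sum>y\<in>T. if acc x (f x) (g y (f x)) then 0 else pXY x y) / \<eta> \<le> 2"
    "(\<Sum>x\<in>S. \<Sum>y\<in>T. if acc x (f x) (g y (f x)) then pX x * pY y else 0) * (T1 * T2) \<le> 2"
    using fg(3) w0 by (simp_all add: sum.distrib)
  then show thesis using eta T by (intro that[OF fg(1,2)]) (simp_all add: pos_divide_le_eq pos_le_divide_eq)
qed

section \<open>The random codebook\<close>

definition cond_pr :: "'w pmf \<Rightarrow> ('w \<Rightarrow> 'a) \<Rightarrow> ('w \<Rightarrow> 'b) \<Rightarrow> 'a \<Rightarrow> 'b \<Rightarrow> real" where
  "cond_pr W A B a b = pmf (map_pmf (\<lambda>w. (A w, B w)) W) (a, b) / pmf (map_pmf A W) a"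

lemma cond_pr_nonneg: "0 \<le> cond_pr W A B a b" by (simp add: cond_pr_def)

lemma pmf_marginal_sum_image:
  assumes "finite (set_pmf W)" "finite S" "B ` set_pmf W \<subseteq> S"
  shows "(\<Sum>b\<in>S. pmf (map_pmf (\<lambda>w. (A w, B w)) W) (a, b)) = pmf (map_pmf A W) a"
  using assms by (intro pmf_marginal_sum) auto

lemma pmf_marginal_sum':
  assumes "finite (set_pmf W)" "finite S" "B ` set_pmf W \<subseteq> S"
  shows "(\<Sum>b\<in>S. pmf (map_pmf (\<lambda>w. (A w, B w, C w)) W) (a, b, c)) = pmf (map_pmf (\<lambda>w. (A w, C w)) W) (a, c)"
    and "(\<Sum>b\<in>S. pmf (map_pmf (\<lambda>w. (A w, C w, B w)) W) (a, c, b)) = pmf (map_pmf (\<lambda>w. (A w, C w)) W) (a, c)"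
    and "(\<Sum>b\<in>S. pmf (map_pmf (\<lambda>w. ((A w, B w), C w)) W) ((a, b), c)) = pmf (map_pmf (\<lambda>w. (A w, C w)) W) (a, c)"
proof -
  have *: "pmf (map_pmf F W) z = pmf (map_pmf (\<lambda>w. ((A w, C w), B w)) W) ((a, c), b)"
    if "\<And>w. F w = z \<longleftrightarrow> A w = a \<and> B w = b \<and> C w = c" for F :: "_ \<Rightarrow> 'z" and z b
    using that by (auto simp: pmf_map_sum[OF assms(1)] intro!: sum.cong)
  note m = pmf_marginal_sum_image[OF assms, where A="\<lambda>w. (A w, C w)" and a="(a, c)"]
  show "(\<Sum>b\<in>S. pmf (map_pmf (\<lambda>w. (A w, B w, C w)) W) (a, b, c)) = pmf (map_pmf (\<lambda>w. (A w, C w)) W) (a, c)"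
    by (rule trans[OF sum.cong[OF refl *] m]) auto
  show "(\<Sum>b\<in>S. pmf (map_pmf (\<lambda>w. (A w, C w, B w)) W) (a, c, b)) = pmf (map_pmf (\<lambda>w. (A w, C w)) W) (a, c)"
    by (rule trans[OF sum.cong[OF refl *] m]) auto
  show "(\<Sum>b\<in>S. pmf (map_pmf (\<lambda>w. ((A w, B w), C w)) W) ((a, b), c)) = pmf (map_pmf (\<lambda>w. (A w, C w)) W) (a, c)"
    by (rule trans[OF sum.cong[OF refl *] m]) auto
qed

text \<open>Division by zero makes the conditional law of a null value vanish, whence the bound by 1
  instead of equality.\<close>

lemma cond_pr_sum:
  assumes "finite (set_pmf W)" "finite S" "B ` set_pmf W \<subseteq> S"
  shows "(\<Sum>b\<in>S. cond_pr W A B a b) \<le> 1"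
    and "(\<Sum>b\<in>S. cond_pr W A (\<lambda>w. (B w, C w)) a (b, c)) = cond_pr W A C a c"
    and "(\<Sum>b\<in>S. cond_pr W A (\<lambda>w. (C w, B w)) a (c, b)) = cond_pr W A C a c"
  unfolding cond_pr_def sum_divide_distrib[symmetric] pmf_marginal_sum_image[OF assms] pmf_marginal_sum'[OF assms]
  by simp_all

text \<open>Tower property: it turns an average of conditional masses of bad symbols into the
  probability of a bad event.\<close>

lemma expect_cond_pr:
  assumes fin: "finite (set_pmf W)" and S: "finite S" "B ` set_pmf W \<subseteq> S"
  shows "expect W (\<lambda>w. \<Sum>b\<in>S. cond_pr W A B (A w) b * h (A w) b) = expect W (\<lambda>w. h (A w) (B w))"
proof -
  let ?SA = "A ` set_pmf W"
  let ?AB = "map_pmf (\<lambda>w. (A w, B w)) W"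
  have "expect W (\<lambda>w. \<Sum>b\<in>S. cond_pr W A B (A w) b * h (A w) b)
     = expect (map_pmf A W) (\<lambda>a. \<Sum>b\<in>S. cond_pr W A B a b * h a b)" by simp
  also have "\<dots> = (\<Sum>a\<in>?SA. pmf (map_pmf A W) a * (\<Sum>b\<in>S. cond_pr W A B a b * h a b))"
    using fin by (subst expect_sum) auto
  also have "\<dots> = (\<Sum>a\<in>?SA. \<Sum>b\<in>S. pmf ?AB (a, b) * h a b)"
  proof (intro sum.cong refl)
    fix a assume "a \<in> ?SA"
    then have "pmf (map_pmf A W) a > 0" by (intro pmf_positive) simp
    then show "pmf (map_pmf A W) a * (\<Sum>b\<in>S. cond_pr W A B a b * h a b) = (\<Sum>b\<in>S. pmf ?AB (a, b) * h a b)"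
      by (simp add: cond_pr_def sum_distrib_left)
  qed
  also have "\<dots> = (\<Sum>z\<in>?SA \<times> S. (case z of (a, b) \<Rightarrow> h a b) * pmf ?AB z)"
    by (simp add: sum.cartesian_product split_beta mult.commute)
  also have "\<dots> = expect ?AB (\<lambda>(a, b). h a b)"
    using fin S by (intro integral_measure_pmf_real[symmetric]) auto
  also have "\<dots> = expect W (\<lambda>w. h (A w) (B w))" by simp
  finally show ?thesis .
qed

lemma measure_sum_Times:
  assumes "finite S" "finite T" "set_pmf Q \<subseteq> S \<times> T"
  shows "measure (measure_pmf Q) {z. R z} = (\<Sum>x\<in>S. \<Sum>y\<in>T. if R (x, y) then pmf Q (x, y) else 0)"
proof -
  have "measure Q {z. R z} = measure Q {z\<in>S \<times> T. R z}"
    using assms(3) by (intro measure_eq_AE) (auto simp: AE_measure_pmf_iff)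
  also have "\<dots> = sum (pmf Q) {z\<in>S \<times> T. R z}" using assms by (intro measure_measure_pmf_finite) auto
  also have "\<dots> = (\<Sum>z\<in>S \<times> T. if R z then pmf Q z else 0)"
    using assms by (intro sum.mono_neutral_cong_left) auto
  finally show ?thesis by (simp add: sum.cartesian_product')
qed

text \<open>Superposition codebook: \<open>M\<close> independent codewords u, and for each of them
  \<open>L\<close> codewords v drawn independently given u. \<open>err\<close> collects two covering
  errors, each a large-density event plus a fluctuation term, and the failures of the two tests. The
  densities are multiplied out, which makes them products over the letters in the block
  case.\<close>

lemma one_shot:
  fixes W :: "'w pmf" and X :: "'w \<Rightarrow> 'x" and Y :: "'w \<Rightarrow> 'y" and U :: "'w \<Rightarrow> 'u" and V :: "'w \<Rightarrow> 'v"
    and M L :: nat and T1 T2 \<tau>1 \<tau>2 \<eta> :: real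
  assumes fin: "finite (set_pmf W)" and pos: "M > 0" "L > 0" "T1 > 0" "T2 > 0" "0 \<le> \<tau>1" "0 \<le> \<tau>2" "\<eta> > 0"
    and markov1: "\<And>u x y. pmf (map_pmf (\<lambda>w. (U w, X w, Y w)) W) (u, x, y) * pmf (map_pmf X W) x
        = pmf (map_pmf (\<lambda>w. (U w, X w)) W) (u, x) * pmf (map_pmf (\<lambda>w. (X w, Y w)) W) (x, y)"
    and markov2: "\<And>u v x y. pmf (map_pmf (\<lambda>w. ((U w, V w), X w, Y w)) W) ((u, v), x, y) * pmf (map_pmf (\<lambda>w. (U w, Y w)) W) (u, y)
        = pmf (map_pmf (\<lambda>w. ((U w, V w), Y w)) W) ((u, v), y) * pmf (map_pmf (\<lambda>w. (U w, X w, Y w)) W) (u, x, y)"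
    and err: "measure W {w. \<tau>1 * pr W X w * pr W U w < pr W (\<lambda>w. (U w, X w)) w} + sqrt (\<tau>1 / M)
      + measure W {w. \<tau>2 * pr W (\<lambda>w. (U w, Y w)) w * pr W (\<lambda>w. (U w, V w)) w < pr W (\<lambda>w. ((U w, V w), Y w)) w * pr W U w} + sqrt (\<tau>2 / L)
      + measure W {w. pr W (\<lambda>w. (U w, Y w)) w < T1 * pr W Y w * pr W U w}
      + measure W {w. pr W (\<lambda>w. ((U w, V w), X w)) w * pr W U w < T2 * pr W (\<lambda>w. (U w, X w)) w * pr W (\<lambda>w. (U w, V w)) w} \<le> \<eta>"
  obtains f g acc where "\<And>x. f x \<le> M" "\<And>y m. m \<le> M \<Longrightarrow> g y m \<le> L"
    "measure (map_pmf (\<lambda>w. (X w, Y w)) W) {(x, y). \<not> acc x (f x) (g y (f x))} \<le> 2 * \<eta>"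
    "measure (pair_pmf (map_pmf X W) (map_pmf Y W)) {(x, y). acc x (f x) (g y (f x))} \<le> 2 / (T1 * T2)"
proof -
  let ?XY = "\<lambda>w. (X w, Y w)" and ?UX = "\<lambda>w. (U w, X w)" and ?UY = "\<lambda>w. (U w, Y w)"
  let ?UV = "\<lambda>w. (U w, V w)" and ?UVX = "\<lambda>w. ((U w, V w), X w)" and ?UVY = "\<lambda>w. ((U w, V w), Y w)"
  let ?E1 = "{w. \<tau>1 * pr W X w * pr W U w < pr W ?UX w}" and ?E2 = "{w. \<tau>2 * pr W ?UY w * pr W ?UV w < pr W ?UVY w * pr W U w}"
    and ?E3 = "{w. pr W ?UY w < T1 * pr W Y w * pr W U w}" and ?E4 = "{w. pr W ?UVX w * pr W U w < T2 * pr W ?UX w * pr W ?UV w}"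
  define S where "S = X ` set_pmf W"
  define T where "T = Y ` set_pmf W"
  have S: "finite S" "X ` set_pmf W \<subseteq> S" and T: "finite T" "Y ` set_pmf W \<subseteq> T"
    using fin by (auto simp: S_def T_def)
  define pX where "pX = pmf (map_pmf X W)"
  define pY where "pY = pmf (map_pmf Y W)"
  define a where "a = cond_pr W U X"
  define D where "D = cond_pr W U Y"
  define B where "B u v = cond_pr W ?UV X (u, v)" for u v
  define C where "C u v = cond_pr W ?UV Y (u, v)" for u v
  have ann: "0 \<le> a u x" "0 \<le> D u y" "0 \<le> B u v x" "0 \<le> C u v y" for u v x y
    by (simp_all add: a_def D_def B_def C_def cond_pr_nonneg)
  define PU where "PU = map_pmf U W"
  let ?PUV = "map_pmf ?UV W"
  obtain PV where PV: "?PUV = bind_pmf (map_pmf fst ?PUV) (\<lambda>u. map_pmf (Pair u) (PV u))" "\<And>u. finite (set_pmf (PV u))"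
    using pmf_disintegrate[of ?PUV] fin by auto
  have PU: "map_pmf fst ?PUV = PU" by (simp add: PU_def map_pmf_comp)
  have finPU: "finite (set_pmf PU)" using fin by (simp add: PU_def)
  have PUV: "pmf ?PUV (u, v) = pmf PU u * pmf (PV u) v" for u v
    using arg_cong[OF PV(1), of "\<lambda>p. pmf p (u, v)"] unfolding PU pmf_bind_map_Pair .
  have EUV: "expect PU (\<lambda>u. expect (PV u) (h u)) = expect W (\<lambda>w. h (U w) (V w))" for h
  proof -
    have "expect W (\<lambda>w. h (U w) (V w)) = expect ?PUV (\<lambda>(u, v). h u v)" by simp
    also have "\<dots> = expect (bind_pmf PU (\<lambda>u. map_pmf (Pair u) (PV u))) (\<lambda>(u, v). h u v)"
      using PV(1) unfolding PU by (rule arg_cong)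
    also have "\<dots> = expect PU (\<lambda>u. expect (PV u) (h u))" using finPU PV(2) by (simp add: expect_bind)
    finally show ?thesis ..
  qed
  \<comment> \<open>Covering at the second stage needs the law of Y given u to be the exact mean of
    the laws given (u, v); this holds for u of positive probability.\<close>
  have CD: "expect (PV u) (\<lambda>v. C u v y) = D u y" if u: "u \<in> set_pmf PU" for u y
  proof -
    let ?Q = "map_pmf ?UVY W"
    have pu: "pmf PU u > 0" using u by (rule pmf_positive)
    have z: "pmf ?Q ((u, v), y) = 0" if "v \<notin> set_pmf (PV u)" for v
    proof -
      have "pmf ?PUV (u, v) = 0" using that by (simp add: PUV set_pmf_iff)
      then have "(u, v) \<notin> ?UV ` set_pmf W" by (simp add: pmf_eq_0_set_pmf)
      then have "((u, v), y) \<notin> set_pmf ?Q" by auto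
      then show ?thesis by (simp only: pmf_eq_0_set_pmf not_False_eq_True)
    qed
    have "expect (PV u) (\<lambda>v. C u v y) = (\<Sum>v\<in>set_pmf (PV u). pmf ?Q ((u, v), y) / pmf PU u)"
      unfolding expect_sum[OF PV(2)]
    proof (intro sum.cong refl)
      fix v assume "v \<in> set_pmf (PV u)"
      then have "pmf (PV u) v > 0" by (rule pmf_positive)
      then show "pmf (PV u) v * C u v y = pmf ?Q ((u, v), y) / pmf PU u"
        using pu by (simp add: C_def cond_pr_def PUV)
    qed
    also have "\<dots> = (\<Sum>v\<in>set_pmf (PV u) \<union> V ` set_pmf W. pmf ?Q ((u, v), y) / pmf PU u)"
      using fin PV(2) z by (intro sum.mono_neutral_left) auto
    also have "\<dots> = D u y"
      using fin PV(2) unfolding sum_divide_distrib[symmetric]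
      by (subst pmf_marginal_sum'(3)) (auto simp: D_def cond_pr_def PU_def)
    finally show ?thesis .
  qed
  have D1: "(\<Sum>y\<in>T. D u y) \<le> 1" for u unfolding D_def by (rule cond_pr_sum(1)[OF fin T])
  let ?cw = "\<lambda>u. bind_pmf (replicate_pmf L (PV u)) (\<lambda>vs. return_pmf (u, vs))"
  define Q where "Q = bind_pmf PU ?cw"
  note frep = finite_set_replicate_pmf[OF PV(2)]
  have finQ: "finite (set_pmf Q)" using finPU frep by (auto simp: Q_def)
  have EQ: "expect Q h = expect PU (\<lambda>u. expect (replicate_pmf L (PV u)) (\<lambda>vs. h (u, vs)))" for h
    unfolding Q_def using finPU frep by (simp add: expect_bind)
  define bad1 where "bad1 u y \<longleftrightarrow> \<not> T1 * pY y \<le> D u y" for u y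
  define bad2 where "bad2 u v x \<longleftrightarrow> \<not> T2 * a u x \<le> B u v x" for u v x
  \<comment> \<open>\<open>crit\<close> involves a single u with its own list of v, so its mean
    needs only one codebook entry; \<open>crit1\<close> involves all the codewords u
    together.\<close>
  define crit where "crit c = (\<Sum>y\<in>T. max 0 (D (fst c) y - (\<Sum>v\<leftarrow>snd c. C (fst c) v y) / L))
           + (\<Sum>y\<in>T. if bad1 (fst c) y then D (fst c) y else 0)
           + (\<Sum>v\<leftarrow>snd c. \<Sum>x\<in>S. if bad2 (fst c) v x then B (fst c) v x else 0) / L" for c
  define crit1 where "crit1 cb = (\<Sum>x\<in>S. max 0 (pX x - (\<Sum>c\<leftarrow>cb. a (fst c) x) / M))" for cb :: "('u \<times> 'v list) list"
  have prob: "expect W (\<lambda>w. if R w then 1 else 0) = measure W {w. R w}" for R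
  proof -
    have "expect W (\<lambda>w. if R w then 1 else 0) = expect W (indicator {w. R w})"
      by (intro expect_cong) (simp add: indicator_def)
    then show ?thesis by simp
  qed
  have pos_pr: "pr W A w > 0" if "w \<in> set_pmf W" for A :: "_ \<Rightarrow> 'z" and w using that by (rule pr_pos)
  have at: "a (U w) (X w) = pr W ?UX w / pr W U w" "D (U w) (Y w) = pr W ?UY w / pr W U w"
    "B (U w) (V w) (X w) = pr W ?UVX w / pr W ?UV w"
    "C (U w) (V w) (Y w) = pr W ?UVY w / pr W ?UV w"
    "pX (X w) = pr W X w" "pY (Y w) = pr W Y w" for w
    by (simp_all add: a_def D_def B_def C_def cond_pr_def pX_def pY_def pmf_map_pr pmf_map_pr[of ?UX]
      pmf_map_pr[of ?UY] pmf_map_pr[of ?UV] pmf_map_pr[of ?UVX] pmf_map_pr[of ?UVY])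
  \<comment> \<open>Here and in the next three facts, conditional mass averaged over the codewords
    becomes a probability under \<open>W\<close>.\<close>
  have E1: "expect PU (\<lambda>u. \<Sum>x\<in>S. if \<tau>1 * pX x < a u x then a u x else 0)
      = measure W ?E1"
  proof -
    have "expect PU (\<lambda>u. \<Sum>x\<in>S. if \<tau>1 * pX x < a u x then a u x else 0)
       = expect W (\<lambda>w. \<Sum>x\<in>S. cond_pr W U X (U w) x * (if \<tau>1 * pX x < a (U w) x then 1 else 0))"
      unfolding PU_def integral_map_pmf a_def by (intro expect_cong sum.cong) auto
    also have "\<dots> = expect W (\<lambda>w. if \<tau>1 * pX (X w) < a (U w) (X w) then 1 else 0)"
      by (rule expect_cond_pr[OF fin S])
    also have "\<dots> = expect W (\<lambda>w. if \<tau>1 * pr W X w * pr W U w < pr W ?UX w then 1 else 0)"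
      by (intro expect_cong) (simp add: at pos_less_divide_eq pos_pr)
    finally show ?thesis unfolding prob .
  qed
  have E2: "expect PU (\<lambda>u. expect (PV u) (\<lambda>v. \<Sum>y\<in>T. if \<tau>2 * D u y < C u v y then C u v y else 0))
      = measure W ?E2"
  proof -
    have "expect PU (\<lambda>u. expect (PV u) (\<lambda>v. \<Sum>y\<in>T. if \<tau>2 * D u y < C u v y then C u v y else 0))
       = expect W (\<lambda>w. \<Sum>y\<in>T. cond_pr W ?UV Y (?UV w) y * (if \<tau>2 * D (fst (?UV w)) y < C (fst (?UV w)) (snd (?UV w)) y then 1 else 0))"
      unfolding EUV C_def by (intro expect_cong sum.cong) auto
    also have "\<dots> = expect W (\<lambda>w. if \<tau>2 * D (fst (?UV w)) (Y w) < C (fst (?UV w)) (snd (?UV w)) (Y w) then 1 else 0)"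
      by (rule expect_cond_pr[OF fin T, where h="\<lambda>uv y. if \<tau>2 * D (fst uv) y < C (fst uv) (snd uv) y then 1 else 0"])
    also have "\<dots> = expect W (\<lambda>w. if \<tau>2 * pr W ?UY w * pr W ?UV w < pr W ?UVY w * pr W U w then 1 else 0)"
      by (intro expect_cong) (simp add: at pos_less_divide_eq pos_divide_less_eq pos_pr)
    finally show ?thesis unfolding prob .
  qed
  have E3: "expect PU (\<lambda>u. \<Sum>y\<in>T. if bad1 u y then D u y else 0) = measure W ?E3"
  proof -
    have "expect PU (\<lambda>u. \<Sum>y\<in>T. if bad1 u y then D u y else 0)
       = expect W (\<lambda>w. \<Sum>y\<in>T. cond_pr W U Y (U w) y * (if bad1 (U w) y then 1 else 0))"
      unfolding PU_def integral_map_pmf D_def by (intro expect_cong sum.cong) auto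
    also have "\<dots> = expect W (\<lambda>w. if bad1 (U w) (Y w) then 1 else 0)"
      by (rule expect_cond_pr[OF fin T])
    also have "\<dots> = expect W (\<lambda>w. if pr W ?UY w < T1 * pr W Y w * pr W U w then 1 else 0)"
      by (intro expect_cong) (simp add: bad1_def at not_le pos_divide_less_eq pos_pr)
    finally show ?thesis unfolding prob .
  qed
  have E4: "expect PU (\<lambda>u. expect (PV u) (\<lambda>v. \<Sum>x\<in>S. if bad2 u v x then B u v x else 0))
      = measure W ?E4"
  proof -
    have "expect PU (\<lambda>u. expect (PV u) (\<lambda>v. \<Sum>x\<in>S. if bad2 u v x then B u v x else 0))
       = expect W (\<lambda>w. \<Sum>x\<in>S. cond_pr W ?UV X (?UV w) x * (if bad2 (fst (?UV w)) (snd (?UV w)) x then 1 else 0))"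
      unfolding EUV B_def by (intro expect_cong sum.cong) auto
    also have "\<dots> = expect W (\<lambda>w. if bad2 (fst (?UV w)) (snd (?UV w)) (X w) then 1 else 0)"
      by (rule expect_cond_pr[OF fin S, where h="\<lambda>uv x. if bad2 (fst uv) (snd uv) x then 1 else 0"])
    also have "\<dots> = expect W (\<lambda>w. if pr W ?UVX w * pr W U w < T2 * pr W ?UX w * pr W ?UV w then 1 else 0)"
      by (intro expect_cong) (simp add: bad2_def at not_le pos_divide_less_eq pos_less_divide_eq pos_pr)
    finally show ?thesis unfolding prob .
  qed
  have aX: "expect Q (\<lambda>c. a (fst c) x) = pX x" if "x \<in> S" for x
  proof -
    have "expect Q (\<lambda>c. a (fst c) x) = expect W (\<lambda>w. \<Sum>x'\<in>S. cond_pr W U X (U w) x' * (if x' = x then 1 else 0))"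
      unfolding EQ using S(1) that by (simp add: PU_def a_def if_distrib cong: if_cong)
    also have "\<dots> = expect W (\<lambda>w. if X w = x then 1 else 0)" by (rule expect_cond_pr[OF fin S])
    also have "\<dots> = pX x" unfolding prob by (simp add: pX_def pmf_map vimage_def)
    finally show ?thesis .
  qed
  have pX1: "(\<Sum>x\<in>S. pX x) \<le> 1" unfolding pX_def S_def using fin by (subst sum_pmf_eq_1) auto
  let ?R = "replicate_pmf M Q"
  have finR: "finite (set_pmf ?R)" by (rule finite_set_replicate_pmf[OF finQ])
  have C1: "expect ?R crit1 \<le> measure W ?E1 + sqrt (\<tau>1 / M)"
  proof -
    have "expect ?R crit1 \<le> expect Q (\<lambda>c. \<Sum>x\<in>S. if \<tau>1 * pX x < a (fst c) x then a (fst c) x else 0) + sqrt (\<tau>1 / M)"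
      unfolding crit1_def[abs_def] using S(1) pos ann aX pX1 by (intro soft_covering finQ) auto
    also have "expect Q (\<lambda>c. \<Sum>x\<in>S. if \<tau>1 * pX x < a (fst c) x then a (fst c) x else 0) = expect PU (\<lambda>u. \<Sum>x\<in>S. if \<tau>1 * pX x < a u x then a u x else 0)"
      unfolding EQ fst_conv by simp
    finally show ?thesis unfolding E1 .
  qed
  have C2: "expect Q crit \<le> measure W ?E2 + sqrt (\<tau>2 / L)
      + measure W ?E3
      + measure W ?E4"
  proof -
    have "expect Q crit \<le> expect PU (\<lambda>u. (expect (PV u) (\<lambda>v. \<Sum>y\<in>T. if \<tau>2 * D u y < C u v y then C u v y else 0) + sqrt (\<tau>2 / L))
        + (\<Sum>y\<in>T. if bad1 u y then D u y else 0)
        + expect (PV u) (\<lambda>v. \<Sum>x\<in>S. if bad2 u v x then B u v x else 0))"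
      unfolding EQ
    proof (rule expect_mono[OF finPU])
      fix u assume u: "u \<in> set_pmf PU"
      let ?Rv = "replicate_pmf L (PV u)"
      have "expect ?Rv (\<lambda>vs. crit (u, vs)) = expect ?Rv (\<lambda>vs. \<Sum>y\<in>T. max 0 (D u y - (\<Sum>v\<leftarrow>vs. C u v y) / L))
         + (\<Sum>y\<in>T. if bad1 u y then D u y else 0)
         + expect ?Rv (\<lambda>vs. \<Sum>v\<leftarrow>vs. \<Sum>x\<in>S. if bad2 u v x then B u v x else 0) / L"
        unfolding crit_def fst_conv snd_conv
        by (subst expect_add, rule frep, subst expect_add, rule frep) simp
      also have "expect ?Rv (\<lambda>vs. \<Sum>v\<leftarrow>vs. \<Sum>x\<in>S. if bad2 u v x then B u v x else 0)
         = L * expect (PV u) (\<lambda>v. \<Sum>x\<in>S. if bad2 u v x then B u v x else 0)"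
        by (rule expect_replicate_sum[OF PV(2)])
      also have "expect ?Rv (\<lambda>vs. \<Sum>y\<in>T. max 0 (D u y - (\<Sum>v\<leftarrow>vs. C u v y) / L))
         \<le> expect (PV u) (\<lambda>v. \<Sum>y\<in>T. if \<tau>2 * D u y < C u v y then C u v y else 0) + sqrt (\<tau>2 / L)"
        using T(1) pos ann CD[OF u] D1 by (intro soft_covering PV(2)) auto
      finally show "expect ?Rv (\<lambda>vs. crit (u, vs)) \<le> (expect (PV u) (\<lambda>v. \<Sum>y\<in>T. if \<tau>2 * D u y < C u v y then C u v y else 0) + sqrt (\<tau>2 / L))
        + (\<Sum>y\<in>T. if bad1 u y then D u y else 0)
        + expect (PV u) (\<lambda>v. \<Sum>x\<in>S. if bad2 u v x then B u v x else 0)"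
        using pos(2) by simp
    qed
    also have "\<dots> = expect PU (\<lambda>u. expect (PV u) (\<lambda>v. \<Sum>y\<in>T. if \<tau>2 * D u y < C u v y then C u v y else 0)) + sqrt (\<tau>2 / L)
        + expect PU (\<lambda>u. \<Sum>y\<in>T. if bad1 u y then D u y else 0)
        + expect PU (\<lambda>u. expect (PV u) (\<lambda>v. \<Sum>x\<in>S. if bad2 u v x then B u v x else 0))"
      by (subst expect_add, rule finPU, subst expect_add, rule finPU, subst expect_add, rule finPU) simp
    finally show ?thesis unfolding E2 E3 E4 .
  qed
  have "expect ?R (\<lambda>cb. crit1 cb + (\<Sum>c\<leftarrow>cb. crit c) / M) = expect ?R crit1 + expect Q crit"
    using pos(1) expect_replicate_sum[OF finQ, of M crit] by (subst expect_add[OF finR]) simp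
  also have "\<dots> \<le> \<eta>" using C1 C2 err by linarith
  finally obtain cb where cb: "cb \<in> set_pmf ?R" "crit1 cb + (\<Sum>c\<leftarrow>cb. crit c) / M \<le> \<eta>"
    using expect_le_obtain[OF finR] by blast
  have len: "length cb = M" using cb(1) by (auto simp: set_replicate_pmf)
  have len': "length (snd (cb ! m)) = L" if "m < M" for m
  proof -
    have "cb ! m \<in> set_pmf Q" using cb(1) that len by (auto simp: set_replicate_pmf in_lists_conv_set)
    then show ?thesis by (auto simp: Q_def set_replicate_pmf)
  qed
  define cu where "cu m = fst (cb ! m)" for m
  define cv where "cv m l = snd (cb ! m) ! l" for m l
  have sum_cb: "(\<Sum>c\<leftarrow>cb. h c) = (\<Sum>m<M. h (cb ! m))" for h :: "_ \<Rightarrow> real"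
    using len by (simp add: sum_list_sum_nth atLeast0LessThan)
  have sum_cv: "(\<Sum>v\<leftarrow>snd (cb ! m). h v) = (\<Sum>l<L. h (cv m l))" if "m < M" for h :: "_ \<Rightarrow> real" and m
    using len'[OF that] by (simp add: sum_list_sum_nth atLeast0LessThan cv_def)
  have err': "(\<Sum>x\<in>S. max 0 (pX x - (\<Sum>m<M. a (cu m) x) / M))
      + (\<Sum>m<M. (\<Sum>y\<in>T. max 0 (D (cu m) y - (\<Sum>l<L. C (cu m) (cv m l) y) / L))
           + (\<Sum>y\<in>T. if T1 * pY y \<le> D (cu m) y then 0 else D (cu m) y)
           + (\<Sum>l<L. \<Sum>x\<in>S. if T2 * a (cu m) x \<le> B (cu m) (cv m l) x then 0 else B (cu m) (cv m l) x) / L) / M \<le> \<eta>"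
  proof -
    have flip: "(if \<not> b then t else (0::real)) = (if b then 0 else t)" for b t by simp
    have "crit (cb ! m) = (\<Sum>y\<in>T. max 0 (D (cu m) y - (\<Sum>l<L. C (cu m) (cv m l) y) / L))
           + (\<Sum>y\<in>T. if T1 * pY y \<le> D (cu m) y then 0 else D (cu m) y)
           + (\<Sum>l<L. \<Sum>x\<in>S. if T2 * a (cu m) x \<le> B (cu m) (cv m l) x then 0 else B (cu m) (cv m l) x) / L" if "m < M" for m
      unfolding crit_def sum_cv[OF that] bad1_def bad2_def flip cu_def[symmetric] ..
    then have "(\<Sum>m<M. crit (cb ! m)) = (\<Sum>m<M. (\<Sum>y\<in>T. max 0 (D (cu m) y - (\<Sum>l<L. C (cu m) (cv m l) y) / L))
           + (\<Sum>y\<in>T. if T1 * pY y \<le> D (cu m) y then 0 else D (cu m) y)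
           + (\<Sum>l<L. \<Sum>x\<in>S. if T2 * a (cu m) x \<le> B (cu m) (cv m l) x then 0 else B (cu m) (cv m l) x) / L)"
      by (intro sum.cong) auto
    then show ?thesis using cb(2) unfolding crit1_def sum_cb cu_def[symmetric] by simp
  qed
  define acc where "acc x m l \<longleftrightarrow> m < M \<and> l < L \<and> T2 * a (cu m) x \<le> B (cu m) (cv m l) x" for x m l
  obtain f g where fg: "\<And>x. f x \<le> M" "\<And>y m. m \<le> M \<Longrightarrow> g y m \<le> L"
    "(\<Sum>x\<in>S. \<Sum>y\<in>T. if acc x (f x) (g y (f x)) then 0 else pmf (map_pmf ?XY W) (x, y)) \<le> 2 * \<eta>"
    "(\<Sum>x\<in>S. \<Sum>y\<in>T. if acc x (f x) (g y (f x)) then pX x * pY y else 0) \<le> 2 / (T1 * T2)"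
  proof -
    let ?pXY = "\<lambda>x y. pmf (map_pmf ?XY W) (x, y)"
    let ?J = "\<lambda>m x y. cond_pr W U ?XY (cu m) (x, y)"
    let ?Jv = "\<lambda>m l x y. cond_pr W ?UV ?XY (cu m, cv m l) (x, y)"
    have sums: "(\<Sum>y\<in>T. ?pXY x y) = pX x" "(\<Sum>x\<in>S. ?J m x y) = D (cu m) y"
      "(\<Sum>y\<in>T. ?Jv m l x y) = B (cu m) (cv m l) x" "(\<Sum>x\<in>S. B (cu m) (cv m l) x) \<le> 1" for x y m l
      unfolding pX_def D_def B_def
      by (rule pmf_marginal_sum_image[OF fin T] cond_pr_sum(2)[OF fin S] cond_pr_sum(3)[OF fin T] cond_pr_sum(1)[OF fin S])+
    have mk1: "?J m x y * pX x = a (cu m) x * ?pXY x y" for m x y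
      using markov1[of "cu m" x y] by (simp add: cond_pr_def a_def pX_def)
    have mk2: "?Jv m l x y * D (cu m) y = C (cu m) (cv m l) y * ?J m x y" for m l x y
      using markov2[of "cu m" "cv m l" x y] by (simp add: cond_pr_def D_def C_def)
    have nnX: "0 \<le> pX x" "0 \<le> pY y" for x y by (simp_all add: pX_def pY_def)
    show thesis
      by (rule codebook_code[where M=M and L=L and ?T1.0=T1 and ?T2.0=T2 and \<eta>=\<eta> and S=S and T=T
            and pX=pX and pY=pY and pXY="?pXY" and a="\<lambda>m. a (cu m)" and D="\<lambda>m. D (cu m)" and J="?J"
            and B="\<lambda>m l. B (cu m) (cv m l)" and C="\<lambda>m l. C (cu m) (cv m l)" and Jv="?Jv",
          OF pos(1,2,3,4,7) S(1) T(1) nnX pmf_nonneg ann(1) ann(2) cond_pr_nonneg ann(3) ann(4) cond_pr_nonneg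
            sums(1) sums(2) D1 sums(3) sums(4) mk1 mk2 err'])
         (rule that; simp add: acc_def)
  qed
  show thesis
  proof (rule that[OF fg(1,2)])
    have "measure (map_pmf ?XY W) {z. (\<lambda>(x, y). \<not> acc x (f x) (g y (f x))) z}
       = (\<Sum>x\<in>S. \<Sum>y\<in>T. if acc x (f x) (g y (f x)) then 0 else pmf (map_pmf ?XY W) (x, y))"
      by (subst measure_sum_Times[OF S(1) T(1)]) (use S T in \<open>auto intro!: sum.cong\<close>)
    then show "measure (map_pmf ?XY W) {(x, y). \<not> acc x (f x) (g y (f x))} \<le> 2 * \<eta>"
      using fg(3) by simp
    have "measure (pair_pmf (map_pmf X W) (map_pmf Y W)) {z. (\<lambda>(x, y). acc x (f x) (g y (f x))) z}
       = (\<Sum>x\<in>S. \<Sum>y\<in>T. if acc x (f x) (g y (f x)) then pX x * pY y else 0)"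
      by (subst measure_sum_Times[OF S(1) T(1)]) (use S T in \<open>auto intro!: sum.cong simp: pmf_pair pX_def pY_def\<close>)
    then show "measure (pair_pmf (map_pmf X W) (map_pmf Y W)) {(x, y). acc x (f x) (g y (f x))} \<le> 2 / (T1 * T2)"
      using fg(4) by simp
  qed
qed

section \<open>Block codes\<close>

lemma pmf_replicate_pmf:
  "length zs = n \<Longrightarrow> pmf (replicate_pmf n p) zs = prod_list (map (pmf p) zs)"
proof (induction n arbitrary: zs)
  case (Suc n)
  then obtain a as where zs: "zs = a # as" "length as = n" by (cases zs) auto
  have "replicate_pmf (Suc n) p = map_pmf (\<lambda>z. fst z # snd z) (pair_pmf p (replicate_pmf n p))"
    by (simp add: pair_pmf_def map_pmf_def bind_assoc_pmf bind_return_pmf)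
  moreover have "inj (\<lambda>z::'a \<times> 'a list. fst z # snd z)" by (auto simp: inj_def prod_eq_iff)
  ultimately have "pmf (replicate_pmf (Suc n) p) zs = pmf (pair_pmf p (replicate_pmf n p)) (a, as)"
    using pmf_map_inj'[of "\<lambda>z::'a \<times> 'a list. fst z # snd z" "pair_pmf p (replicate_pmf n p)" "(a, as)"] by (simp add: zs)
  then show ?case using Suc.IH[OF zs(2)] by (simp add: pmf_pair zs(1))
qed simp

text \<open>\<open>F\<close> may be any map with the partition of \<open>map f\<close>; for instance
  a pair of lists stands for the list of pairs.\<close>

lemma pr_replicate_pmf:
  assumes F: "\<And>ws. length ws = n \<Longrightarrow> F ws = F zs \<longleftrightarrow> map f ws = map f zs" and len: "length zs = n"
  shows "pr (replicate_pmf n W) F zs = prod_list (map (pr W f) zs)"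
proof -
  have "pr (replicate_pmf n W) F zs = pr (replicate_pmf n W) (map f) zs"
    unfolding pr_def using F by (intro measure_eq_AE) (auto simp: AE_measure_pmf_iff set_replicate_pmf)
  also have "\<dots> = pmf (replicate_pmf n (map_pmf f W)) (map f zs)"
    unfolding map_replicate_pmf[symmetric] pmf_map_pr ..
  also have "\<dots> = prod_list (map (pr W f) zs)"
    using len by (simp add: pmf_replicate_pmf o_def pmf_map_pr)
  finally show ?thesis .
qed

lemma prod_list_map_mult: "prod_list (map f zs) * prod_list (map g zs) = prod_list (map (\<lambda>z. f z * g z) zs)"
  for f :: "'a \<Rightarrow> real"
  by (induction zs) auto

lemma chebyshev_replicate_pmf:
  fixes h :: "'w \<Rightarrow> real"
  assumes fin: "finite (set_pmf W)" and n: "n > 0" and d: "\<delta> > 0"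
  defines "\<mu> \<equiv> expect W h"
  shows "measure (measure_pmf (replicate_pmf n W)) {zs. real n * \<delta> \<le> \<bar>sum_list (map h zs) - real n * \<mu>\<bar>} \<le> expect W (\<lambda>w. (h w - \<mu>)\<^sup>2) / (real n * \<delta>\<^sup>2)"
proof -
  let ?R = "replicate_pmf n W" and ?Z = "\<lambda>zs. sum_list (map h zs) - real n * \<mu>"
  have pos: "real n * \<delta> > 0" using n d by simp
  have "measure (measure_pmf ?R) {zs. real n * \<delta> \<le> \<bar>?Z zs\<bar>} = expect ?R (indicator {zs. real n * \<delta> \<le> \<bar>?Z zs\<bar>})" by simp
  also have "\<dots> \<le> expect ?R (\<lambda>zs. (?Z zs)\<^sup>2 / (real n * \<delta>)\<^sup>2)"
  proof (intro expect_mono finite_set_replicate_pmf fin)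
    fix zs
    have "1 \<le> (?Z zs)\<^sup>2 / (real n * \<delta>)\<^sup>2" if "real n * \<delta> \<le> \<bar>?Z zs\<bar>"
    proof -
      have "(real n * \<delta>)\<^sup>2 \<le> \<bar>?Z zs\<bar>\<^sup>2" using that pos by (intro power_mono) auto
      then show ?thesis using pos zero_less_power[OF pos, of 2] by (subst pos_le_divide_eq) auto
    qed
    then show "indicator {zs. real n * \<delta> \<le> \<bar>?Z zs\<bar>} zs \<le> (?Z zs)\<^sup>2 / (real n * \<delta>)\<^sup>2" by (simp add: indicator_def)
  qed
  also have "\<dots> = real n * expect W (\<lambda>w. (h w - \<mu>)\<^sup>2) / (real n * \<delta>)\<^sup>2"
    using expect_replicate_variance[OF fin, of n h] by (simp add: \<mu>_def)
  also have "\<dots> = expect W (\<lambda>w. (h w - \<mu>)\<^sup>2) / (real n * \<delta>\<^sup>2)" using n d by (simp add: power2_eq_square)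
  finally show ?thesis .
qed

lemma log_ratio_prod_list:
  fixes a b :: "'w \<Rightarrow> real"
  assumes "\<And>z. z \<in> set zs \<Longrightarrow> a z > 0" "\<And>z. z \<in> set zs \<Longrightarrow> b z > 0"
  shows "prod_list (map a zs) > 0 \<and> prod_list (map b zs) > 0 \<and>
    sum_list (map (\<lambda>z. log 2 (a z / b z)) zs) = log 2 (prod_list (map a zs) / prod_list (map b zs))"
  using assms
proof (induction zs)
  case (Cons z zs)
  then have "a z > 0" "b z > 0" "prod_list (map a zs) > 0" "prod_list (map b zs) > 0"
    "sum_list (map (\<lambda>z. log 2 (a z / b z)) zs) = log 2 (prod_list (map a zs) / prod_list (map b zs))" by auto
  then show ?case by (simp add: log_divide log_mult less_imp_neq[THEN not_sym])
qed simp

text \<open>Weak law of large numbers for the log-ratio, exponentiated into comparisons of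
  products.\<close>

lemma ratio_tails:
  fixes a b :: "'w \<Rightarrow> real"
  assumes fin: "finite (set_pmf W)" and n: "n > 0" and d: "\<delta> > 0"
    and ab: "\<And>z. z \<in> set_pmf W \<Longrightarrow> a z > 0" "\<And>z. z \<in> set_pmf W \<Longrightarrow> b z > 0"
  defines "\<mu> \<equiv> expect W (\<lambda>z. log 2 (a z / b z))"
  defines "v \<equiv> expect W (\<lambda>z. (log 2 (a z / b z) - \<mu>)\<^sup>2)"
  shows "measure (measure_pmf (replicate_pmf n W)) {zs. 2 powr (real n * (\<mu> + \<delta>)) * prod_list (map b zs) < prod_list (map a zs)} \<le> v / (real n * \<delta>\<^sup>2)"
    and "measure (measure_pmf (replicate_pmf n W)) {zs. prod_list (map a zs) < 2 powr (real n * (\<mu> - \<delta>)) * prod_list (map b zs)} \<le> v / (real n * \<delta>\<^sup>2)"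
proof -
  let ?h = "\<lambda>z. log 2 (a z / b z)"
  let ?A = "\<lambda>zs. prod_list (map a zs)" and ?B = "\<lambda>zs. prod_list (map b zs)"
  have lr: "?A zs > 0" "?B zs > 0" "sum_list (map ?h zs) = log 2 (?A zs / ?B zs)" if "zs \<in> set_pmf (replicate_pmf n W)" for zs
    using log_ratio_prod_list[of zs a b] ab that by (auto simp: set_replicate_pmf in_lists_conv_set)
  have bound: "measure (measure_pmf (replicate_pmf n W)) {zs. real n * \<delta> \<le> \<bar>sum_list (map ?h zs) - real n * \<mu>\<bar>} \<le> v / (real n * \<delta>\<^sup>2)"
    unfolding v_def \<mu>_def by (rule chebyshev_replicate_pmf[OF fin n d])
  have mono: "measure (measure_pmf (replicate_pmf n W)) A \<le> v / (real n * \<delta>\<^sup>2)"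
    if "\<And>zs. zs \<in> set_pmf (replicate_pmf n W) \<Longrightarrow> zs \<in> A \<Longrightarrow> real n * \<delta> \<le> \<bar>sum_list (map ?h zs) - real n * \<mu>\<bar>" for A
  proof -
    have "measure (measure_pmf (replicate_pmf n W)) A \<le> measure (measure_pmf (replicate_pmf n W)) {zs. real n * \<delta> \<le> \<bar>sum_list (map ?h zs) - real n * \<mu>\<bar>}"
      using that by (intro measure_pmf.finite_measure_mono_AE) (auto simp: AE_measure_pmf_iff)
    then show ?thesis using bound by linarith
  qed
  show "measure (measure_pmf (replicate_pmf n W)) {zs. 2 powr (real n * (\<mu> + \<delta>)) * ?B zs < ?A zs} \<le> v / (real n * \<delta>\<^sup>2)"
  proof (rule mono)
    fix zs assume zs: "zs \<in> set_pmf (replicate_pmf n W)" "zs \<in> {zs. 2 powr (real n * (\<mu> + \<delta>)) * ?B zs < ?A zs}"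
    then have "2 powr (real n * (\<mu> + \<delta>)) < ?A zs / ?B zs" using lr(2)[OF zs(1)] by (simp add: pos_less_divide_eq)
    then have "real n * (\<mu> + \<delta>) < log 2 (?A zs / ?B zs)" using lr(1,2)[OF zs(1)] by (simp add: less_log_iff)
    then show "real n * \<delta> \<le> \<bar>sum_list (map ?h zs) - real n * \<mu>\<bar>" unfolding lr(3)[OF zs(1)] by (simp add: algebra_simps)
  qed
  show "measure (measure_pmf (replicate_pmf n W)) {zs. ?A zs < 2 powr (real n * (\<mu> - \<delta>)) * ?B zs} \<le> v / (real n * \<delta>\<^sup>2)"
  proof (rule mono)
    fix zs assume zs: "zs \<in> set_pmf (replicate_pmf n W)" "zs \<in> {zs. ?A zs < 2 powr (real n * (\<mu> - \<delta>)) * ?B zs}"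
    then have "?A zs / ?B zs < 2 powr (real n * (\<mu> - \<delta>))" using lr(2)[OF zs(1)] by (simp add: pos_divide_less_eq)
    then have "log 2 (?A zs / ?B zs) < real n * (\<mu> - \<delta>)" using lr(1,2)[OF zs(1)] by (simp add: log_less_iff)
    then show "real n * \<delta> \<le> \<bar>sum_list (map ?h zs) - real n * \<mu>\<bar>" unfolding lr(3)[OF zs(1)] by (simp add: algebra_simps)
  qed
qed

lemma pr_joint_law_markov:
  fixes P K L
  defines "W \<equiv> joint_law P K L"
  shows "pr W (\<lambda>(x,y,u,v). (u,x,y)) z * pr W (\<lambda>(x,y,u,v). x) z = pr W (\<lambda>(x,y,u,v). (u,x)) z * pr W (\<lambda>(x,y,u,v). (x,y)) z"
    and "pr W (\<lambda>(x,y,u,v). ((u,v),x,y)) z * pr W (\<lambda>(x,y,u,v). (u,y)) z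
      = pr W (\<lambda>(x,y,u,v). ((u,v),y)) z * pr W (\<lambda>(x,y,u,v). (u,x,y)) z"
proof -
  obtain x y u v where z: "z = (x,y,u,v)" by (cases z)
  have c: "pr W A z = pr W B z" if "\<And>w. A w = A z \<longleftrightarrow> B w = B z" for A :: "_ \<Rightarrow> 'p" and B :: "_ \<Rightarrow> 'q"
    using that by (simp add: pr_def)
  have e: "pr W (\<lambda>(x,y,u,v). (u,x,y)) z = pr W (\<lambda>(x,y,u,v). ((x,y),u)) z"
    "pr W (\<lambda>(x,y,u,v). (u,x)) z = pr W (\<lambda>(x,y,u,v). (x,u)) z"
    "pr W (\<lambda>(x,y,u,v). ((u,v),x,y)) z = pr W (\<lambda>(x,y,u,v). (((x,y),u),v)) z"
    "pr W (\<lambda>(x,y,u,v). ((u,v),y)) z = pr W (\<lambda>(x,y,u,v). ((u,y),v)) z"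
    by (intro c; auto simp: z)+
  show "pr W (\<lambda>(x,y,u,v). (u,x,y)) z * pr W (\<lambda>(x,y,u,v). x) z = pr W (\<lambda>(x,y,u,v). (u,x)) z * pr W (\<lambda>(x,y,u,v). (x,y)) z"
    unfolding e using joint_law_markov_U[of P K L x y u] by (simp add: z flip: W_def pmf_map_pr)
  show "pr W (\<lambda>(x,y,u,v). ((u,v),x,y)) z * pr W (\<lambda>(x,y,u,v). (u,y)) z
      = pr W (\<lambda>(x,y,u,v). ((u,v),y)) z * pr W (\<lambda>(x,y,u,v). (u,x,y)) z"
    unfolding e using joint_law_markov_V[of P K L x y u v] by (simp add: z mult.commute flip: W_def pmf_map_pr)
qed

lemma map_Pair_eq_iff:
  "map (\<lambda>z. (f z, g z)) ws = map (\<lambda>z. (f z, g z)) zs \<longleftrightarrow> map f ws = map f zs \<and> map g ws = map g zs"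
  by (auto simp: list_eq_iff_nth_eq)

text \<open>\<open>h1\<close>, \<open>h2\<close>, \<open>h3\<close>, \<open>h4\<close> are the
  information densities of I(U;X), I(V;Y|U), I(U;Y) and I(V;X|U). Covering fails on upper tails and
  the tests on lower tails, hence the signs of \<delta>. By \<open>surj\<close> every tuple of
  sequences of length \<open>n\<close> comes from a list of outcomes, which transfers the Markov
  identities from \<open>pr\<close> to arbitrary arguments.\<close>

lemma block_code:
  fixes W :: "'w pmf" and X :: "'w \<Rightarrow> 'x" and Y :: "'w \<Rightarrow> 'y" and U :: "'w \<Rightarrow> 'u" and V :: "'w \<Rightarrow> 'v"
    and M L n :: nat and \<delta> \<eta> :: real
  assumes fin: "finite (set_pmf W)" and pos: "n > 0" "\<delta> > 0" "M > 0" "L > 0" "\<eta> > 0"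
    and surj: "\<And>x y u v. \<exists>z. X z = x \<and> Y z = y \<and> U z = u \<and> V z = v"
    and markov1: "\<And>z. pr W (\<lambda>z. (U z, X z, Y z)) z * pr W X z = pr W (\<lambda>z. (U z, X z)) z * pr W (\<lambda>z. (X z, Y z)) z"
    and markov2: "\<And>z. pr W (\<lambda>z. ((U z, V z), X z, Y z)) z * pr W (\<lambda>z. (U z, Y z)) z
        = pr W (\<lambda>z. ((U z, V z), Y z)) z * pr W (\<lambda>z. (U z, X z, Y z)) z"
  defines "h1 \<equiv> \<lambda>z. log 2 (pr W (\<lambda>z. (U z, X z)) z / (pr W X z * pr W U z))"
    and "h2 \<equiv> \<lambda>z. log 2 (pr W (\<lambda>z. ((U z, V z), Y z)) z * pr W U z / (pr W (\<lambda>z. (U z, Y z)) z * pr W (\<lambda>z. (U z, V z)) z))"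
    and "h3 \<equiv> \<lambda>z. log 2 (pr W (\<lambda>z. (U z, Y z)) z / (pr W Y z * pr W U z))"
    and "h4 \<equiv> \<lambda>z. log 2 (pr W (\<lambda>z. ((U z, V z), X z)) z * pr W U z / (pr W (\<lambda>z. (U z, X z)) z * pr W (\<lambda>z. (U z, V z)) z))"
  defines "var \<equiv> \<lambda>h. expect W (\<lambda>z. (h z - expect W h)\<^sup>2)"
  assumes err: "var h1 / (real n * \<delta>\<^sup>2) + sqrt (2 powr (real n * (expect W h1 + \<delta>)) / M)
     + var h2 / (real n * \<delta>\<^sup>2) + sqrt (2 powr (real n * (expect W h2 + \<delta>)) / L)
     + var h3 / (real n * \<delta>\<^sup>2) + var h4 / (real n * \<delta>\<^sup>2) \<le> \<eta>"
  obtains f g acc where "\<And>x. f x \<le> M" "\<And>y m. m \<le> M \<Longrightarrow> g y m \<le> L"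
    "measure (map_pmf (\<lambda>w. (map X w, map Y w)) (replicate_pmf n W)) {(x, y). \<not> acc x (f x) (g y (f x))} \<le> 2 * \<eta>"
    "measure (pair_pmf (map_pmf (map X) (replicate_pmf n W)) (map_pmf (map Y) (replicate_pmf n W))) {(x, y). acc x (f x) (g y (f x))}
      \<le> 2 / (2 powr (real n * (expect W h3 - \<delta>)) * 2 powr (real n * (expect W h4 - \<delta>)))"
proof -
  let ?XY = "\<lambda>z. (X z, Y z)" and ?nXY = "\<lambda>w. (map X w, map Y w)"
    and ?UX = "\<lambda>z. (U z, X z)" and ?nUX = "\<lambda>w. (map U w, map X w)"
    and ?UY = "\<lambda>z. (U z, Y z)" and ?nUY = "\<lambda>w. (map U w, map Y w)"
    and ?UV = "\<lambda>z. (U z, V z)" and ?nUV = "\<lambda>w. (map U w, map V w)"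
    and ?UVX = "\<lambda>z. ((U z, V z), X z)" and ?nUVX = "\<lambda>w. ((map U w, map V w), map X w)"
    and ?UVY = "\<lambda>z. ((U z, V z), Y z)" and ?nUVY = "\<lambda>w. ((map U w, map V w), map Y w)"
    and ?UXY = "\<lambda>z. (U z, X z, Y z)" and ?nUXY = "\<lambda>w. (map U w, map X w, map Y w)"
    and ?UVXY = "\<lambda>z. ((U z, V z), X z, Y z)" and ?nUVXY = "\<lambda>w. ((map U w, map V w), map X w, map Y w)"
    and ?t1 = "2 powr (real n * (expect W h1 + \<delta>))"
    and ?t2 = "2 powr (real n * (expect W h2 + \<delta>))"
    and ?t3 = "2 powr (real n * (expect W h3 - \<delta>)) :: real"
    and ?t4 = "2 powr (real n * (expect W h4 - \<delta>)) :: real"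
    and ?mR = "measure_pmf (replicate_pmf n W)"
  let ?R = "replicate_pmf n W"
  have prn:
    "pr ?R (map X) zs = prod_list (map (pr W X) zs)" "pr ?R (map Y) zs = prod_list (map (pr W Y) zs)"
    "pr ?R (map U) zs = prod_list (map (pr W U) zs)"
    "pr ?R ?nXY zs = prod_list (map (pr W ?XY) zs)"
    "pr ?R ?nUX zs = prod_list (map (pr W ?UX) zs)"
    "pr ?R ?nUY zs = prod_list (map (pr W ?UY) zs)"
    "pr ?R ?nUV zs = prod_list (map (pr W ?UV) zs)"
    "pr ?R ?nUVX zs = prod_list (map (pr W ?UVX) zs)"
    "pr ?R ?nUVY zs = prod_list (map (pr W ?UVY) zs)"
    "pr ?R ?nUXY zs = prod_list (map (pr W ?UXY) zs)"
    "pr ?R ?nUVXY zs = prod_list (map (pr W ?UVXY) zs)"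
    if "length zs = n" for zs
    by (intro pr_replicate_pmf that; simp add: map_Pair_eq_iff)+
  have len: "length zs = n" if "zs \<in> set_pmf ?R" for zs using that by (simp add: set_replicate_pmf)
  have "\<forall>x y u v. \<exists>z. X z = x \<and> Y z = y \<and> U z = u \<and> V z = v" using surj by blast
  then obtain zf where zf: "\<And>x y u v. X (zf x y u v) = x \<and> Y (zf x y u v) = y \<and> U (zf x y u v) = u \<and> V (zf x y u v) = v"
    by metis
  have zs: "\<exists>zs. length zs = n \<and> map X zs = xs \<and> map Y zs = ys \<and> map U zs = us \<and> map V zs = vs"
    if "length xs = n" "length ys = n" "length us = n" "length vs = n" for xs ys us vs
    using that zf by (intro exI[of _ "map (\<lambda>i. zf (xs ! i) (ys ! i) (us ! i) (vs ! i)) [0..<n]"]) (auto simp: list_eq_iff_nth_eq)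
  have out: "pmf (map_pmf F ?R) c = 0" if "\<And>w. length w = n \<Longrightarrow> F w \<noteq> c" for F :: "_ \<Rightarrow> 'z" and c
    using that len by (auto simp: pmf_eq_0_set_pmf)
  have mk1: "pmf (map_pmf ?nUXY ?R) (us, xs, ys) * pmf (map_pmf (map X) ?R) xs
        = pmf (map_pmf ?nUX ?R) (us, xs) * pmf (map_pmf ?nXY ?R) (xs, ys)" for us xs ys
  proof (cases "length us = n \<and> length xs = n \<and> length ys = n")
    case True
    then obtain zs where z: "length zs = n" "map X zs = xs" "map Y zs = ys" "map U zs = us"
      using zs[of xs ys us "replicate n undefined"] by auto
    have "pr ?R ?nUXY zs * pr ?R (map X) zs
        = pr ?R ?nUX zs * pr ?R ?nXY zs"
      unfolding prn[OF z(1)] prod_list_map_mult markov1 ..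
    then show ?thesis unfolding pmf_map_pr[symmetric] z .
  next
    case False
    have "pmf (map_pmf ?nUXY ?R) (us, xs, ys) = 0" using False by (intro out) auto
    \<comment> \<open>For a list of the wrong length the right side vanishes too, but through a
      factor that depends on which list is at fault.\<close>
    moreover have "pmf (map_pmf ?nUX ?R) (us, xs) = 0 \<or> pmf (map_pmf ?nXY ?R) (xs, ys) = 0"
    proof (cases "length ys = n")
      case True
      then have "pmf (map_pmf ?nUX ?R) (us, xs) = 0" using False by (intro out) auto
      then show ?thesis ..
    next
      case False
      then have "pmf (map_pmf ?nXY ?R) (xs, ys) = 0" by (intro out) auto
      then show ?thesis ..
    qed
    ultimately show ?thesis by auto
  qed
  have mk2: "pmf (map_pmf ?nUVXY ?R) ((us, vs), xs, ys) * pmf (map_pmf ?nUY ?R) (us, ys)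
        = pmf (map_pmf ?nUVY ?R) ((us, vs), ys) * pmf (map_pmf ?nUXY ?R) (us, xs, ys)" for us vs xs ys
  proof (cases "length us = n \<and> length vs = n \<and> length xs = n \<and> length ys = n")
    case True
    then obtain zs where z: "length zs = n" "map X zs = xs" "map Y zs = ys" "map U zs = us" "map V zs = vs"
      using zs[of xs ys us vs] by auto
    have "pr ?R ?nUVXY zs * pr ?R ?nUY zs
        = pr ?R ?nUVY zs * pr ?R ?nUXY zs"
      unfolding prn[OF z(1)] prod_list_map_mult markov2 ..
    then show ?thesis unfolding pmf_map_pr[symmetric] z .
  next
    case False
    have "pmf (map_pmf ?nUVXY ?R) ((us, vs), xs, ys) = 0" using False by (intro out) auto
    moreover have "pmf (map_pmf ?nUVY ?R) ((us, vs), ys) = 0 \<or> pmf (map_pmf ?nUXY ?R) (us, xs, ys) = 0"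
    proof (cases "length xs = n")
      case True
      then have "pmf (map_pmf ?nUVY ?R) ((us, vs), ys) = 0" using False by (intro out) auto
      then show ?thesis ..
    next
      case False
      then have "pmf (map_pmf ?nUXY ?R) (us, xs, ys) = 0" by (intro out) auto
      then show ?thesis ..
    qed
    ultimately show ?thesis by auto
  qed
  have meas: "measure ?mR {zs. G zs} = measure ?mR {zs. H zs}" if "\<And>zs. length zs = n \<Longrightarrow> G zs = H zs" for G H
    using that len by (intro measure_eq_AE) (auto simp: AE_measure_pmf_iff)
  note tails = ratio_tails[OF fin pos(1,2)]
  have e1: "measure ?mR {w. ?t1 * pr ?R (map X) w * pr ?R (map U) w < pr ?R ?nUX w}
      \<le> var h1 / (real n * \<delta>\<^sup>2)" (is "?lhs \<le> _")
  proof (rule order_trans[OF eq_refl])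
    show "?lhs
      = measure ?mR {zs. ?t1 * prod_list (map (\<lambda>z. pr W X z * pr W U z) zs) < prod_list (map (pr W ?UX) zs)}"
      by (intro meas) (simp add: prn mult.assoc prod_list_map_mult)
    show "measure ?mR {zs. ?t1 * prod_list (map (\<lambda>z. pr W X z * pr W U z) zs) < prod_list (map (pr W ?UX) zs)} \<le> var h1 / (real n * \<delta>\<^sup>2)"
      unfolding var_def h1_def by (rule tails(1)) (simp_all add: pr_pos)
  qed
  have e2: "measure ?mR {w. ?t2 * pr ?R ?nUY w * pr ?R ?nUV w
       < pr ?R ?nUVY w * pr ?R (map U) w} \<le> var h2 / (real n * \<delta>\<^sup>2)" (is "?lhs \<le> _")
  proof (rule order_trans[OF eq_refl])
    show "?lhs
      = measure ?mR {zs. ?t2 * prod_list (map (\<lambda>z. pr W ?UY z * pr W ?UV z) zs)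
         < prod_list (map (\<lambda>z. pr W ?UVY z * pr W U z) zs)}"
      by (intro meas) (simp add: prn mult.assoc prod_list_map_mult)
    show "measure ?mR {zs. ?t2 * prod_list (map (\<lambda>z. pr W ?UY z * pr W ?UV z) zs)
         < prod_list (map (\<lambda>z. pr W ?UVY z * pr W U z) zs)} \<le> var h2 / (real n * \<delta>\<^sup>2)"
      unfolding var_def h2_def by (rule tails(1)) (simp_all add: pr_pos)
  qed
  have e3: "measure ?mR {w. pr ?R ?nUY w < ?t3 * pr ?R (map Y) w * pr ?R (map U) w}
      \<le> var h3 / (real n * \<delta>\<^sup>2)" (is "?lhs \<le> _")
  proof (rule order_trans[OF eq_refl])
    show "?lhs
      = measure ?mR {zs. prod_list (map (pr W ?UY) zs) < ?t3 * prod_list (map (\<lambda>z. pr W Y z * pr W U z) zs)}"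
      by (intro meas) (simp add: prn mult.assoc prod_list_map_mult)
    show "measure ?mR {zs. prod_list (map (pr W ?UY) zs) < ?t3 * prod_list (map (\<lambda>z. pr W Y z * pr W U z) zs)} \<le> var h3 / (real n * \<delta>\<^sup>2)"
      unfolding var_def h3_def by (rule tails(2)) (simp_all add: pr_pos)
  qed
  have e4: "measure ?mR {w. pr ?R ?nUVX w * pr ?R (map U) w
       < ?t4 * pr ?R ?nUX w * pr ?R ?nUV w} \<le> var h4 / (real n * \<delta>\<^sup>2)" (is "?lhs \<le> _")
  proof (rule order_trans[OF eq_refl])
    show "?lhs
      = measure ?mR {zs. prod_list (map (\<lambda>z. pr W ?UVX z * pr W U z) zs)
         < ?t4 * prod_list (map (\<lambda>z. pr W ?UX z * pr W ?UV z) zs)}"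
      by (intro meas) (simp add: prn mult.assoc prod_list_map_mult)
    show "measure ?mR {zs. prod_list (map (\<lambda>z. pr W ?UVX z * pr W U z) zs)
         < ?t4 * prod_list (map (\<lambda>z. pr W ?UX z * pr W ?UV z) zs)} \<le> var h4 / (real n * \<delta>\<^sup>2)"
      unfolding var_def h4_def by (rule tails(2)) (simp_all add: pr_pos)
  qed
  have finR: "finite (set_pmf ?R)" by (rule finite_set_replicate_pmf[OF fin])
  note E = order_trans[OF add_mono[OF add_mono[OF add_mono[OF add_mono[OF add_mono[OF e1 order_refl] e2] order_refl] e3] e4] err]
  have p: "?t3 > 0" "?t4 > 0"
    "0 \<le> ?t1" "0 \<le> ?t2"
    by simp_all
  show thesis
    by (rule one_shot[where W="?R" and X="map X" and Y="map Y" and U="map U" and V="map V" and M=M and L=L and \<eta>=\<eta>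
        and ?T1.0="?t3" and ?T2.0="?t4"
        and ?\<tau>1.0="?t1" and ?\<tau>2.0="?t2",
        OF finR pos(3,4) p pos(5) mk1 mk2 E]) (rule that; assumption)
qed

section \<open>Codebook sizes and the direct part\<close>

lemma expect_log_ratio:
  fixes A :: "'w \<Rightarrow> 'a" and B :: "'w \<Rightarrow> 'b" and C :: "'w \<Rightarrow> 'c" and D :: "'w \<Rightarrow> 'd"
  assumes "finite (set_pmf W)"
  shows "expect W (\<lambda>z. log 2 (pr W A z / (pr W B z * pr W C z))) = ent W B + ent W C - ent W A"
    and "expect W (\<lambda>z. log 2 (pr W A z * pr W B z / (pr W C z * pr W D z))) = ent W C + ent W D - ent W A - ent W B"
proof -
  have "expect W (\<lambda>z. log 2 (pr W A z / (pr W B z * pr W C z))) = expect W (\<lambda>z. log 2 (pr W A z) - log 2 (pr W B z) - log 2 (pr W C z))"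
    by (intro expect_cong) (simp add: log_divide log_mult pr_pos less_imp_neq[THEN not_sym])
  then show "expect W (\<lambda>z. log 2 (pr W A z / (pr W B z * pr W C z))) = ent W B + ent W C - ent W A"
    using assms by (simp add: ent_def)
  have "expect W (\<lambda>z. log 2 (pr W A z * pr W B z / (pr W C z * pr W D z)))
      = expect W (\<lambda>z. log 2 (pr W A z) + log 2 (pr W B z) - log 2 (pr W C z) - log 2 (pr W D z))"
    by (intro expect_cong) (simp add: log_divide log_mult pr_pos less_imp_neq[THEN not_sym])
  then show "expect W (\<lambda>z. log 2 (pr W A z * pr W B z / (pr W C z * pr W D z))) = ent W C + ent W D - ent W A - ent W B"
    using assms by (simp add: ent_def)
qed

text \<open>Rounding up and the rejection message together cost at most a factor 4, that is, two
  bits.\<close>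

lemma log_codebook_size:
  fixes a :: real
  assumes "0 \<le> a"
  shows "log 2 (real (nat \<lceil>2 powr a\<rceil> + 1)) \<le> a + 2"
proof -
  have "1 \<le> 2 powr a" using assms by (simp add: ge_one_powr_ge_zero)
  moreover have "real (nat \<lceil>2 powr a\<rceil> + 1) = of_int \<lceil>2 powr a\<rceil> + 1" by (simp add: of_nat_nat)
  ultimately have "real (nat \<lceil>2 powr a\<rceil> + 1) \<le> 4 * 2 powr a"
    using of_int_ceiling_le_add_one[of "2 powr a"] by linarith
  also have "4 * (2::real) powr a = 2 powr (a + 2)" by (simp add: powr_add)
  finally have "real (nat \<lceil>2 powr a\<rceil> + 1) \<le> 2 powr (a + 2)" .
  moreover have "0 < real k + 1" for k by simp
  ultimately show ?thesis by (simp only: log_le_iff of_nat_add of_nat_1 one_less_numeral_iff semiring_norm)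
qed

lemma achievability:
  fixes P :: "('x::finite \<times> 'y::finite) pmf"
  assumes re: "(r, e) \<in> region P" "r \<le> R" and eps: "0 < \<epsilon>"
  shows "feasible_exponent P (independent_law P) R \<epsilon> e"
proof -
  obtain K :: "'x \<Rightarrow> nat pmf" and L :: "nat \<times> 'y \<Rightarrow> nat pmf" where
    r: "r = rate (joint_law P K L)" "e = expo (joint_law P K L)"
    and fK: "\<And>x. finite (set_pmf (K x))" and fL: "\<And>z. finite (set_pmf (L z))"
    using re(1) unfolding region_def by auto
  define W where "W = joint_law P K L"
  have fin: "finite (set_pmf W)" unfolding W_def by (intro finite_set_joint_law fK fL) simp
  define X :: "'x \<times> 'y \<times> nat \<times> nat \<Rightarrow> 'x" where "X = fst"
  define Y :: "'x \<times> 'y \<times> nat \<times> nat \<Rightarrow> 'y" where "Y = (\<lambda>z. fst (snd z))"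
  define U :: "'x \<times> 'y \<times> nat \<times> nat \<Rightarrow> nat" where "U = (\<lambda>z. fst (snd (snd z)))"
  define V :: "'x \<times> 'y \<times> nat \<times> nat \<Rightarrow> nat" where "V = (\<lambda>z. snd (snd (snd z)))"
  have surj: "\<exists>z. X z = x \<and> Y z = y \<and> U z = u \<and> V z = v" for x y u v
    by (intro exI[of _ "(x,y,u,v)"]) (simp add: X_def Y_def U_def V_def)
  have c: "(\<lambda>(x,y,u,v). h x y u v) = (\<lambda>z. h (X z) (Y z) (U z) (V z))" for h :: "_ \<Rightarrow> _ \<Rightarrow> _ \<Rightarrow> _ \<Rightarrow> 'z"
    by (simp add: fun_eq_iff X_def Y_def U_def V_def split: prod.splits)
  have mk: "pr W (\<lambda>z. (U z, X z, Y z)) z * pr W X z = pr W (\<lambda>z. (U z, X z)) z * pr W (\<lambda>z. (X z, Y z)) z"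
    "pr W (\<lambda>z. ((U z, V z), X z, Y z)) z * pr W (\<lambda>z. (U z, Y z)) z
        = pr W (\<lambda>z. ((U z, V z), Y z)) z * pr W (\<lambda>z. (U z, X z, Y z)) z" for z
    using pr_joint_law_markov[of P K L z, folded W_def] unfolding c by simp_all
  define h1 where "h1 = (\<lambda>z. log 2 (pr W (\<lambda>z. (U z, X z)) z / (pr W X z * pr W U z)))"
  define h2 where "h2 = (\<lambda>z. log 2 (pr W (\<lambda>z. ((U z, V z), Y z)) z * pr W U z / (pr W (\<lambda>z. (U z, Y z)) z * pr W (\<lambda>z. (U z, V z)) z)))"
  define h3 where "h3 = (\<lambda>z. log 2 (pr W (\<lambda>z. (U z, Y z)) z / (pr W Y z * pr W U z)))"
  define h4 where "h4 = (\<lambda>z. log 2 (pr W (\<lambda>z. ((U z, V z), X z)) z * pr W U z / (pr W (\<lambda>z. (U z, X z)) z * pr W (\<lambda>z. (U z, V z)) z)))"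
  define v where "v h = expect W (\<lambda>z. (h z - expect W h)\<^sup>2)" for h
  note hs = h1_def h2_def h3_def h4_def
  have r_eq: "r = expect W h1 + expect W h2" and e_eq: "e = expect W h3 + expect W h4"
  proof -
    have o: "ent W (\<lambda>z. (U z, X z)) = ent W (\<lambda>z. (X z, U z))" "ent W (\<lambda>z. (Y z, U z)) = ent W (\<lambda>z. (U z, Y z))"
      "ent W (\<lambda>z. (V z, U z)) = ent W (\<lambda>z. (U z, V z))" "ent W (\<lambda>z. (V z, Y z, U z)) = ent W (\<lambda>z. ((U z, V z), Y z))"
      "ent W (\<lambda>z. (V z, X z, U z)) = ent W (\<lambda>z. ((U z, V z), X z))"
      by (intro ent_cong; auto)+
    show "r = expect W h1 + expect W h2" "e = expect W h3 + expect W h4"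
      unfolding r W_def[symmetric] rate_def expo_def c hs expect_log_ratio[OF fin] o by simp_all
  qed
  have nonneg: "0 \<le> expect W h1" "0 \<le> expect W h2"
  proof -
    have o: "ent W (\<lambda>z. (X z, U z, ())) = ent W (\<lambda>z. (U z, X z))" "ent W (\<lambda>z. (X z, ())) = ent W X" "ent W (\<lambda>z. (U z, ())) = ent W U"
      "ent W (\<lambda>z. (V z, Y z, U z)) = ent W (\<lambda>z. ((U z, V z), Y z))" "ent W (\<lambda>z. (V z, U z)) = ent W (\<lambda>z. (U z, V z))"
      "ent W (\<lambda>z. (Y z, U z)) = ent W (\<lambda>z. (U z, Y z))"
      by (intro ent_cong; auto)+
    show "0 \<le> expect W h1" "0 \<le> expect W h2"
      using ent_submodular[OF fin, of X U "\<lambda>_. ()"] ent_submodular[OF fin, of V Y U]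
      unfolding hs expect_log_ratio[OF fin] o by simp_all
  qed
  have XY: "map_pmf (\<lambda>w. (X w, Y w)) W = P"
    using map_joint_law_XY[of P K L] unfolding W_def[symmetric] c .
  show ?thesis
    unfolding feasible_exponent_def
  proof (intro allI impI)
    fix \<delta>0 :: real assume d0: "\<delta>0 > 0"
    \<comment> \<open>The rate overshoots by 4 \<delta> + 4 / n, below 8 \<delta> once 1 / n <
      \<delta>; the exponent loses only 2 \<delta> + 1 / n.\<close>
    define \<delta> where "\<delta> = \<delta>0 / 8"
    have d: "\<delta> > 0" using d0 by (simp add: \<delta>_def)
    have lim: "(\<lambda>n. v h1 / (real n * \<delta>\<^sup>2) + sqrt (2 powr (- (real n * \<delta>))) + v h2 / (real n * \<delta>\<^sup>2) + sqrt (2 powr (- (real n * \<delta>)))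
        + v h3 / (real n * \<delta>\<^sup>2) + v h4 / (real n * \<delta>\<^sup>2)) \<longlonglongrightarrow> 0"
    proof -
      have 1: "(\<lambda>n. c / (real n * \<delta>\<^sup>2)) \<longlonglongrightarrow> 0" for c
        using tendsto_mult_right_zero[OF lim_1_over_n, of "c / \<delta>\<^sup>2"] by (simp add: mult.commute)
      have 2: "(\<lambda>n. sqrt (2 powr (- (real n * \<delta>)))) \<longlonglongrightarrow> 0" using d by real_asymp
      show ?thesis
        using tendsto_add[OF tendsto_add[OF tendsto_add[OF tendsto_add[OF tendsto_add[OF 1 2] 1] 2] 1] 1] by simp
    qed
    have ev: "\<forall>\<^sub>F n in sequentially. v h1 / (real n * \<delta>\<^sup>2) + sqrt (2 powr (- (real n * \<delta>))) + v h2 / (real n * \<delta>\<^sup>2) + sqrt (2 powr (- (real n * \<delta>)))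
        + v h3 / (real n * \<delta>\<^sup>2) + v h4 / (real n * \<delta>\<^sup>2) < \<epsilon> / 2 \<and> 1 / real n < \<delta> \<and> n > 0"
      using d eps by (intro eventually_conj order_tendstoD(2)[OF lim] order_tendstoD(2)[OF lim_1_over_n] eventually_gt_at_top) auto
    then show "\<forall>\<^sub>F n in sequentially. \<exists>F G f g \<phi>. one_round_code n F G f g \<phi> \<and>
        error_exponent n (decision_prob n (independent_law P) f g \<phi> 0) \<ge> ereal (e - \<delta>0) \<and>
        (1 / real n) * log 2 (real F * real G) \<le> R + \<delta>0 \<and> decision_prob n P f g \<phi> 1 \<le> \<epsilon>"
    proof eventually_elim
      case (elim n)
      then have n: "n > 0" and n1: "1 / real n < \<delta>" by auto
      \<comment> \<open>The sizes exceed the covering thresholds by a factor 2^(n \<delta>), which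
        makes the fluctuation terms vanish.\<close>
      define a1 where "a1 = real n * (expect W h1 + 2 * \<delta>)"
      define a2 where "a2 = real n * (expect W h2 + 2 * \<delta>)"
      define M where "M = nat \<lceil>2 powr a1\<rceil>"
      define N where "N = nat \<lceil>2 powr a2\<rceil>"
      have MN: "2 powr a1 \<le> real M" "2 powr a2 \<le> real N" by (simp_all add: M_def N_def)
      have MN0: "M > 0" "N > 0" by (simp_all add: M_def N_def)
      have sq: "sqrt (2 powr (real n * (\<mu> + \<delta>)) / real B) \<le> sqrt (2 powr (- (real n * \<delta>)))"
        if "2 powr (real n * (\<mu> + 2 * \<delta>)) \<le> real B" for \<mu> :: real and B
      proof -
        have "2 powr (real n * (\<mu> + \<delta>)) = 2 powr (- (real n * \<delta>)) * 2 powr (real n * (\<mu> + 2 * \<delta>))"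
          by (simp add: algebra_simps flip: powr_add)
        also have "\<dots> \<le> 2 powr (- (real n * \<delta>)) * real B" using that by (intro mult_left_mono) auto
        finally have "2 powr (real n * (\<mu> + \<delta>)) \<le> 2 powr (- (real n * \<delta>)) * real B" .
        moreover have "real B > 0" using that less_le_trans[OF powr_gt_zero[THEN iffD2]] by fastforce
        ultimately show ?thesis by (simp add: pos_divide_le_eq)
      qed
      have err: "v h1 / (real n * \<delta>\<^sup>2) + sqrt (2 powr (real n * (expect W h1 + \<delta>)) / real M)
         + v h2 / (real n * \<delta>\<^sup>2) + sqrt (2 powr (real n * (expect W h2 + \<delta>)) / real N)
         + v h3 / (real n * \<delta>\<^sup>2) + v h4 / (real n * \<delta>\<^sup>2) \<le> \<epsilon> / 2"
        using elim sq[OF MN(1)[unfolded a1_def]] sq[OF MN(2)[unfolded a2_def]] by linarith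
      let ?R = "replicate_pmf n W"
      have eps2: "\<epsilon> / 2 > 0" using eps by simp
      obtain f g acc where fg: "\<And>x. f x \<le> M" "\<And>y m. m \<le> M \<Longrightarrow> g y m \<le> N"
        "measure (map_pmf (\<lambda>w. (map X w, map Y w)) ?R) {(x, y). \<not> acc x (f x) (g y (f x))} \<le> 2 * (\<epsilon> / 2)"
        "measure (pair_pmf (map_pmf (map X) ?R) (map_pmf (map Y) ?R)) {(x, y). acc x (f x) (g y (f x))}
          \<le> 2 / (2 powr (real n * (expect W h3 - \<delta>)) * 2 powr (real n * (expect W h4 - \<delta>)))"
        by (rule block_code[where X=X and Y=Y and U=U and V=V, OF fin n d MN0 eps2 surj mk err[unfolded v_def hs], folded hs]) blast
      have seq: "map_pmf (\<lambda>w. (map X w, map Y w)) ?R = seq_law n P"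
        unfolding seq_law_def XY[symmetric] map_replicate_pmf[symmetric] by (simp add: map_pmf_comp o_def)
      have seqX: "map_pmf (map X) ?R = map_pmf fst (seq_law n P)" and seqY: "map_pmf (map Y) ?R = map_pmf snd (seq_law n P)"
        unfolding seq[symmetric] by (simp_all add: map_pmf_comp)
      \<comment> \<open>Messages of a code start at 1, those of the construction at 0; the sizes
        \<open>M + 1\<close> and \<open>N + 1\<close> include the rejection messages.\<close>
      define f' where "f' xs = f xs + 1" for xs
      define g' where "g' = (\<lambda>(ys, m). g ys (m - 1) + 1)"
      define \<phi> where "\<phi> = (\<lambda>(xs, j). if acc xs (f xs) (j - 1) then 0 else (1::nat))"
      have dec: "\<phi> (x, g' (y, f' x)) = (if acc x (f x) (g y (f x)) then 0 else 1)" for x y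
        by (simp add: \<phi>_def g'_def f'_def)
      have "one_round_code n (M + 1) (N + 1) f' g' \<phi>"
        using fg(1) by (auto simp: one_round_code_def f'_def g'_def \<phi>_def intro!: fg(2))
      moreover have "decision_prob n P f' g' \<phi> 1 \<le> \<epsilon>"
        using fg(3) unfolding decision_prob_seq_law dec seq by (simp add: case_prod_unfold)
      moreover have "(1 / real n) * log 2 (real (M + 1) * real (N + 1)) \<le> R + \<delta>0"
      proof -
        have "log 2 (real (M + 1) * real (N + 1)) = log 2 (real (M + 1)) + log 2 (real (N + 1))"
          by (simp add: log_mult)
        also have "\<dots> \<le> (a1 + 2) + (a2 + 2)"
          unfolding M_def N_def using nonneg d by (intro add_mono log_codebook_size) (auto simp: a1_def a2_def)
        also have "\<dots> = real n * (r + 4 * \<delta>) + 4" by (simp add: a1_def a2_def r_eq algebra_simps)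
        finally have "(1 / real n) * log 2 (real (M + 1) * real (N + 1)) \<le> (1 / real n) * (real n * (r + 4 * \<delta>) + 4)"
          by (intro mult_left_mono) auto
        also have "\<dots> = r + 4 * \<delta> + 4 * (1 / real n)" using n by (simp add: distrib_left)
        also have "\<dots> \<le> R + \<delta>0" using re(2) n1 by (simp add: \<delta>_def)
        finally show ?thesis .
      qed
      moreover have "error_exponent n (decision_prob n (independent_law P) f' g' \<phi> 0) \<ge> ereal (e - \<delta>0)"
      proof -
        let ?b = "decision_prob n (independent_law P) f' g' \<phi> 0"
        have "?b \<le> 2 / (2 powr (real n * (expect W h3 - \<delta>)) * 2 powr (real n * (expect W h4 - \<delta>)))"
          using fg(4) unfolding decision_prob_seq_law seq_law_independent dec seqX seqY by (simp add: case_prod_unfold)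
        also have "2 powr (real n * (expect W h3 - \<delta>)) * 2 powr (real n * (expect W h4 - \<delta>)) = (2::real) powr (real n * (e - 2 * \<delta>))"
          by (simp add: e_eq algebra_simps flip: powr_add)
        also have "2 / 2 powr (real n * (e - 2 * \<delta>)) = (2::real) powr (1 - real n * (e - 2 * \<delta>))"
          by (simp add: powr_diff)
        finally have b: "?b \<le> 2 powr (1 - real n * (e - 2 * \<delta>))" .
        show ?thesis
        proof (cases "?b = 0")
          case False
          then have pos: "?b > 0" by (simp add: decision_prob_def zero_less_measure_iff)
          have "log 2 ?b \<le> 1 - real n * (e - 2 * \<delta>)" using b pos by (simp add: log_le_iff)
          then have "(1 / real n) * log 2 ?b \<le> (1 / real n) * (1 - real n * (e - 2 * \<delta>))"
            by (intro mult_left_mono) auto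
          also have "\<dots> = 1 / real n - (e - 2 * \<delta>)" using n by (simp add: right_diff_distrib)
          finally have "e - \<delta>0 \<le> - (1 / real n) * log 2 ?b" using n1 d by (simp add: \<delta>_def)
          then show ?thesis using False by (simp add: error_exponent_def)
        qed (simp add: error_exponent_def)
      qed
      ultimately show ?case by blast
    qed
  qed
qed

theorem theorem1:
  fixes P :: "('x::finite \<times> 'y::finite) pmf" and R :: real
  assumes "R \<ge> 0"
  shows "\<exists>E. is_maximum (exponent_values P R) E \<and>
    ((\<lambda>\<epsilon>. optimal_exponent P (independent_law P) R \<epsilon>) \<longlongrightarrow> ereal E) (at_right 0)"
proof -
  obtain r E where E: "(r, E) \<in> region P" "r \<le> R" and mx: "\<And>r' e'. (r', e') \<in> region P \<Longrightarrow> r' \<le> R \<Longrightarrow> e' \<le> E"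
    using region_attains_max[OF region_zero[of P] assms] by blast
  have "is_maximum (exponent_values P R) E"
    using E mx by (auto simp: is_maximum_def exponent_values_region)
  moreover have "((\<lambda>\<epsilon>. optimal_exponent P (independent_law P) R \<epsilon>) \<longlongrightarrow> ereal E) (at_right 0)"
  \<comment> \<open>For 0 < \<epsilon> < 1 the optimal exponent lies between E, by achievability,
    and E / (1 - \<epsilon>), by the weak converse.\<close>
  proof (rule tendsto_sandwich[of "\<lambda>_. ereal E" _ _ "\<lambda>\<epsilon>. ereal (E / (1 - \<epsilon>))"])
    have near: "\<forall>\<^sub>F \<epsilon> in at_right 0. 0 < \<epsilon> \<and> \<epsilon> < (1::real)"
      by (auto simp: eventually_at_right_field intro: exI[of _ 1])
    show "\<forall>\<^sub>F \<epsilon> in at_right 0. ereal E \<le> optimal_exponent P (independent_law P) R \<epsilon>"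
      using near
    proof eventually_elim
      case (elim \<epsilon>)
      then have "feasible_exponent P (independent_law P) R \<epsilon> E" using achievability[OF E] by blast
      then show ?case unfolding optimal_exponent_def by (intro Sup_upper) auto
    qed
    show "\<forall>\<^sub>F \<epsilon> in at_right 0. optimal_exponent P (independent_law P) R \<epsilon> \<le> ereal (E / (1 - \<epsilon>))"
      using near
    proof eventually_elim
      case (elim \<epsilon>)
      then have eps: "\<epsilon> < 1" by simp
      have "E' \<le> E / (1 - \<epsilon>)" if "feasible_exponent P (independent_law P) R \<epsilon> E'" for E'
        using feasible_exponent_le[OF that eps assms mx] eps by (simp add: pos_le_divide_eq mult.commute)
      then show ?case unfolding optimal_exponent_def by (intro Sup_least) auto
    qed
    have "((\<lambda>\<epsilon>. E / (1 - \<epsilon>)) \<longlongrightarrow> E / (1 - 0)) (at_right 0)" by (intro tendsto_intros) auto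
    then show "((\<lambda>\<epsilon>. ereal (E / (1 - \<epsilon>))) \<longlongrightarrow> ereal E) (at_right 0)" by simp
  qed simp
  ultimately show ?thesis by blast
qed

end
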